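(* Let $n\ge 3$, suppose the $n$-dimensional pseudo-manifold $\widehat{M}$ has an even triangulation, and let $1<k\le \frac{n+1}{2}$. Then the induced representation $\rho_{k\mid n-k+1}\colon\pi_1(M)\to\mathrm{Sym}(N)$ leaves each component of the $(k,n-k+1)$-hypersurface $Q$ invariant. Moreover, $\operatorname{im}(\rho_{k\mid n-k+1})$ is trivial if and only if $Q$ has $N$ components. In this case, each of these components is an embedded normal hypersurface in $\widehat{M}$. Here $N$ is the number of unordered partitions of a set of $n+1$ elements into two sets of sizes $k$ and $n-k+1$.
   Context: Triangulations. Let $\widetilde{\Delta}$ be a finite union of pairwise disjoint, oriented Euclidean $n$-simplices, with each facet ($(n-1)$-simplex) $\tau$ the domain of a unique face pairing $\varphi_\tau\in\Phi$, where $\Phi$ is a family, closed under inverses, of orientation-reversing affine isomorphisms between facets. The quotient $\widehat{M}=\widetilde{\Delta}/\Phi$ with quotient map $p$ is a closed orientable $n$-dimensional pseudo-manifold, assumed connected; $(\widetilde{\Delta},\Phi,p)$ is a (singular) triangulation. Images of $k$-simplices are $k$-singlices; the degree of a $k$-singlex is the number of $k$-simplices mapped onto it. The triangulation is even if every $(n-2)$-singlex has even degree. $M=\widehat{M}\setminus\widehat{M}^{(0)}$ is the complement of the vertices. Standing convention: $\pi_1(M,x_0)$ ($x_0$ the barycentre of a base $n$-simplex $\sigma_0$) is presented with generators represented by loops in the dual 1-skeleton and relators arising from the cells of the dual 2-skeleton (one 2-cell per $(n-2)$-singlex). Representations. For a facet $\tau$ of an $n$-simplex $\sigma_\tau$,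 the perspectivity $p_\tau\colon\sigma_\tau\to\sigma_{\varphi_\tau(\tau)}$ is the bijection of vertex sets that agrees with $\varphi_\tau$ on $\tau$ and sends the vertex opposite $\tau$ to the vertex opposite $\varphi_\tau(\tau)$. A loop $\gamma$ in the dual 1-skeleton based at $x_0$ crossing successively the facets $\tau_0,\dots,\tau_m$ has projectivity $p_\gamma=p_{\tau_m}\circ\cdots\circ p_{\tau_0}\in\mathrm{Sym}(\sigma_0)$. For an even triangulation, $\rho\colon[\gamma]\mapsto p_\gamma$ is a homomorphism $\pi_1(M,x_0)\to\mathrm{Sym}(\sigma_0)\cong\mathrm{Sym}(n+1)$, the canonical symmetric representation. The induced action of $\rho$ on the set of the $N$ unordered partitions of the vertices of $\sigma_0$ into two sets of sizes $k$ and $n-k+1$ is $\rho_{k\mid n-k+1}\colon\pi_1(M)\to\mathrm{Sym}(N)$. (So $N=\binom{n+1}{k}$, or $\frac12\binom{n+1}{k}$ if $k=\frac{n+1}2$.) Hypersurface. A $(k,n-k+1)$-normal disc type of an $n$-simplex $\sigma$ is such a partition $\nu=\{A,B\}$ of its vertices, represented by the disc $\overline\nu$ which is the convex hull of the midpoints of all edges with one endpoint in $A$ and the other in $B$ ($\sigma$ regular Euclidean); a normal disc of type $\nu$ is a properly embedded PL $(n-1)$-cell isotopic to $\overline\nu$ through isotopies preserving all faces. The $(k,n-k+1)$-hypersurface $Q$ is obtained by taking one disc $\overline\nu$ for each $(k,n-k+1)$-type $\nu$ in each $n$-simplex, and gluing across each facet $\tau$ the disc of type $\nu$ to the disc of type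 $p_\tau(\nu)$ along their boundary facets via $\varphi_\tau$; it comes with a natural map to $\widehat M$. "Leaves a component $Q_0$ invariant" means that the set of $(k,n-k+1)$-normal disc types in $\sigma_0$ whose disc lies in $Q_0$ is preserved by the action of $\rho_{k\mid n-k+1}$. A component is an embedded normal hypersurface if it can be realised (by normal discs) as an embedding in $\widehat M$. *)

theory Defs
  imports
    "HOL-Analysis.Analysis"
    "HOL-Algebra.Bij"
    "HOL-Combinatorics.Multiset_Permutations"
begin

section \<open>Quotient spaces\<close>

definition generated_equiv :: "'a set \<Rightarrow> ('a \<times> 'a) set \<Rightarrow> ('a \<times> 'a) set" where
  "generated_equiv S R = (Restr R S \<union> (Restr R S)\<inverse>)\<^sup>* \<inter> S \<times> S"

definition quotient_topology :: "'a topology \<Rightarrow> ('a \<times> 'a) set \<Rightarrow> 'a set topology" where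
  "quotient_topology X r = topology (\<lambda>\<U>. \<U> \<subseteq> topspace X // r \<and> openin X (\<Union>\<U>))"

lemma istopology_quotient:
  assumes "equiv (topspace X) r"
  shows "istopology (\<lambda>\<U>. \<U> \<subseteq> topspace X // r \<and> openin X (\<Union>\<U>))"
  unfolding istopology_def
proof (intro conjI allI impI)
  fix \<U> \<V>
  assume U: "\<U> \<subseteq> topspace X // r \<and> openin X (\<Union>\<U>)"
    and V: "\<V> \<subseteq> topspace X // r \<and> openin X (\<Union>\<V>)"
  have "\<Union>(\<U> \<inter> \<V>) = \<Union>\<U> \<inter> \<Union>\<V>"
    using U V quotient_disj [OF assms] by blast
  then show "\<U> \<inter> \<V> \<subseteq> topspace X // r" "openin X (\<Union>(\<U> \<inter> \<V>))"
    using U V by auto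
next
  fix \<K> :: "'a set set set"
  assume K: "\<forall>\<U>\<in>\<K>. \<U> \<subseteq> topspace X // r \<and> openin X (\<Union>\<U>)"
  have "\<Union>(\<Union>\<K>) = \<Union>(Union ` \<K>)"
    by blast
  then show "\<Union>\<K> \<subseteq> topspace X // r" "openin X (\<Union>(\<Union>\<K>))"
    using K by auto
qed

section \<open>Triangulations\<close>

definition verts :: "'a::euclidean_space set \<Rightarrow> 'a set" where
  "verts \<sigma> = {v. v extreme_point_of \<sigma>}"

definition affine_map_on :: "'a::euclidean_space set \<Rightarrow> ('a \<Rightarrow> 'a) \<Rightarrow> bool" where
  "affine_map_on S f \<longleftrightarrow> (\<exists>L c. linear L \<and> (\<forall>x\<in>S. f x = L x + c))"

definition facets :: "'a::euclidean_space set set \<Rightarrow> 'a set set" where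
  "facets T = {\<tau>. \<exists>\<sigma>\<in>T. \<tau> facet_of \<sigma>}"

definition simplex_of :: "'a::euclidean_space set set \<Rightarrow> 'a set \<Rightarrow> 'a set" where
  "simplex_of T \<tau> = (THE \<sigma>. \<sigma> \<in> T \<and> \<tau> facet_of \<sigma>)"

definition opposite :: "'a::euclidean_space set set \<Rightarrow> 'a set \<Rightarrow> 'a" where
  "opposite T \<tau> = (THE v. v \<in> verts (simplex_of T \<tau>) - verts \<tau>)"

text \<open>An orientation is a class of orderings of the vertices modulo even permutations.\<close>

definition is_orientation :: "'a set \<Rightarrow> 'a list set \<Rightarrow> bool" where
  "is_orientation V \<omega> \<longleftrightarrow>
     (\<exists>vs\<in>permutations_of_set V.
        \<omega> = {permute_list \<pi> vs | \<pi>. \<pi> permutes {..<length vs} \<and> evenperm \<pi>})"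

definition induced_orientation ::
  "'a::euclidean_space set set \<Rightarrow> ('a set \<Rightarrow> 'a list set) \<Rightarrow> 'a set \<Rightarrow> 'a list set" where
  "induced_orientation T \<omega> \<tau> =
     {ws \<in> permutations_of_set (verts \<tau>). opposite T \<tau> # ws \<in> \<omega> (simplex_of T \<tau>)}"

text \<open>
  \<open>T\<close> is the set of \<open>n\<close>-simplices, \<open>\<omega> \<sigma>\<close> the orientation of \<open>\<sigma>\<close>, and \<open>\<Phi> \<tau>\<close> the face pairing
  with domain \<open>\<tau>\<close> (only its values on \<open>\<tau>\<close> matter), so that \<open>\<Phi> \<tau> ` \<tau>\<close> is the facet paired
  with \<open>\<tau>\<close>.
\<close>

definition face_equiv ::
  "'a::euclidean_space set set \<Rightarrow> ('a set \<Rightarrow> 'a \<Rightarrow> 'a) \<Rightarrow> ('a \<times> 'a) set" where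
  "face_equiv T \<Phi> = generated_equiv (\<Union>T) {(x, \<Phi> \<tau> x) | \<tau> x. \<tau> \<in> facets T \<and> x \<in> \<tau>}"

definition pseudo_manifold ::
  "'a::euclidean_space set set \<Rightarrow> ('a set \<Rightarrow> 'a \<Rightarrow> 'a) \<Rightarrow> 'a set topology" where
  "pseudo_manifold T \<Phi> = quotient_topology (top_of_set (\<Union>T)) (face_equiv T \<Phi>)"

definition proj ::
  "'a::euclidean_space set set \<Rightarrow> ('a set \<Rightarrow> 'a \<Rightarrow> 'a) \<Rightarrow> 'a \<Rightarrow> 'a set" where
  "proj T \<Phi> x = face_equiv T \<Phi> `` {x}"

definition triangulation ::
  "nat \<Rightarrow> 'a::euclidean_space set set \<Rightarrow> ('a set \<Rightarrow> 'a list set) \<Rightarrow> ('a set \<Rightarrow> 'a \<Rightarrow> 'a) \<Rightarrow> bool"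
where
  "triangulation n T \<omega> \<Phi> \<longleftrightarrow>
     finite T \<and> (\<forall>\<sigma>\<in>T. int n simplex \<sigma>) \<and> pairwise disjnt T \<and>
     (\<forall>\<sigma>\<in>T. is_orientation (verts \<sigma>) (\<omega> \<sigma>)) \<and>
     (\<forall>\<tau>\<in>facets T. \<Phi> \<tau> ` \<tau> \<in> facets T \<and> affine_map_on \<tau> (\<Phi> \<tau>) \<and>
        (\<forall>x\<in>\<tau>. \<Phi> (\<Phi> \<tau> ` \<tau>) (\<Phi> \<tau> x) = x) \<and>
        (\<forall>ws\<in>induced_orientation T \<omega> \<tau>. map (\<Phi> \<tau>) ws \<notin> induced_orientation T \<omega> (\<Phi> \<tau> ` \<tau>))) \<and>
     connected_space (pseudo_manifold T \<Phi>)"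

definition simplices :: "int \<Rightarrow> 'a::euclidean_space set set \<Rightarrow> 'a set set" where
  "simplices d T = {\<eta>. aff_dim \<eta> = d \<and> (\<exists>\<sigma>\<in>T. \<eta> face_of \<sigma>)}"

definition singlices ::
  "int \<Rightarrow> 'a::euclidean_space set set \<Rightarrow> ('a set \<Rightarrow> 'a \<Rightarrow> 'a) \<Rightarrow> 'a set set set" where
  "singlices d T \<Phi> = (\<lambda>\<eta>. proj T \<Phi> ` \<eta>) ` simplices d T"

definition singlex_degree ::
  "int \<Rightarrow> 'a::euclidean_space set set \<Rightarrow> ('a set \<Rightarrow> 'a \<Rightarrow> 'a) \<Rightarrow> 'a set set \<Rightarrow> nat" where
  "singlex_degree d T \<Phi> s = card {\<eta> \<in> simplices d T. proj T \<Phi> ` \<eta> = s}"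

definition even_triangulation ::
  "nat \<Rightarrow> 'a::euclidean_space set set \<Rightarrow> ('a set \<Rightarrow> 'a list set) \<Rightarrow> ('a set \<Rightarrow> 'a \<Rightarrow> 'a) \<Rightarrow> bool"
where
  "even_triangulation n T \<omega> \<Phi> \<longleftrightarrow>
     triangulation n T \<omega> \<Phi> \<and>
     (\<forall>s\<in>singlices (int n - 2) T \<Phi>. even (singlex_degree (int n - 2) T \<Phi> s))"

section \<open>Fundamental group and symmetric representation\<close>

text \<open>A path in the dual 1-skeleton is the list of the facets through which it leaves the
  successive \<open>n\<close>-simplices.\<close>

fun dual_path ::
  "'a::euclidean_space set set \<Rightarrow> ('a set \<Rightarrow> 'a \<Rightarrow> 'a) \<Rightarrow> 'a set \<Rightarrow> 'a set list \<Rightarrow> 'a set \<Rightarrow> bool"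
where
  "dual_path T \<Phi> \<sigma> [] \<sigma>' \<longleftrightarrow> \<sigma> \<in> T \<and> \<sigma> = \<sigma>'"
| "dual_path T \<Phi> \<sigma> (\<tau> # \<gamma>) \<sigma>' \<longleftrightarrow>
     \<sigma> \<in> T \<and> \<tau> facet_of \<sigma> \<and> dual_path T \<Phi> (simplex_of T (\<Phi> \<tau> ` \<tau>)) \<gamma> \<sigma>'"

definition dual_loops ::
  "'a::euclidean_space set set \<Rightarrow> ('a set \<Rightarrow> 'a \<Rightarrow> 'a) \<Rightarrow> 'a set \<Rightarrow> 'a set list set" where
  "dual_loops T \<Phi> \<sigma> = {\<gamma>. dual_path T \<Phi> \<sigma> \<gamma> \<sigma>}"

text \<open>\<open>turns_about \<Phi> \<eta> \<gamma>\<close>: all facets crossed by \<open>\<gamma>\<close> contain the current copy of \<open>\<eta>\<close>, and each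
  simplex is left through the facet at \<open>\<eta>\<close> other than the one by which it was entered.\<close>

fun turns_about ::
  "('a::euclidean_space set \<Rightarrow> 'a \<Rightarrow> 'a) \<Rightarrow> 'a set \<Rightarrow> 'a set list \<Rightarrow> bool"
where
  "turns_about \<Phi> \<eta> [] \<longleftrightarrow> True"
| "turns_about \<Phi> \<eta> [\<tau>] \<longleftrightarrow> \<eta> \<subseteq> \<tau>"
| "turns_about \<Phi> \<eta> (\<tau> # \<tau>' # \<gamma>) \<longleftrightarrow>
     \<eta> \<subseteq> \<tau> \<and> \<tau>' \<noteq> \<Phi> \<tau> ` \<tau> \<and> turns_about \<Phi> (\<Phi> \<tau> ` \<eta>) (\<tau>' # \<gamma>)"

text \<open>Boundaries of the dual 2-cell at an \<open>(n-2)\<close>-face \<open>\<eta>\<close> of \<open>\<sigma>\<close>: loops that run about \<open>\<eta>\<close>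
  until they are about to leave \<open>\<sigma>\<close> through the initial facet again, with the composition of the
  face pairings being the identity on \<open>\<eta>\<close> (this is automatic if the face pairings do not identify
  \<open>\<eta>\<close> with itself in a nontrivial way). Multiple turns are powers of the single turn, so admitting
  them does not change the group presented.\<close>

definition dual_cell_boundaries ::
  "nat \<Rightarrow> 'a::euclidean_space set set \<Rightarrow> ('a set \<Rightarrow> 'a \<Rightarrow> 'a) \<Rightarrow> 'a set \<Rightarrow> 'a set list set" where
  "dual_cell_boundaries n T \<Phi> \<sigma> =
     {r \<in> dual_loops T \<Phi> \<sigma>. r \<noteq> [] \<and>
        (\<exists>\<eta>. \<eta> face_of \<sigma> \<and> aff_dim \<eta> = int n - 2 \<and>
             turns_about \<Phi> \<eta> (r @ [hd r]) \<and> (\<forall>x\<in>\<eta>. fold \<Phi> r x = x))}"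

definition backtrackings ::
  "'a::euclidean_space set set \<Rightarrow> ('a set \<Rightarrow> 'a \<Rightarrow> 'a) \<Rightarrow> 'a set \<Rightarrow> 'a set list set" where
  "backtrackings T \<Phi> \<sigma> = {[\<tau>, \<Phi> \<tau> ` \<tau>] | \<tau>. \<tau> facet_of \<sigma>}"

definition dual_homotopy ::
  "nat \<Rightarrow> 'a::euclidean_space set set \<Rightarrow> ('a set \<Rightarrow> 'a \<Rightarrow> 'a) \<Rightarrow> 'a set \<Rightarrow>
     ('a set list \<times> 'a set list) set" where
  "dual_homotopy n T \<Phi> \<sigma>\<^sub>0 =
     generated_equiv (dual_loops T \<Phi> \<sigma>\<^sub>0)
       {(\<gamma> @ r @ \<delta>, \<gamma> @ \<delta>) | \<gamma> r \<delta>.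
          \<exists>\<sigma>. dual_path T \<Phi> \<sigma>\<^sub>0 \<gamma> \<sigma> \<and> r \<in> backtrackings T \<Phi> \<sigma> \<union> dual_cell_boundaries n T \<Phi> \<sigma>}"

text \<open>The fundamental group of the complement of the vertices is taken as presented by the dual
  2-skeleton: loops in the dual 1-skeleton modulo backtrackings and boundaries of dual 2-cells.
  The product \<open>[\<gamma>] \<cdot> [\<delta>]\<close> is the class of the loop running through \<open>\<delta>\<close> first; with this order
  \<open>[\<gamma>] \<mapsto> p\<^sub>\<gamma>\<close> is a homomorphism for composition of maps.\<close>

definition dual_pi1 ::
  "nat \<Rightarrow> 'a::euclidean_space set set \<Rightarrow> ('a set \<Rightarrow> 'a \<Rightarrow> 'a) \<Rightarrow> 'a set \<Rightarrow> 'a set list set monoid"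
where
  "dual_pi1 n T \<Phi> \<sigma>\<^sub>0 =
     \<lparr>carrier = dual_loops T \<Phi> \<sigma>\<^sub>0 // dual_homotopy n T \<Phi> \<sigma>\<^sub>0,
      mult = (\<lambda>X Y. \<Union>\<gamma>\<in>X. \<Union>\<delta>\<in>Y. dual_homotopy n T \<Phi> \<sigma>\<^sub>0 `` {\<delta> @ \<gamma>}),
      one = dual_homotopy n T \<Phi> \<sigma>\<^sub>0 `` {[]}\<rparr>"

definition perspectivity ::
  "'a::euclidean_space set set \<Rightarrow> ('a set \<Rightarrow> 'a \<Rightarrow> 'a) \<Rightarrow> 'a set \<Rightarrow> 'a \<Rightarrow> 'a" where
  "perspectivity T \<Phi> \<tau> v = (if v \<in> \<tau> then \<Phi> \<tau> v else opposite T (\<Phi> \<tau> ` \<tau>))"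

definition projectivity ::
  "'a::euclidean_space set set \<Rightarrow> ('a set \<Rightarrow> 'a \<Rightarrow> 'a) \<Rightarrow> 'a set list \<Rightarrow> 'a \<Rightarrow> 'a" where
  "projectivity T \<Phi> \<gamma> = fold (perspectivity T \<Phi>) \<gamma>"

text \<open>The canonical symmetric representation, as a map from the group above to
  \<open>BijGroup (verts \<sigma>\<^sub>0)\<close>.\<close>

definition symmetric_rep ::
  "'a::euclidean_space set set \<Rightarrow> ('a set \<Rightarrow> 'a \<Rightarrow> 'a) \<Rightarrow> 'a set \<Rightarrow> 'a set list set \<Rightarrow> 'a \<Rightarrow> 'a" where
  "symmetric_rep T \<Phi> \<sigma>\<^sub>0 c =
     the_elem ((\<lambda>\<gamma>. restrict (projectivity T \<Phi> \<gamma>) (verts \<sigma>\<^sub>0)) ` c)"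

definition bipartitions :: "'b set \<Rightarrow> nat \<Rightarrow> 'b set set set" where
  "bipartitions V k =
     {{A, B} | A B. A \<union> B = V \<and> A \<inter> B = {} \<and> card A = k \<and> card B = card V - k}"

definition disc_types :: "nat \<Rightarrow> 'a::euclidean_space set \<Rightarrow> 'a set set set" where
  "disc_types k \<sigma> = bipartitions (verts \<sigma>) k"

definition induced_rep ::
  "nat \<Rightarrow> 'a::euclidean_space set set \<Rightarrow> ('a set \<Rightarrow> 'a \<Rightarrow> 'a) \<Rightarrow> 'a set \<Rightarrow>
     'a set list set \<Rightarrow> 'a set set \<Rightarrow> 'a set set" where
  "induced_rep k T \<Phi> \<sigma>\<^sub>0 c = (\<lambda>\<nu>\<in>disc_types k \<sigma>\<^sub>0. (`) (symmetric_rep T \<Phi> \<sigma>\<^sub>0 c) ` \<nu>)"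

section \<open>The hypersurface\<close>

text \<open>Midpoints and convex hulls are respected by affine maps, so the simplices need not be
  regular.\<close>

definition disc :: "'a::euclidean_space set set \<Rightarrow> 'a set" where
  "disc \<nu> = convex hull {midpoint a b | a b A B. A \<in> \<nu> \<and> B \<in> \<nu> \<and> A \<noteq> B \<and> a \<in> A \<and> b \<in> B}"

definition all_disc_types :: "nat \<Rightarrow> 'a::euclidean_space set set \<Rightarrow> 'a set set set" where
  "all_disc_types k T = (\<Union>\<sigma>\<in>T. disc_types k \<sigma>)"

definition disjoint_discs ::
  "nat \<Rightarrow> 'a::euclidean_space set set \<Rightarrow> ('a set set \<times> 'a) topology" where
  "disjoint_discs k T = sum_topology (\<lambda>\<nu>. top_of_set (disc \<nu>)) (all_disc_types k T)"

definition disc_gluing ::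
  "nat \<Rightarrow> 'a::euclidean_space set set \<Rightarrow> ('a set \<Rightarrow> 'a \<Rightarrow> 'a) \<Rightarrow>
     (('a set set \<times> 'a) \<times> ('a set set \<times> 'a)) set" where
  "disc_gluing k T \<Phi> =
     generated_equiv (topspace (disjoint_discs k T))
       {((\<nu>, x), ((`) (perspectivity T \<Phi> \<tau>) ` \<nu>, \<Phi> \<tau> x)) | \<nu> x \<tau>.
          \<tau> \<in> facets T \<and> \<nu> \<in> disc_types k (simplex_of T \<tau>) \<and> x \<in> disc \<nu> \<inter> \<tau>}"

definition hypersurface ::
  "nat \<Rightarrow> 'a::euclidean_space set set \<Rightarrow> ('a set \<Rightarrow> 'a \<Rightarrow> 'a) \<Rightarrow> ('a set set \<times> 'a) set topology"
where
  "hypersurface k T \<Phi> = quotient_topology (disjoint_discs k T) (disc_gluing k T \<Phi>)"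

definition disc_in_hypersurface ::
  "nat \<Rightarrow> 'a::euclidean_space set set \<Rightarrow> ('a set \<Rightarrow> 'a \<Rightarrow> 'a) \<Rightarrow> 'a set set \<Rightarrow>
     ('a set set \<times> 'a) set set" where
  "disc_in_hypersurface k T \<Phi> \<nu> = (\<lambda>x. disc_gluing k T \<Phi> `` {(\<nu>, x)}) ` disc \<nu>"

definition component_types ::
  "nat \<Rightarrow> 'a::euclidean_space set set \<Rightarrow> ('a set \<Rightarrow> 'a \<Rightarrow> 'a) \<Rightarrow> 'a set \<Rightarrow>
     ('a set set \<times> 'a) set set \<Rightarrow> 'a set set set" where
  "component_types k T \<Phi> \<sigma> Q\<^sub>0 = {\<nu> \<in> disc_types k \<sigma>. disc_in_hypersurface k T \<Phi> \<nu> \<subseteq> Q\<^sub>0}"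

definition pl_homeomorphism ::
  "'a::euclidean_space set \<Rightarrow> 'a set \<Rightarrow> ('a \<Rightarrow> 'a) \<Rightarrow> bool" where
  "pl_homeomorphism P D f \<longleftrightarrow> bij_betw f P D \<and>
     (\<exists>\<P>. finite \<P> \<and> P = \<Union>\<P> \<and> (\<forall>S\<in>\<P>. polytope S \<and> affine_map_on S f))"

definition proper_pl_cell :: "int \<Rightarrow> 'a::euclidean_space set \<Rightarrow> 'a set \<Rightarrow> bool" where
  "proper_pl_cell d \<sigma> D \<longleftrightarrow> D \<subseteq> \<sigma> \<and>
     (\<exists>P f. polytope P \<and> aff_dim P = d \<and> pl_homeomorphism P D f \<and>
            D \<inter> rel_frontier \<sigma> = f ` rel_frontier P)"

definition normal_isotopic ::
  "'a::euclidean_space set \<Rightarrow> 'a set \<Rightarrow> 'a set \<Rightarrow> bool" where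
  "normal_isotopic \<sigma> D\<^sub>0 D\<^sub>1 \<longleftrightarrow>
     (\<exists>H :: real \<Rightarrow> 'a \<Rightarrow> 'a.
        continuous_on ({0..1} \<times> \<sigma>) (\<lambda>(t, x). H t x) \<and>
        (\<forall>t\<in>{0..1}. inj_on (H t) \<sigma> \<and> (\<forall>F. F face_of \<sigma> \<longrightarrow> H t ` F = F)) \<and>
        (\<forall>x\<in>\<sigma>. H 0 x = x) \<and> H 1 ` D\<^sub>0 = D\<^sub>1)"

definition normal_disc ::
  "nat \<Rightarrow> 'a::euclidean_space set \<Rightarrow> 'a set set \<Rightarrow> 'a set \<Rightarrow> bool" where
  "normal_disc n \<sigma> \<nu> D \<longleftrightarrow> proper_pl_cell (int n - 1) \<sigma> D \<and> normal_isotopic \<sigma> (disc \<nu>) D"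

text \<open>The realisation \<open>f\<close> maps the disc of each type \<open>\<nu>\<close> in the component onto the image of the
  normal disc \<open>h \<nu> ` disc \<nu>\<close> of type \<open>\<nu>\<close>.\<close>

definition embedded_normal_hypersurface ::
  "nat \<Rightarrow> nat \<Rightarrow> 'a::euclidean_space set set \<Rightarrow> ('a set \<Rightarrow> 'a \<Rightarrow> 'a) \<Rightarrow>
     ('a set set \<times> 'a) set set \<Rightarrow> bool" where
  "embedded_normal_hypersurface n k T \<Phi> Q\<^sub>0 \<longleftrightarrow>
     (\<exists>f h. embedding_map (subtopology (hypersurface k T \<Phi>) Q\<^sub>0) (pseudo_manifold T \<Phi>) f \<and>
        (\<forall>\<sigma>\<in>T. \<forall>\<nu>\<in>component_types k T \<Phi> \<sigma> Q\<^sub>0.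
           normal_disc n \<sigma> \<nu> (h \<nu> ` disc \<nu>) \<and>
           continuous_on (disc \<nu>) (h \<nu>) \<and> inj_on (h \<nu>) (disc \<nu>) \<and>
           (\<forall>F. F face_of \<sigma> \<longrightarrow> h \<nu> ` (disc \<nu> \<inter> F) = h \<nu> ` disc \<nu> \<inter> F) \<and>
           (\<forall>x\<in>disc \<nu>. f (disc_gluing k T \<Phi> `` {(\<nu>, x)}) = proj T \<Phi> (h \<nu> x))))"

end

theory Submission
  imports Defs
begin

text \<open>
  Turning about a codimension two face fixes the vertices of that face and exchanges, at every
  facet crossed, the roles of the two remaining vertices. Evenness makes every full turn an even
  number of crossings, so projectivities are homotopy invariant. As \<open>1 < k < n\<close>, every disc meets
  every facet of its simplex; hence the components of the hypersurface correspond to the classes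
  of disc types under perspectivities, and, by connectedness of the dual graph, to the orbits of
  the fundamental group on the disc types of \<open>\<sigma>\<^sub>0\<close>. If the action is trivial, a component contains
  exactly one disc of each simplex, and its natural map to the pseudo-manifold is an injective
  closed map, the realising normal discs being the discs themselves.
\<close>

section \<open>Quotient spaces\<close>

text \<open>The degree of a singlex counts simplices, while a loop about a codimension two face
  counts crossings, and the two numbers may differ: the loop may run round several times, or meet
  the same face again with its two facets interchanged. Turning is therefore modelled as a product
  of two involutions on flags: crossing a facet, and exchanging the two vertices off the face. If a
  flag returned after an odd number of turns, the dihedral relation would forbid meeting any face in
  both directions. The orbit would then list every face over the singlex exactly once, and its size,
  a divisor of the odd period, would be the degree. So even degrees exclude odd periods. That the
  orbit misses no face over the singlex is seen by following a relative interior point through the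
  pairings.

  On the geometric side, the bounds on \<open>k\<close> give both blocks of a type at least two
  vertices, so a disc survives in the facet opposite any vertex. The disc is also the slice of its
  simplex by a hyperplane through the relative interior, which determines its dimension and
  boundary.\<close>

lemma equiv_generated_equiv: "equiv S (generated_equiv S R)"
proof -
  let ?Q = "Restr R S \<union> (Restr R S)\<inverse>"
  have "sym (?Q\<^sup>*)"
    by (intro sym_rtrancl) (auto simp: sym_def)
  moreover have "trans (?Q\<^sup>*)"
    by (rule trans_rtrancl)
  ultimately show ?thesis
    unfolding generated_equiv_def equiv_def refl_on_def sym_def trans_def by blast
qed

lemma generated_equivI: "(x, y) \<in> R \<Longrightarrow> x \<in> S \<Longrightarrow> y \<in> S \<Longrightarrow> (x, y) \<in> generated_equiv S R"
  unfolding generated_equiv_def by auto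

text \<open>A chain of generators, read in either direction, preserves the value. The invariance of
  projectivities, of adjacency classes of disc types and of projected points is obtained in this
  form.\<close>

lemma generated_equiv_invariant:
  assumes "(x, y) \<in> generated_equiv S R"
    and "\<And>u v. (u, v) \<in> R \<Longrightarrow> u \<in> S \<Longrightarrow> v \<in> S \<Longrightarrow> f u = f v"
  shows "f x = f y"
proof -
  have "(x, y) \<in> (Restr R S \<union> (Restr R S)\<inverse>)\<^sup>*"
    using assms(1) by (simp add: generated_equiv_def)
  then show ?thesis
    by (induction rule: rtrancl_induct) (use assms(2) in force)+
qed

text \<open>The predicate itself is the invariant. This needs \<open>P u = P v\<close> for a
  generator; symmetry of the generators supplies the missing implication.\<close>

lemma generated_equiv_sym_induct:
  assumes "(x, y) \<in> generated_equiv S R" "P x"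
    and "\<And>u v. (u, v) \<in> R \<Longrightarrow> u \<in> S \<Longrightarrow> v \<in> S \<Longrightarrow> (v, u) \<in> R"
    and "\<And>u v. (u, v) \<in> R \<Longrightarrow> u \<in> S \<Longrightarrow> v \<in> S \<Longrightarrow> P u \<Longrightarrow> P v"
  shows "P y"
  using generated_equiv_invariant[OF assms(1), of P] assms(2-) by blast

context
  fixes X :: "'a topology" and r :: "('a \<times> 'a) set"
  assumes r: "equiv (topspace X) r"
begin

lemma openin_quotient_topology:
  "openin (quotient_topology X r) U \<longleftrightarrow> U \<subseteq> topspace X // r \<and> openin X (\<Union>U)"
  unfolding quotient_topology_def using topology_inverse'[OF istopology_quotient[OF r]] by simp

lemma topspace_quotient_topology: "topspace (quotient_topology X r) = topspace X // r"
proof -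
  have "openin (quotient_topology X r) (topspace X // r)"
    unfolding openin_quotient_topology using Union_quotient[OF r] by simp
  then show ?thesis
    by (meson openin_quotient_topology openin_subset openin_topspace subset_antisym)
qed

text \<open>Classes are equal or disjoint, so a union of classes contains the class of each of its
  points. This matches the topology, declared through unions of classes, with preimages under the
  class map.\<close>

lemma Union_quotient_preimage:
  assumes "U \<subseteq> topspace X // r"
  shows "{x \<in> topspace X. r `` {x} \<in> U} = \<Union>U"
proof (intro equalityI subsetI)
  fix x assume "x \<in> {x \<in> topspace X. r `` {x} \<in> U}"
  then show "x \<in> \<Union>U"
    using equiv_class_self[OF r] by blast
next
  fix x assume "x \<in> \<Union>U"
  then obtain c where c: "c \<in> U" "x \<in> c" by blast
  with assms obtain y where y: "y \<in> topspace X" "c = r `` {y}"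
    by (meson quotientE subsetD)
  with c have "(y, x) \<in> r" by blast
  then have "c = r `` {x}" "x \<in> topspace X"
    using y equiv_class_eq[OF r] equivE[OF r] equiv_type[OF r] by blast+
  with c show "x \<in> {x \<in> topspace X. r `` {x} \<in> U}" by simp
qed

lemma quotient_map_quotient_topology:
  "quotient_map X (quotient_topology X r) (\<lambda>x. r `` {x})"
  unfolding quotient_map_def topspace_quotient_topology
  by (auto simp: Union_quotient_preimage openin_quotient_topology quotient_def)

end

lemma
  assumes "quotient_map X Y f" "U \<subseteq> topspace Y" "{x \<in> topspace X. f x \<in> U} = V"
  shows quotient_map_openin_iff: "openin Y U \<longleftrightarrow> openin X V"
    and quotient_map_closedin_iff: "closedin Y U \<longleftrightarrow> closedin X V"
proof -
  show "openin Y U \<longleftrightarrow> openin X V"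
    unfolding assms(3)[symmetric] using assms(1,2) unfolding quotient_map_def by blast
  show "closedin Y U \<longleftrightarrow> closedin X V"
    unfolding assms(3)[symmetric] using assms(1,2) unfolding quotient_map_closedin by blast
qed

section \<open>Simplices\<close>

lemma affine_map_on_convex_hull:
  assumes "affine_map_on S f" "C \<subseteq> S" "convex S"
  shows "f ` (convex hull C) = convex hull (f ` C)"
proof -
  obtain L c where L: "linear L" "\<And>x. x \<in> S \<Longrightarrow> f x = L x + c"
    using assms(1) unfolding affine_map_on_def by blast
  have sub: "convex hull C \<subseteq> S"
    using assms by (simp add: hull_minimal)
  have "f ` (convex hull C) = (\<lambda>x. c + x) ` (L ` (convex hull C))"
    using L(2) sub by (auto simp: image_image add.commute intro!: image_cong)
  also have "\<dots> = (\<lambda>x. c + x) ` (convex hull (L ` C))"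
    using convex_hull_linear_image[OF L(1)] by simp
  also have "\<dots> = convex hull ((\<lambda>x. c + x) ` (L ` C))"
    by (simp add: convex_hull_translation)
  also have "(\<lambda>x. c + x) ` (L ` C) = f ` C"
    using L(2) assms(2) by (auto simp: image_image add.commute intro!: image_cong)
  finally show ?thesis .
qed

text \<open>On \<open>S\<close> the map is linear up to a translation, and both commute with
  relative interiors of convex sets. It keeps a point in the relative interior of a ridge while the
  point is carried through face pairings.\<close>

lemma affine_map_on_rel_interior:
  assumes "affine_map_on S f" "C \<subseteq> S" "convex C"
  shows "f ` rel_interior C = rel_interior (f ` C)"
proof -
  obtain L c where L: "linear L" "\<And>x. x \<in> S \<Longrightarrow> f x = L x + c"
    using assms(1) unfolding affine_map_on_def by blast
  have eq: "f ` D = (\<lambda>x. c + x) ` (L ` D)" if "D \<subseteq> S" for D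
    using L(2) that by (auto simp: image_image add.commute intro!: image_cong)
  have "f ` rel_interior C = (\<lambda>x. c + x) ` rel_interior (L ` C)"
    using eq[of "rel_interior C"] assms rel_interior_subset[of C]
      rel_interior_convex_linear_image[OF L(1) assms(3)] by auto
  also have "\<dots> = rel_interior (f ` C)"
    using eq[OF assms(2)] by (simp add: rel_interior_translation)
  finally show ?thesis .
qed

lemma affine_map_on_midpoint:
  assumes "affine_map_on S f" "a \<in> S" "b \<in> S" "midpoint a b \<in> S"
  shows "f (midpoint a b) = midpoint (f a) (f b)"
proof -
  obtain L c where L: "linear L" "\<And>x. x \<in> S \<Longrightarrow> f x = L x + c"
    using assms(1) unfolding affine_map_on_def by blast
  then have "f (midpoint a b) = L (midpoint a b) + c"
    using assms by blast
  also have "\<dots> = midpoint (L a + c) (L b + c)"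
    using L(1) by (simp add: midpoint_def linear_add linear_scale scaleR_add_right
        flip: scaleR_add_left)
  finally show ?thesis
    using assms L(2) by simp
qed

lemma verts_convex_hull:
  fixes C :: "'a::euclidean_space set"
  shows "\<not> affine_dependent C \<Longrightarrow> verts (convex hull C) = C"
  by (simp add: verts_def extreme_point_of_convex_hull_affine_independent)

lemma verts_convex_hull_subset:
  fixes C :: "'a::euclidean_space set"
  shows "verts (convex hull C) \<subseteq> C"
  by (auto simp: verts_def dest: extreme_point_of_convex_hull)

text \<open>Otherwise \<open>v\<close> would lie in the affine hull of the other vertices, against
  affine independence.\<close>

lemma vertex_mem_convex_hull_iff:
  fixes V :: "'a::euclidean_space set"
  assumes "\<not> affine_dependent V" "C \<subseteq> V" "v \<in> V"
  shows "v \<in> convex hull C \<longleftrightarrow> v \<in> C"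
proof
  assume v: "v \<in> convex hull C"
  have "convex hull C \<subseteq> convex hull (V - {v})" if "v \<notin> C"
    using that assms by (intro hull_mono) auto
  moreover have "v \<notin> affine hull (V - {v})"
    using assms by (auto simp: affine_dependent_def)
  ultimately show "v \<in> C"
    using v convex_hull_subset_affine_hull by blast
qed (simp add: hull_inc)

lemma midpoint_mem_face:
  assumes "F face_of S" "a \<in> S" "b \<in> S" "midpoint a b \<in> F"
  shows "a \<in> F" "b \<in> F"
proof -
  have "a \<in> F \<and> b \<in> F"
  proof (cases "a = b")
    case False
    then have "midpoint a b \<in> open_segment a b" by simp
    then show ?thesis using assms unfolding face_of_def by blast
  qed (use assms in simp)
  then show "a \<in> F" "b \<in> F" by auto
qed

text \<open>The intersection is a face of the hull, and a face of a finite hull is spanned by some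
  of the generating points, which then lie in \<open>F\<close>. Applied to midpoints, this describes
  the part of a disc in a facet.\<close>

lemma convex_hull_Int_face:
  fixes M :: "'a::euclidean_space set"
  assumes "finite M" "M \<subseteq> S" "convex S" "F face_of S"
  shows "convex hull M \<inter> F = convex hull (M \<inter> F)"
proof
  have sub: "convex hull M \<subseteq> S"
    using assms by (simp add: hull_minimal)
  have "convex hull M \<inter> F face_of convex hull M"
    using face_of_Int_Int[OF face_of_refl[OF convex_convex_hull] assms(4), of M] sub
    by (simp add: inf.absorb1)
  then obtain M' where M': "M' \<subseteq> M" "convex hull M \<inter> F = convex hull M'"
    using face_of_convex_hull_subset assms(1) finite_imp_compact by metis
  then have "M' \<subseteq> M \<inter> F"
    using hull_subset[of M' convex] by blast
  then show "convex hull M \<inter> F \<subseteq> convex hull (M \<inter> F)"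
    unfolding M'(2) by (rule hull_mono)
  show "convex hull (M \<inter> F) \<subseteq> convex hull M \<inter> F"
    using face_of_imp_convex[OF assms(4)] by (simp add: hull_minimal hull_mono)
qed

section \<open>The disc in a simplex\<close>

text \<open>Differences from a base point \<open>a0\<close> are linearly independent, so a linear
  functional may be prescribed on them: 0 towards \<open>A\<close>, -2 towards \<open>B\<close>. The
  two levels are 2 apart, which puts the midpoints on the level \<open>t\<close>.\<close>

lemma affine_independent_separation:
  fixes V :: "'a::euclidean_space set"
  assumes "\<not> affine_dependent V" "A \<union> B = V" "A \<inter> B = {}" "A \<noteq> {}"
  obtains c t where "\<And>a. a \<in> A \<Longrightarrow> c \<bullet> a = t + 1" "\<And>b. b \<in> B \<Longrightarrow> c \<bullet> b = t - (1::real)"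
proof -
  obtain a0 where a0: "a0 \<in> A" using assms by blast
  have ind: "independent ((\<lambda>x. - a0 + x) ` (V - {a0}))"
    using assms(1) affine_dependent_iff_dependent2[of a0 V] a0 assms(2) by auto
  obtain g :: "'a \<Rightarrow> real" where g: "linear g"
    "\<And>x. x \<in> (\<lambda>x. - a0 + x) ` (V - {a0}) \<Longrightarrow> g x = (if x + a0 \<in> A then 0 else -2)"
    using linear_independent_extend[OF ind, of "\<lambda>x. if x + a0 \<in> A then 0 else -2"] by blast
  \<comment> \<open>The adjoint at 1 represents the real functional \<open>g\<close> as an inner
    product.\<close>
  define c where "c = adjoint g 1"
  have c: "c \<bullet> x = g x" for x
    unfolding c_def using adjoint_works[OF g(1), of x 1] by (simp add: inner_commute)
  have gd: "g v = g a0 + g (- a0 + v)" for v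
    using linear_add[OF g(1), of a0 "- a0 + v"] by simp
  show ?thesis
  proof
    show "c \<bullet> a = (g a0 - 1) + 1" if "a \<in> A" for a
      using that g(2)[of "- a0 + a"] gd[of a] assms(2) by (cases "a = a0") (auto simp: c)
    show "c \<bullet> b = (g a0 - 1) - 1" if "b \<in> B" for b
    proof -
      have "b \<notin> A" "b \<in> V - {a0}"
        using that assms(2,3) a0 by auto
      then show ?thesis
        using g(2)[of "- a0 + b"] gd[of b] by (auto simp: c)
    qed
  qed
qed

text \<open>\<open>disc\<close> ranges over both orders of the blocks because a type is an unordered
  partition; midpoints are symmetric, so one order suffices.\<close>

lemma disc_eq:
  fixes A B :: "'a::euclidean_space set"
  assumes "A \<inter> B = {}" "A \<noteq> {}"
  shows "disc {A, B} = convex hull {midpoint a b |a b. a \<in> A \<and> b \<in> B}"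
proof -
  have "A \<noteq> B" using assms by auto
  moreover have "midpoint b a \<in> {midpoint a b |a b. a \<in> A \<and> b \<in> B}" if "a \<in> A" "b \<in> B" for a b
    using that by (subst midpoint_sym) blast
  ultimately have "{midpoint a b |a b A' B'. A' \<in> {A, B} \<and> B' \<in> {A, B} \<and> A' \<noteq> B' \<and> a \<in> A' \<and> b \<in> B'}
     = {midpoint a b |a b. a \<in> A \<and> b \<in> B}"
    by blast
  then show ?thesis
    unfolding disc_def by simp
qed

lemma finite_midpoints:
  "finite A \<Longrightarrow> finite B \<Longrightarrow> finite {midpoint a b |a b. a \<in> A \<and> b \<in> B}"
  using finite_image_set2[of "\<lambda>a. a \<in> A" "\<lambda>b. b \<in> B" midpoint] by simp

text \<open>A point of the simplex on the level \<open>t\<close> has total weight 1/2 on each block.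
  Such a weight vector spreads over pairs of vertices as a product, which exhibits the point as a
  convex combination of midpoints.\<close>

lemma disc_eq_slice:
  fixes A B :: "'a::euclidean_space set"
  assumes fin: "finite A" "finite B" and ne: "A \<inter> B = {}" "A \<noteq> {}"
    and c: "\<And>a. a \<in> A \<Longrightarrow> c \<bullet> a = t + 1" "\<And>b. b \<in> B \<Longrightarrow> c \<bullet> b = t - (1::real)"
  shows "disc {A, B} = convex hull (A \<union> B) \<inter> {x. c \<bullet> x = t}"
proof
  let ?M = "{midpoint a b |a b. a \<in> A \<and> b \<in> B}"
  have mid: "midpoint a b \<in> convex hull (A \<union> B) \<inter> {x. c \<bullet> x = t}" if "a \<in> A" "b \<in> B" for a b
  proof -
    have "a \<in> convex hull (A \<union> B)" "b \<in> convex hull (A \<union> B)"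
      using that by (auto simp: hull_inc)
    then have "midpoint a b \<in> convex hull (A \<union> B)"
      using midpoint_in_closed_segment convex_contains_segment convex_convex_hull by blast
    moreover have "c \<bullet> midpoint a b = t"
      using that c by (simp add: midpoint_def inner_add_right)
    ultimately show ?thesis by simp
  qed
  have "convex (convex hull (A \<union> B) \<inter> {x. c \<bullet> x = t})"
    by (intro convex_Int convex_convex_hull convex_hyperplane)
  then show "disc {A, B} \<subseteq> convex hull (A \<union> B) \<inter> {x. c \<bullet> x = t}"
    unfolding disc_eq[OF ne] using mid by (intro hull_minimal) auto
  show "convex hull (A \<union> B) \<inter> {x. c \<bullet> x = t} \<subseteq> disc {A, B}"
  proof
    fix x assume x: "x \<in> convex hull (A \<union> B) \<inter> {x. c \<bullet> x = t}"
    then obtain u where u: "\<And>v. v \<in> A \<union> B \<Longrightarrow> 0 \<le> u v" "sum u (A \<union> B) = 1"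
      "(\<Sum>v\<in>A \<union> B. u v *\<^sub>R v) = x"
      using fin by (auto simp: convex_hull_finite)
    have split: "sum f (A \<union> B) = sum f A + sum f B" for f :: "'a \<Rightarrow> 'b::comm_monoid_add"
      using fin ne by (simp add: sum.union_disjoint)
    have "t = c \<bullet> (\<Sum>v\<in>A \<union> B. u v *\<^sub>R v)"
      using x u(3) by simp
    also have "\<dots> = (\<Sum>v\<in>A. u v * (t + 1)) + (\<Sum>v\<in>B. u v * (t - 1))"
      using c by (simp add: split inner_add_right inner_sum_right)
    also have "\<dots> = sum u A * (t + 1) + sum u B * (t - 1)"
      by (simp add: sum_distrib_right)
    also have "\<dots> = t * (sum u A + sum u B) + (sum u A - sum u B)"
      by (simp add: algebra_simps)
    \<comment> \<open>The two block sums add up to 1, so the first summand is \<open>t\<close> and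
      the difference of the block sums must vanish.\<close>
    finally have half: "sum u A = 1/2" "sum u B = 1/2"
      using u(2) by (auto simp: split)
    have "x = (\<Sum>a\<in>A. u a *\<^sub>R a) + (\<Sum>b\<in>B. u b *\<^sub>R b)"
      using u(3) by (simp add: split)
    \<comment> \<open>The factors \<open>2 * u b\<close> sum to 1 over \<open>B\<close>, so the
      weight of \<open>a\<close> may be distributed over the pairs with \<open>B\<close>; likewise
      for \<open>b\<close> below.\<close>
    also have "(\<Sum>a\<in>A. u a *\<^sub>R a) = (\<Sum>a\<in>A. \<Sum>b\<in>B. (2 * u a * u b) *\<^sub>R a)"
    proof (rule sum.cong[OF refl])
      fix a
      have "(\<Sum>b\<in>B. (2 * u a * u b) *\<^sub>R a) = (2 * u a * sum u B) *\<^sub>R a"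
        by (simp add: scaleR_sum_left sum_distrib_left)
      then show "u a *\<^sub>R a = (\<Sum>b\<in>B. (2 * u a * u b) *\<^sub>R a)"
        using half by simp
    qed
    also have "(\<Sum>b\<in>B. u b *\<^sub>R b) = (\<Sum>a\<in>A. \<Sum>b\<in>B. (2 * u a * u b) *\<^sub>R b)"
    proof -
      have "(\<Sum>a\<in>A. \<Sum>b\<in>B. (2 * u a * u b) *\<^sub>R b) = (\<Sum>b\<in>B. \<Sum>a\<in>A. (2 * u a * u b) *\<^sub>R b)"
        by (rule sum.swap)
      also have "\<dots> = (\<Sum>b\<in>B. (2 * sum u A * u b) *\<^sub>R b)"
        by (intro sum.cong refl) (simp add: sum_distrib_left sum_distrib_right flip: scaleR_sum_left)
      finally show ?thesis using half by simp
    qed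
    \<comment> \<open>A midpoint halves both endpoints, so the coefficient 2 becomes 4. The total of
      the new coefficients is four times the product of the two block sums, that is 1.\<close>
    also have "(\<Sum>a\<in>A. \<Sum>b\<in>B. (2 * u a * u b) *\<^sub>R a) + (\<Sum>a\<in>A. \<Sum>b\<in>B. (2 * u a * u b) *\<^sub>R b)
      = (\<Sum>a\<in>A. \<Sum>b\<in>B. (4 * u a * u b) *\<^sub>R midpoint a b)"
      by (simp add: midpoint_def scaleR_add_right sum.distrib mult.assoc)
    also have "\<dots> = (\<Sum>p\<in>A \<times> B. (4 * u (fst p) * u (snd p)) *\<^sub>R midpoint (fst p) (snd p))"
      by (simp add: sum.cartesian_product case_prod_beta)
    also have "\<dots> \<in> convex hull ?M"
    proof (rule convex_sum)
      have "(\<Sum>p\<in>A \<times> B. 4 * u (fst p) * u (snd p)) = 4 * (\<Sum>a\<in>A. \<Sum>b\<in>B. u a * u b)"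
        by (simp add: sum.cartesian_product sum_distrib_left case_prod_beta mult.assoc)
      also have "\<dots> = 4 * (sum u A * sum u B)"
        by (simp add: sum_product)
      finally show "(\<Sum>p\<in>A \<times> B. 4 * u (fst p) * u (snd p)) = 1"
        using half by simp
      show "midpoint (fst p) (snd p) \<in> convex hull ?M" if "p \<in> A \<times> B" for p
        using that by (intro hull_inc CollectI exI[of _ "fst p"] exI[of _ "snd p"]) auto
    qed (use fin u in \<open>auto\<close>)
    finally show "x \<in> disc {A, B}"
      using disc_eq[OF ne] by simp
  qed
qed

text \<open>The slicing hyperplane passes through a relative interior point of the simplex. Hence
  slicing commutes with taking relative interiors, and the dimension drops by exactly one.\<close>

lemma disc_rel_frontier_aff_dim:
  fixes A B :: "'a::euclidean_space set"
  assumes indep: "\<not> affine_dependent (A \<union> B)" and AB: "A \<inter> B = {}" "A \<noteq> {}" "B \<noteq> {}"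
  shows "disc {A, B} \<inter> rel_frontier (convex hull (A \<union> B)) = rel_frontier (disc {A, B})"
    and "aff_dim (disc {A, B}) = aff_dim (convex hull (A \<union> B)) - 1"
proof -
  have fin: "finite A" "finite B"
    using aff_independent_finite[OF indep] by auto
  obtain c t where c: "\<And>a. a \<in> A \<Longrightarrow> c \<bullet> a = t + 1" "\<And>b. b \<in> B \<Longrightarrow> c \<bullet> b = t - (1::real)"
    using affine_independent_separation[OF indep refl AB(1,2)] by blast
  let ?S = "convex hull (A \<union> B)" and ?H = "{x. c \<bullet> x = t}"
  have D: "disc {A, B} = ?S \<inter> ?H"
    by (rule disc_eq_slice[OF fin AB(1,2) c])
  \<comment> \<open>Weight 1/2 is spread evenly over each block: positivity makes \<open>x\<close> a
    relative interior point, and the equal totals put it on the hyperplane.\<close>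
  define w where "w v = (if v \<in> A then 1 / (2 * real (card A)) else 1 / (2 * real (card B)))" for v
  define x where "x = (\<Sum>v\<in>A \<union> B. w v *\<^sub>R v)"
  have cards: "real (card A) > 0" "real (card B) > 0"
    using fin AB by (simp_all add: card_gt_0_iff)
  have wB: "v \<in> B \<Longrightarrow> w v = 1 / (2 * real (card B))" for v
    using AB(1) by (auto simp: w_def)
  have wA: "v \<in> A \<Longrightarrow> w v = 1 / (2 * real (card A))" for v
    by (auto simp: w_def)
  have sw: "sum w A = 1/2" "sum w B = 1/2"
    using cards by (simp_all add: wA wB)
  have split: "sum f (A \<union> B) = sum f A + sum f B" for f :: "'a \<Rightarrow> 'b::comm_monoid_add"
    using fin AB by (simp add: sum.union_disjoint)
  have "x \<in> rel_interior ?S"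
    unfolding rel_interior_convex_hull_explicit[OF indep] x_def
    using cards sw by (auto simp: split wA wB intro!: exI[of _ w])
  moreover have "c \<bullet> x = t"
  proof -
    have "c \<bullet> x = sum w A * (t + 1) + sum w B * (t - 1)"
      using c by (simp add: x_def split inner_add_right inner_sum_right sum_distrib_right)
    then show ?thesis using sw by (simp add: field_simps)
  qed
  ultimately have x: "x \<in> rel_interior ?S \<inter> ?H" by simp
  have affH: "affine ?H" by (rule affine_hyperplane)
  have ri: "rel_interior (?S \<inter> ?H) = rel_interior ?S \<inter> ?H"
    using convex_affine_rel_interior_Int[OF convex_convex_hull affH] x by blast
  have "compact ?S"
    using fin by (simp add: finite_imp_compact_convex_hull)
  then have "closed ?S" "closed (?S \<inter> ?H)"
    by (auto intro!: closed_Int closed_hyperplane compact_imp_closed)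
  then show "disc {A, B} \<inter> rel_frontier ?S = rel_frontier (disc {A, B})"
    unfolding D rel_frontier_def ri by (auto simp: closure_closed)
  \<comment> \<open>The slice of the relative interior is nonempty and relatively open in the affine
    set \<open>?T\<close>, so both have the same affine hull. The disc lies between them.\<close>
  let ?T = "affine hull ?S \<inter> ?H"
  have affT: "affine ?T"
    by (intro affine_Int affine_affine_hull affH)
  have "openin (top_of_set (affine hull ?S)) (affine hull ?S \<inter> rel_interior ?S)"
    using openin_rel_interior[of ?S] openin_subset[OF openin_rel_interior[of ?S]]
    by (metis inf.absorb2 topspace_euclidean_subtopology)
  then have "openin (top_of_set ?T) (?T \<inter> rel_interior ?S)"
    by (rule openin_subtopology_Int_subset) simp
  moreover have "?T \<inter> rel_interior ?S = rel_interior ?S \<inter> ?H"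
    using rel_interior_subset[of ?S] hull_subset[of ?S affine] by blast
  ultimately have "openin (top_of_set (affine hull ?T)) (rel_interior ?S \<inter> ?H)"
    using affT by (simp add: hull_same)
  then have "affine hull (rel_interior ?S \<inter> ?H) = affine hull ?T"
    using x by (intro affine_hull_openin) auto
  then have "aff_dim (rel_interior ?S \<inter> ?H) = aff_dim ?T"
    by (metis aff_dim_affine_hull)
  moreover have "aff_dim (rel_interior ?S \<inter> ?H) \<le> aff_dim (?S \<inter> ?H)"
    using rel_interior_subset by (intro aff_dim_subset) blast
  moreover have "aff_dim (?S \<inter> ?H) \<le> aff_dim ?T"
    using hull_subset[of ?S affine] by (intro aff_dim_subset) blast
  moreover have "aff_dim ?T = aff_dim (affine hull ?S) - 1"
  proof -
    have "x \<in> ?T" using x rel_interior_subset[of ?S] hull_subset[of ?S affine] by blast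
    moreover obtain a where "a \<in> A" using AB by blast
    then have "a \<in> affine hull ?S" "c \<bullet> a \<noteq> t"
      using c hull_subset[of "A \<union> B" convex] hull_subset[of ?S affine] by auto
    ultimately show ?thesis
      by (subst aff_dim_affine_Int_hyperplane) auto
  qed
  ultimately show "aff_dim (disc {A, B}) = aff_dim ?S - 1"
    unfolding D by (simp add: aff_dim_convex_hull)
qed

section \<open>Facets and perspectivities\<close>

text \<open>Indexing facets by their opposite vertex turns statements about facets and pairings into
  statements about vertex sets.\<close>

definition opp_facet :: "'a::euclidean_space set \<Rightarrow> 'a \<Rightarrow> 'a set" where
  "opp_facet \<sigma> v = convex hull (verts \<sigma> - {v})"

text \<open>The bound \<open>n_ge\<close> gives a codimension two face at least one vertex, so that
  the face determines the simplex containing it.\<close>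

locale face_paired_simplices =
  fixes n :: nat and T :: "'a::euclidean_space set set" and \<Phi> :: "'a set \<Rightarrow> 'a \<Rightarrow> 'a"
  assumes n_ge: "2 \<le> n"
    and finite_T: "finite T"
    and simplex_T: "\<sigma> \<in> T \<Longrightarrow> int n simplex \<sigma>"
    and disjoint_T: "pairwise disjnt T"
    and pairing_facet: "\<tau> \<in> facets T \<Longrightarrow> \<Phi> \<tau> ` \<tau> \<in> facets T"
    and pairing_affine: "\<tau> \<in> facets T \<Longrightarrow> affine_map_on \<tau> (\<Phi> \<tau>)"
    and pairing_inverse: "\<tau> \<in> facets T \<Longrightarrow> x \<in> \<tau> \<Longrightarrow> \<Phi> (\<Phi> \<tau> ` \<tau>) (\<Phi> \<tau> x) = x"
begin

abbreviation across :: "'a set \<Rightarrow> 'a set" where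
  "across \<tau> \<equiv> simplex_of T (\<Phi> \<tau> ` \<tau>)"

abbreviation persp :: "'a set \<Rightarrow> 'a \<Rightarrow> 'a" where
  "persp \<equiv> perspectivity T \<Phi>"

lemma simplex_verts:
  assumes "\<sigma> \<in> T"
  shows "\<not> affine_dependent (verts \<sigma>)" "card (verts \<sigma>) = Suc n" "convex hull (verts \<sigma>) = \<sigma>"
    "finite (verts \<sigma>)"
proof -
  obtain C where C: "\<not> affine_dependent C" "int (card C) = int n + 1" "\<sigma> = convex hull C"
    using simplex_T[OF assms] unfolding simplex_def by blast
  then have "verts \<sigma> = C"
    by (simp add: verts_convex_hull)
  with C show "\<not> affine_dependent (verts \<sigma>)" "card (verts \<sigma>) = Suc n" "convex hull (verts \<sigma>) = \<sigma>"
    "finite (verts \<sigma>)"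
    by (auto intro: aff_independent_finite)
qed

lemma simplex_unique: "\<sigma> \<in> T \<Longrightarrow> \<sigma>' \<in> T \<Longrightarrow> x \<in> \<sigma> \<Longrightarrow> x \<in> \<sigma>' \<Longrightarrow> \<sigma> = \<sigma>'"
  using disjoint_T unfolding pairwise_def disjnt_def by blast

lemma vertex_in_simplex: "v \<in> verts \<sigma> \<Longrightarrow> v \<in> \<sigma>"
  by (simp add: verts_def extreme_point_of_def)

lemma facet_iff:
  assumes "\<sigma> \<in> T"
  shows "\<tau> facet_of \<sigma> \<longleftrightarrow> (\<exists>v\<in>verts \<sigma>. \<tau> = opp_facet \<sigma> v)"
  using facet_of_convex_hull_affine_independent_alt[of "verts \<sigma>" \<tau>] simplex_verts[OF assms] n_ge
  by (auto simp: opp_facet_def)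

lemma opp_facet_subset: "\<sigma> \<in> T \<Longrightarrow> opp_facet \<sigma> v \<subseteq> \<sigma>"
  using hull_mono[of "verts \<sigma> - {v}" "verts \<sigma>" convex] simplex_verts(3)[of \<sigma>]
  by (auto simp: opp_facet_def)

lemma facets_iff: "\<tau> \<in> facets T \<longleftrightarrow> (\<exists>\<sigma>\<in>T. \<exists>v\<in>verts \<sigma>. \<tau> = opp_facet \<sigma> v)"
  unfolding facets_def using facet_iff by blast

lemma vertex_mem_hull_iff:
  "\<sigma> \<in> T \<Longrightarrow> C \<subseteq> verts \<sigma> \<Longrightarrow> v \<in> verts \<sigma> \<Longrightarrow> v \<in> convex hull C \<longleftrightarrow> v \<in> C"
  using vertex_mem_convex_hull_iff simplex_verts(1) by blast

lemma vertex_mem_opp_facet: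
  "\<sigma> \<in> T \<Longrightarrow> w \<in> verts \<sigma> \<Longrightarrow> w \<in> opp_facet \<sigma> v \<longleftrightarrow> w \<noteq> v"
  using vertex_mem_hull_iff[of \<sigma> "verts \<sigma> - {v}" w] by (auto simp: opp_facet_def)

lemma verts_convex_hull_verts:
  assumes "\<sigma> \<in> T" "C \<subseteq> verts \<sigma>"
  shows "verts (convex hull C) = C"
  using simplex_verts(1)[OF assms(1)] assms(2) affine_independent_subset verts_convex_hull by blast

lemma verts_opp_facet: "\<sigma> \<in> T \<Longrightarrow> verts (opp_facet \<sigma> v) = verts \<sigma> - {v}"
  unfolding opp_facet_def by (rule verts_convex_hull_verts) auto

text \<open>A facet is nonempty and the simplices are disjoint, which justifies the definite
  description.\<close>

lemma simplex_of_facet: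
  assumes "\<sigma> \<in> T" "\<tau> facet_of \<sigma>"
  shows "simplex_of T \<tau> = \<sigma>"
  unfolding simplex_of_def
proof (rule the_equality)
  obtain x where "x \<in> \<tau>"
    using assms(2) by (auto simp: facet_of_def)
  then show "\<sigma>' = \<sigma>" if "\<sigma>' \<in> T \<and> \<tau> facet_of \<sigma>'" for \<sigma>'
    using that assms simplex_unique[of \<sigma>' \<sigma> x] facet_of_imp_subset by blast
qed (use assms in simp)

lemma opp_facet:
  assumes "\<sigma> \<in> T" "v \<in> verts \<sigma>"
  shows "opp_facet \<sigma> v \<in> facets T" "opp_facet \<sigma> v facet_of \<sigma>"
    "simplex_of T (opp_facet \<sigma> v) = \<sigma>" "opposite T (opp_facet \<sigma> v) = v"
proof -
  show f: "opp_facet \<sigma> v \<in> facets T" "opp_facet \<sigma> v facet_of \<sigma>"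
    using assms facets_iff facet_iff by blast+
  show s: "simplex_of T (opp_facet \<sigma> v) = \<sigma>"
    using simplex_of_facet[OF assms(1) f(2)] .
  show "opposite T (opp_facet \<sigma> v) = v"
    unfolding opposite_def s verts_opp_facet[OF assms(1)] using assms(2) by (auto intro: the_equality)
qed

lemma facet_cases:
  assumes "\<tau> \<in> facets T"
  obtains \<sigma> v where "\<sigma> \<in> T" "v \<in> verts \<sigma>" "\<tau> = opp_facet \<sigma> v" "simplex_of T \<tau> = \<sigma>"
  using assms facets_iff opp_facet(3) by metis

text \<open>The paired facet is the hull of the images of the vertices, so its vertices are among
  these images; both sets have \<open>n\<close> elements and therefore agree.\<close>

lemma pairing_verts:
  assumes "\<tau> \<in> facets T"
  shows "bij_betw (\<Phi> \<tau>) (verts \<tau>) (verts (\<Phi> \<tau> ` \<tau>))"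
proof -
  obtain \<sigma> v where s: "\<sigma> \<in> T" "v \<in> verts \<sigma>" "\<tau> = opp_facet \<sigma> v"
    using facet_cases[OF assms] by metis
  obtain \<sigma>' v' where s': "\<sigma>' \<in> T" "v' \<in> verts \<sigma>'" "\<Phi> \<tau> ` \<tau> = opp_facet \<sigma>' v'"
    using facet_cases[OF pairing_facet[OF assms]] by metis
  have vt: "verts \<tau> = verts \<sigma> - {v}"
    unfolding s(3) by (rule verts_opp_facet[OF s(1)])
  have hull: "convex hull (verts \<tau>) = \<tau>"
    unfolding vt unfolding s(3) opp_facet_def ..
  have sub: "verts \<tau> \<subseteq> \<tau>"
    using hull_subset[of "verts \<tau>" convex] unfolding hull .
  have inj: "inj_on (\<Phi> \<tau>) \<tau>"
    using pairing_inverse[OF assms] by (metis inj_on_inverseI)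
  have "convex \<tau>"
    using convex_convex_hull[of "verts \<tau>"] unfolding hull .
  then have "\<Phi> \<tau> ` \<tau> = convex hull (\<Phi> \<tau> ` verts \<tau>)"
    using affine_map_on_convex_hull[OF pairing_affine[OF assms] sub] hull by simp
  then have "verts (\<Phi> \<tau> ` \<tau>) \<subseteq> \<Phi> \<tau> ` verts \<tau>"
    using verts_convex_hull_subset by metis
  moreover have "card (\<Phi> \<tau> ` verts \<tau>) = n"
    using inj_on_subset[OF inj sub] s(2) simplex_verts[OF s(1)]
    by (simp only: card_image vt) simp
  moreover have "card (verts (\<Phi> \<tau> ` \<tau>)) = n"
    using s' simplex_verts[OF s'(1)] verts_opp_facet[OF s'(1)] by simp
  moreover have "finite (\<Phi> \<tau> ` verts \<tau>)"
    using vt simplex_verts(4)[OF s(1)] by simp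
  ultimately have "verts (\<Phi> \<tau> ` \<tau>) = \<Phi> \<tau> ` verts \<tau>"
    by (simp add: card_subset_eq)
  with inj sub show ?thesis
    by (simp add: bij_betw_def inj_on_subset)
qed

text \<open>The pairing matches the vertices of the two facets, and the default branch of
  \<open>perspectivity\<close> matches the two remaining vertices.\<close>

lemma perspectivity:
  assumes "\<sigma> \<in> T" "v \<in> verts \<sigma>" and t: "\<tau> = opp_facet \<sigma> v"
  shows "across \<tau> \<in> T" "persp \<tau> v \<in> verts (across \<tau>)" "\<Phi> \<tau> ` \<tau> = opp_facet (across \<tau>) (persp \<tau> v)"
    "bij_betw (persp \<tau>) (verts \<sigma>) (verts (across \<tau>))"
    "w \<in> verts \<sigma> \<Longrightarrow> w \<noteq> v \<Longrightarrow> persp \<tau> w = \<Phi> \<tau> w"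
proof -
  have f: "\<tau> \<in> facets T"
    using opp_facet(1) assms by blast
  obtain \<sigma>' v' where s': "\<sigma>' \<in> T" "v' \<in> verts \<sigma>'" "\<Phi> \<tau> ` \<tau> = opp_facet \<sigma>' v'" "across \<tau> = \<sigma>'"
    using facet_cases[OF pairing_facet[OF f]] by metis
  have v: "persp \<tau> v = v'"
    unfolding perspectivity_def t using assms vertex_mem_opp_facet opp_facet(4)[OF s'(1,2)] s'(3) by auto
  show "across \<tau> \<in> T" "persp \<tau> v \<in> verts (across \<tau>)" "\<Phi> \<tau> ` \<tau> = opp_facet (across \<tau>) (persp \<tau> v)"
    using s' v by auto
  show w: "persp \<tau> w = \<Phi> \<tau> w" if "w \<in> verts \<sigma>" "w \<noteq> v" for w
    using that vertex_mem_opp_facet[OF assms(1) that(1)] by (simp add: perspectivity_def t)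
  have "bij_betw (persp \<tau>) (verts \<sigma> - {v}) (verts \<sigma>' - {v'})"
    using pairing_verts[OF f] w bij_betw_cong[of "verts \<sigma> - {v}" "persp \<tau>" "\<Phi> \<tau>"]
    unfolding s'(3) verts_opp_facet[OF s'(1)] unfolding t verts_opp_facet[OF assms(1)] by blast
  then have "bij_betw (persp \<tau>) ((verts \<sigma> - {v}) \<union> {v}) ((verts \<sigma>' - {v'}) \<union> {v'})"
    by (rule bij_betw_combine) (auto simp: v)
  then show "bij_betw (persp \<tau>) (verts \<sigma>) (verts (across \<tau>))"
    using assms(2) s'(2,4) by (simp add: insert_absorb)
qed

lemma pairing_involution: "\<tau> \<in> facets T \<Longrightarrow> \<Phi> (\<Phi> \<tau> ` \<tau>) ` \<Phi> \<tau> ` \<tau> = \<tau>"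
  using pairing_inverse by (auto simp: image_image)

text \<open>On the facet the partner pairing undoes the pairing. The opposite vertex returns because
  the partner of the partner facet is \<open>\<tau>\<close> itself.\<close>

lemma perspectivity_back:
  assumes "\<sigma> \<in> T" "v \<in> verts \<sigma>" and t: "\<tau> = opp_facet \<sigma> v"
  shows "across (\<Phi> \<tau> ` \<tau>) = \<sigma>" "w \<in> verts \<sigma> \<Longrightarrow> persp (\<Phi> \<tau> ` \<tau>) (persp \<tau> w) = w"
proof -
  note p = perspectivity[OF assms]
  have f: "\<tau> \<in> facets T"
    using opp_facet(1) assms by blast
  show "across (\<Phi> \<tau> ` \<tau>) = \<sigma>"
    using pairing_involution[OF f] opp_facet(3)[OF assms(1,2)] t by simp
  assume w: "w \<in> verts \<sigma>"
  show "persp (\<Phi> \<tau> ` \<tau>) (persp \<tau> w) = w"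
  proof (cases "w = v")
    case True
    have "persp \<tau> v \<notin> \<Phi> \<tau> ` \<tau>"
      by (subst p(3)) (simp add: vertex_mem_opp_facet[OF p(1,2)])
    then show ?thesis
      using True pairing_involution[OF f] opp_facet(4)[OF assms(1,2)] t by (simp add: perspectivity_def)
  next
    case False
    then have "w \<in> \<tau>"
      using vertex_mem_opp_facet[OF assms(1) w] t by simp
    then show ?thesis
      using pairing_inverse[OF f] by (simp add: perspectivity_def)
  qed
qed

lemma pairing_convex_hull:
  assumes "\<sigma> \<in> T" "v \<in> verts \<sigma>" "\<tau> = opp_facet \<sigma> v" "C \<subseteq> verts \<sigma> - {v}"
  shows "\<Phi> \<tau> ` (convex hull C) = convex hull (persp \<tau> ` C)"
proof -
  have f: "\<tau> \<in> facets T"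
    using opp_facet(1) assms by blast
  have "convex \<tau>" "verts \<sigma> - {v} \<subseteq> \<tau>"
    unfolding assms(3) opp_facet_def by (simp_all add: hull_subset)
  then have "\<Phi> \<tau> ` (convex hull C) = convex hull (\<Phi> \<tau> ` C)"
    using affine_map_on_convex_hull[OF pairing_affine[OF f]] assms(4) by blast
  also have "\<Phi> \<tau> ` C = persp \<tau> ` C"
    using assms(4) by (intro image_cong refl perspectivity(5)[OF assms(1-3), symmetric]) auto
  finally show ?thesis .
qed

section \<open>Paths in the dual 1-skeleton\<close>

lemma dual_path_start: "dual_path T \<Phi> \<sigma> \<gamma> \<sigma>' \<Longrightarrow> \<sigma> \<in> T"
  by (cases \<gamma>) auto

lemma dual_path_end: "dual_path T \<Phi> \<sigma> \<gamma> \<sigma>' \<Longrightarrow> \<sigma>' \<in> T"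
  by (induction \<gamma> arbitrary: \<sigma>) auto

lemma dual_path_append:
  "dual_path T \<Phi> \<sigma> (\<gamma> @ \<delta>) \<sigma>'' \<longleftrightarrow> (\<exists>\<sigma>'. dual_path T \<Phi> \<sigma> \<gamma> \<sigma>' \<and> dual_path T \<Phi> \<sigma>' \<delta> \<sigma>'')"
  by (induction \<gamma> arbitrary: \<sigma>) (auto dest: dual_path_start)

lemma projectivity_append: "projectivity T \<Phi> (\<gamma> @ \<delta>) v = projectivity T \<Phi> \<delta> (projectivity T \<Phi> \<gamma> v)"
  by (simp add: projectivity_def)

lemma projectivity_bij:
  "dual_path T \<Phi> \<sigma> \<gamma> \<sigma>' \<Longrightarrow> bij_betw (projectivity T \<Phi> \<gamma>) (verts \<sigma>) (verts \<sigma>')"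
proof (induction \<gamma> arbitrary: \<sigma>)
  case Nil
  then show ?case by (simp add: projectivity_def bij_betw_def)
next
  case (Cons \<tau> \<gamma>)
  then obtain v where v: "\<sigma> \<in> T" "v \<in> verts \<sigma>" "\<tau> = opp_facet \<sigma> v"
    using facet_iff by auto
  have "bij_betw (projectivity T \<Phi> \<gamma> \<circ> persp \<tau>) (verts \<sigma>) (verts \<sigma>')"
    using Cons perspectivity(4)[OF v] by (auto intro: bij_betw_trans)
  then show ?case
    by (simp add: projectivity_def comp_def)
qed

section \<open>Turning about a codimension two face\<close>

definition flags :: "('a set \<times> 'a \<times> 'a) set" where
  "flags = {(\<sigma>, a, b). \<sigma> \<in> T \<and> a \<in> verts \<sigma> \<and> b \<in> verts \<sigma> \<and> a \<noteq> b}"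

text \<open>The flag \<open>(\<sigma>, a, b)\<close> encodes the codimension two face of \<open>\<sigma>\<close> avoiding \<open>a\<close> and \<open>b\<close>, together
  with the facet opposite \<open>b\<close> as the one to be crossed next.\<close>

definition ridge :: "'a set \<times> 'a \<times> 'a \<Rightarrow> 'a set" where
  "ridge = (\<lambda>(\<sigma>, a, b). convex hull (verts \<sigma> - {a, b}))"

text \<open>The image of \<open>b\<close> lies opposite the facet of entry, so crossing again leads
  straight back. Only after \<open>flip\<close> does the flag point to the other facet at the
  ridge.\<close>

definition cross :: "'a set \<times> 'a \<times> 'a \<Rightarrow> 'a set \<times> 'a \<times> 'a" where
  "cross = (\<lambda>(\<sigma>, a, b). (across (opp_facet \<sigma> b), persp (opp_facet \<sigma> b) a, persp (opp_facet \<sigma> b) b))"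

definition flip :: "'a set \<times> 'a \<times> 'a \<Rightarrow> 'a set \<times> 'a \<times> 'a" where
  "flip = (\<lambda>(\<sigma>, a, b). (\<sigma>, b, a))"

definition turn :: "'a set \<times> 'a \<times> 'a \<Rightarrow> 'a set \<times> 'a \<times> 'a" where
  "turn f = flip (cross f)"

lemma flip_flags:
  "f \<in> flags \<Longrightarrow> flip f \<in> flags" "flip (flip f) = f" "f \<in> flags \<Longrightarrow> flip f \<noteq> f" "ridge (flip f) = ridge f"
  by (auto simp: flags_def flip_def ridge_def insert_commute split: prod.splits)

lemma cross_flags:
  assumes "f \<in> flags"
  shows "cross f \<in> flags" "cross (cross f) = f"
proof -
  obtain \<sigma> a b where f: "f = (\<sigma>, a, b)" "\<sigma> \<in> T" "a \<in> verts \<sigma>" "b \<in> verts \<sigma>" "a \<noteq> b"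
    using assms by (auto simp: flags_def)
  note p = perspectivity[OF f(2,4) refl] and q = perspectivity_back[OF f(2,4) refl]
  have "inj_on (persp (opp_facet \<sigma> b)) (verts \<sigma>)"
    using p(4) bij_betw_imp_inj_on by blast
  then have "persp (opp_facet \<sigma> b) a \<noteq> persp (opp_facet \<sigma> b) b"
    using f by (auto dest: inj_onD)
  then show "cross f \<in> flags"
    using f p(1,2) bij_betw_apply[OF p(4)] by (auto simp: cross_def flags_def)
  show "cross (cross f) = f"
    using f p(3) q by (simp add: cross_def)
qed

lemma ridge_cross:
  assumes "(\<sigma>, a, b) \<in> flags"
  shows "ridge (cross (\<sigma>, a, b)) = \<Phi> (opp_facet \<sigma> b) ` ridge (\<sigma>, a, b)"
proof -
  have f: "\<sigma> \<in> T" "a \<in> verts \<sigma>" "b \<in> verts \<sigma>"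
    using assms by (auto simp: flags_def)
  note p = perspectivity(4)[OF f(1,3) refl]
  have "persp (opp_facet \<sigma> b) ` (verts \<sigma> - {a, b})
      = verts (across (opp_facet \<sigma> b)) - {persp (opp_facet \<sigma> b) a, persp (opp_facet \<sigma> b) b}"
    using p f inj_on_image_set_diff[of "persp (opp_facet \<sigma> b)" "verts \<sigma>" "verts \<sigma>" "{a, b}"]
    by (auto simp: bij_betw_def)
  then show ?thesis
    using pairing_convex_hull[OF f(1,3) refl, of "verts \<sigma> - {a, b}"]
    by (auto simp: ridge_def cross_def)
qed

end

section \<open>Products of two involutions and odd periods\<close>

text \<open>\<open>s\<close> is a rotation in the dihedral group generated by \<open>c\<close> and
  \<open>i\<close>, and \<open>i\<close> conjugates it into its inverse. If one point of the orbit
  were \<open>i\<close> of another, the odd period would allow the connecting power to be chosen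
  even, and half way along it there would be a fixed point of \<open>i\<close>.\<close>

lemma involutions_no_odd_period:
  assumes F: "\<And>x. x \<in> F \<Longrightarrow> c x \<in> F" "\<And>x. x \<in> F \<Longrightarrow> c (c x) = x"
    "\<And>x. x \<in> F \<Longrightarrow> i x \<in> F" "\<And>x. x \<in> F \<Longrightarrow> i (i x) = x" "\<And>x. x \<in> F \<Longrightarrow> i x \<noteq> x"
    and s: "\<And>x. s x = i (c x)"
    and f: "f \<in> F" and L: "(s ^^ L) f = f" "odd L"
  shows "(s ^^ a) f \<noteq> i ((s ^^ b) f)"
proof
  assume eq: "(s ^^ a) f = i ((s ^^ b) f)"
  have sF: "x \<in> F \<Longrightarrow> (s ^^ m) x \<in> F" for m x
    by (induction m) (auto simp: s F)
  \<comment> \<open>The dihedral relation: \<open>s (i (s y)) = i y\<close> cancels one layer at a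
    time.\<close>
  have rev: "x \<in> F \<Longrightarrow> (s ^^ m) (i ((s ^^ m) x)) = i x" for m x
  proof (induction m)
    case (Suc m)
    have "(s ^^ Suc m) (i ((s ^^ Suc m) x)) = (s ^^ m) (s (i (s ((s ^^ m) x))))"
      by (simp add: funpow_swap1)
    also have "s (i (s ((s ^^ m) x))) = i ((s ^^ m) x)"
      using sF[OF Suc.prems, of m] by (simp add: s F)
    finally show ?case using Suc by simp
  qed simp
  have per: "(s ^^ (L * m)) f = f" for m
    using L(1) by (induction m) (simp_all add: funpow_add)
  define g where "g = (s ^^ b) f"
  have g: "g \<in> F" "i g = (s ^^ a) f"
    using sF[OF f] eq by (auto simp: g_def)
  have gL: "(s ^^ L) g = g"
    unfolding g_def by (metis L(1) add.commute comp_apply funpow_add)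
  \<comment> \<open>The exponent must be a natural number although \<open>a\<close> may be smaller
    than \<open>b\<close>. As \<open>g\<close> has already used \<open>b\<close> steps,
    \<open>(L - 1) * b\<close> further ones complete \<open>b\<close> full periods.\<close>
  obtain j0 where j0: "(s ^^ j0) g = i g"
  proof
    have "L * b = (L - 1) * b + b"
      using L(2) by (cases L) auto
    then have "a + L * b = (a + (L - 1) * b) + b"
      by simp
    then have "(s ^^ (a + (L - 1) * b)) g = (s ^^ (a + L * b)) f"
      by (simp only: g_def funpow_add comp_apply)
    also have "\<dots> = (s ^^ a) f"
      by (simp add: funpow_add per)
    finally show "(s ^^ (a + (L - 1) * b)) g = i g"
      using g by simp
  qed
  \<comment> \<open>One additional odd period changes the parity of the exponent.\<close>
  obtain j where j: "(s ^^ (j + j)) g = i g"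
  proof (cases "even j0")
    case True
    then show ?thesis using j0 that by (metis evenE mult_2)
  next
    case False
    with L(2) obtain j where "j0 + L = j + j"
      by (metis evenE mult_2 odd_even_add)
    moreover have "(s ^^ (j0 + L)) g = i g"
      using j0 gL by (simp add: funpow_add)
    ultimately show ?thesis using that by metis
  qed
  define h where "h = (s ^^ j) g"
  have h: "h \<in> F" using sF g h_def by blast
  \<comment> \<open>Both sides equal \<open>i g\<close>, the left one by \<open>rev\<close>. Two
    further instances of \<open>rev\<close> then play the part of injectivity of
    \<open>s ^^ j\<close>.\<close>
  have "(s ^^ j) (i h) = (s ^^ j) h"
    using j rev[OF g(1), of j] by (simp add: h_def funpow_add)
  then have "i (i h) = i h"
    using rev[OF h, of j] rev[OF F(3)[OF h], of j] by metis
  then show False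
    using F(3,5)[OF h] F(4)[OF h] by metis
qed

text \<open>The orbit has as many elements as the least period, which divides \<open>L\<close> and
  is therefore odd.\<close>

lemma odd_card_funpow_orbit:
  assumes "(s ^^ L) f = f" "odd L"
  shows "odd (card (range (\<lambda>i. (s ^^ i) f)))"
proof -
  have L: "0 < L" using assms(2) by (cases L) auto
  define m where "m = (LEAST m. 0 < m \<and> (s ^^ m) f = f)"
  have m: "0 < m" "(s ^^ m) f = f"
    using LeastI[of "\<lambda>m. 0 < m \<and> (s ^^ m) f = f" L] L assms(1) unfolding m_def by auto
  have least: "\<not> (0 < j \<and> (s ^^ j) f = f)" if "j < m" for j
    using that not_less_Least unfolding m_def by blast
  have md: "(s ^^ (i mod m)) f = (s ^^ i) f" for i
    using funpow_mod_eq[OF m(2)] .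
  have "L mod m = 0"
    using least[of "L mod m"] md[of L] m(1) assms(1) by auto
  then have "odd m" using assms(2) by (metis dvd_trans mod_0_imp_dvd)
  moreover have "range (\<lambda>i. (s ^^ i) f) = (\<lambda>i. (s ^^ i) f) ` {..<m}"
    using md m(1) by (auto simp: image_iff) (metis lessThan_iff mod_less_divisor)
  moreover have "inj_on (\<lambda>i. (s ^^ i) f) {..<m}"
  proof (rule linorder_inj_onI)
    fix i j assume ij: "i < j" "i \<in> {..<m}" "j \<in> {..<m}"
    show "(s ^^ i) f \<noteq> (s ^^ j) f"
    proof
      assume "(s ^^ i) f = (s ^^ j) f"
      \<comment> \<open>Running on to the full period \<open>m\<close> turns the collision into a
        period shorter than \<open>m\<close>.\<close>
      then have "(s ^^ (m - j + i)) f = (s ^^ (m - j + j)) f"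
        by (simp only: funpow_add comp_apply)
      also have "m - j + j = m"
        using ij by simp
      finally show False
        using least[of "m - j + i"] m ij by auto
    qed
  qed auto
  ultimately show ?thesis by (simp add: card_image)
qed

section \<open>Ridges over a singlex and the parity of turns\<close>

context face_paired_simplices
begin

lemma equiv_face_equiv: "equiv (\<Union>T) (face_equiv T \<Phi>)"
  unfolding face_equiv_def by (rule equiv_generated_equiv)

lemma facet_subset_Union: "\<tau> \<in> facets T \<Longrightarrow> \<tau> \<subseteq> \<Union>T"
  unfolding facets_def by (auto dest: facet_of_imp_subset)

lemma face_equiv_pairing:
  assumes "\<tau> \<in> facets T" "x \<in> \<tau>"
  shows "(x, \<Phi> \<tau> x) \<in> face_equiv T \<Phi>"
  unfolding face_equiv_def
  using assms facet_subset_Union[OF assms(1)] facet_subset_Union[OF pairing_facet[OF assms(1)]]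
  by (intro generated_equivI) auto

lemma proj_eq_iff: "x \<in> \<Union>T \<Longrightarrow> y \<in> \<Union>T \<Longrightarrow> proj T \<Phi> x = proj T \<Phi> y \<longleftrightarrow> (x, y) \<in> face_equiv T \<Phi>"
  unfolding proj_def using eq_equiv_class_iff[OF equiv_face_equiv] by blast

lemma proj_pairing:
  assumes "\<tau> \<in> facets T" "x \<in> \<tau>"
  shows "proj T \<Phi> (\<Phi> \<tau> x) = proj T \<Phi> x"
  unfolding proj_def using equiv_class_eq[OF equiv_face_equiv face_equiv_pairing[OF assms]] by simp

text \<open>The partner pairing reverses each pairing, so the generators are symmetric and stability
  under pairings suffices.\<close>

lemma face_equiv_induct:
  assumes "(x, y) \<in> face_equiv T \<Phi>" "P x"
    and "\<And>\<tau> z. \<tau> \<in> facets T \<Longrightarrow> z \<in> \<tau> \<Longrightarrow> P z \<Longrightarrow> P (\<Phi> \<tau> z)"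
  shows "P y"
  using assms(1)[unfolded face_equiv_def] assms(2)
proof (rule generated_equiv_sym_induct)
  fix u v assume "(u, v) \<in> {(x, \<Phi> \<tau> x) |\<tau> x. \<tau> \<in> facets T \<and> x \<in> \<tau>}"
  then obtain \<tau> where t: "\<tau> \<in> facets T" "u \<in> \<tau>" "v = \<Phi> \<tau> u" by blast
  then have "(v, \<Phi> (\<Phi> \<tau> ` \<tau>) v) \<in> {(x, \<Phi> \<tau> x) |\<tau> x. \<tau> \<in> facets T \<and> x \<in> \<tau>}"
    using pairing_facet by blast
  then show "(v, u) \<in> {(x, \<Phi> \<tau> x) |\<tau> x. \<tau> \<in> facets T \<and> x \<in> \<tau>}"
    using t pairing_inverse by simp
  show "P u \<Longrightarrow> P v" using t assms(3) by blast
qed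

lemma aff_dim_convex_hull_verts:
  assumes "\<sigma> \<in> T" "C \<subseteq> verts \<sigma>"
  shows "aff_dim (convex hull C) = int (card C) - 1"
  using aff_dim_affine_independent[OF affine_independent_subset[OF simplex_verts(1)[OF assms(1)] assms(2)]]
  by (simp add: aff_dim_convex_hull)

lemma face_iff: "\<sigma> \<in> T \<Longrightarrow> F face_of \<sigma> \<longleftrightarrow> (\<exists>C. C \<subseteq> verts \<sigma> \<and> F = convex hull C)"
  using face_of_convex_hull_affine_independent[OF simplex_verts(1)] simplex_verts(3) by metis

lemma ridge_face:
  assumes "(\<sigma>, a, b) \<in> flags"
  shows "ridge (\<sigma>, a, b) face_of \<sigma>" "aff_dim (ridge (\<sigma>, a, b)) = int n - 2"
    "ridge (\<sigma>, a, b) \<noteq> {}" "verts (ridge (\<sigma>, a, b)) = verts \<sigma> - {a, b}"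
    "ridge (\<sigma>, a, b) \<subseteq> opp_facet \<sigma> b"
proof -
  have f: "\<sigma> \<in> T" "a \<in> verts \<sigma>" "b \<in> verts \<sigma>" "a \<noteq> b"
    using assms by (auto simp: flags_def)
  have c: "card (verts \<sigma> - {a, b}) = n - 1"
    using f simplex_verts[OF f(1)] by (simp add: card_Diff_subset)
  show "ridge (\<sigma>, a, b) face_of \<sigma>"
    unfolding ridge_def using face_iff[OF f(1)] by auto
  show "aff_dim (ridge (\<sigma>, a, b)) = int n - 2"
    using aff_dim_convex_hull_verts[OF f(1), of "verts \<sigma> - {a, b}"] c n_ge
    by (simp add: ridge_def)
  show "ridge (\<sigma>, a, b) \<noteq> {}"
  proof -
    have "verts \<sigma> - {a, b} \<noteq> {}"
      using c n_ge by (metis card.empty diff_is_0_eq not_numeral_le_zero One_nat_def Suc_1 Suc_n_not_le_n le_trans)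
    then show ?thesis by (simp add: ridge_def)
  qed
  show "verts (ridge (\<sigma>, a, b)) = verts \<sigma> - {a, b}"
    using verts_convex_hull_verts[OF f(1), of "verts \<sigma> - {a, b}"] by (auto simp: ridge_def)
  show "ridge (\<sigma>, a, b) \<subseteq> opp_facet \<sigma> b"
    unfolding ridge_def opp_facet_def by (auto intro!: hull_mono)
qed

lemma codim2_face_is_ridge:
  assumes "\<sigma> \<in> T" "\<eta> face_of \<sigma>" "aff_dim \<eta> = int n - 2"
  obtains a b where "(\<sigma>, a, b) \<in> flags" "\<eta> = ridge (\<sigma>, a, b)"
proof -
  obtain C where C: "C \<subseteq> verts \<sigma>" "\<eta> = convex hull C"
    using face_iff[OF assms(1)] assms(2) by blast
  have "card C = n - 1"
    using aff_dim_convex_hull_verts[OF assms(1) C(1)] assms(3) C(2) by simp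
  moreover have "finite C"
    using C simplex_verts(4)[OF assms(1)] finite_subset by blast
  ultimately have "card (verts \<sigma> - C) = 2"
    using C simplex_verts[OF assms(1)] n_ge by (simp add: card_Diff_subset)
  then obtain a b where ab: "verts \<sigma> - C = {a, b}" "a \<noteq> b"
    by (auto simp: card_2_iff)
  then have "C = verts \<sigma> - {a, b}" "a \<in> verts \<sigma>" "b \<in> verts \<sigma>"
    using C(1) by auto
  with ab C(2) assms(1) show ?thesis
    by (intro that[of a b]) (auto simp: flags_def ridge_def)
qed

text \<open>A nonempty ridge determines its simplex, and its vertices determine the two missing ones
  up to order.\<close>

lemma ridge_eq_cases:
  assumes "f \<in> flags" "g \<in> flags" "ridge f = ridge g"
  shows "f = g \<or> f = flip g"
proof -
  obtain \<sigma> a b where f: "f = (\<sigma>, a, b)" by (cases f) auto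
  obtain \<sigma>' a' b' where g: "g = (\<sigma>', a', b')" by (cases g) auto
  note F = ridge_face[OF assms(1)[unfolded f]] and G = ridge_face[OF assms(2)[unfolded g]]
  have fg: "\<sigma> \<in> T" "a \<in> verts \<sigma>" "b \<in> verts \<sigma>" "a \<noteq> b"
      "\<sigma>' \<in> T" "a' \<in> verts \<sigma>'" "b' \<in> verts \<sigma>'" "a' \<noteq> b'"
    using assms f g by (auto simp: flags_def)
  obtain x where "x \<in> ridge f"
    using F(3) f by blast
  then have s: "\<sigma> = \<sigma>'"
    using F(1) G(1) assms(3) f g fg simplex_unique face_of_imp_subset by blast
  have "verts \<sigma> - {a, b} = verts \<sigma> - {a', b'}"
    using F(4) G(4) assms(3) f g s by simp
  then have "{a, b} = {a', b'}"
    using fg s by blast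
  then show ?thesis
    using f g s by (auto simp: flip_def doubleton_eq_iff)
qed

lemma turn_flags: "f \<in> flags \<Longrightarrow> turn f \<in> flags" "f \<in> flags \<Longrightarrow> (turn ^^ i) f \<in> flags"
proof -
  show *: "turn f \<in> flags" if "f \<in> flags" for f
    using that cross_flags flip_flags by (simp add: turn_def)
  show "f \<in> flags \<Longrightarrow> (turn ^^ i) f \<in> flags"
    by (induction i) (auto simp: *)
qed

lemma proj_ridge_turn:
  assumes "f \<in> flags"
  shows "proj T \<Phi> ` ridge (turn f) = proj T \<Phi> ` ridge f"
proof -
  obtain \<sigma> a b where f: "f = (\<sigma>, a, b)" by (cases f) auto
  have s: "\<sigma> \<in> T" "b \<in> verts \<sigma>"
    using assms f by (auto simp: flags_def)
  have "ridge (turn f) = \<Phi> (opp_facet \<sigma> b) ` ridge f"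
    using ridge_cross assms flip_flags(4) by (simp add: turn_def f)
  also have "proj T \<Phi> ` \<dots> = proj T \<Phi> ` ridge f"
    unfolding image_image
  proof (rule image_cong)
    show "proj T \<Phi> (\<Phi> (opp_facet \<sigma> b) x) = proj T \<Phi> x" if "x \<in> ridge f" for x
      using that proj_pairing[OF opp_facet(1)[OF s]] ridge_face(5) assms f by blast
  qed simp
  finally show ?thesis .
qed

text \<open>The flags met when turning about a ridge either determine pairwise distinct ridges, which
  then are all the ridges over the same singlex, or some flag is met in both directions.\<close>

lemma even_turn_period:
  assumes ev: "\<forall>s\<in>singlices (int n - 2) T \<Phi>. even (singlex_degree (int n - 2) T \<Phi> s)"
    and f: "f \<in> flags" and L: "(turn ^^ L) f = f"
  shows "even L"
proof (rule ccontr)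
  assume odd: "odd L"
  define Orb where "Orb = range (\<lambda>i. (turn ^^ i) f)"
  have Orb: "g \<in> flags" if "g \<in> Orb" for g
    using that turn_flags(2)[OF f] by (auto simp: Orb_def)
  have f_Orb: "f \<in> Orb"
    unfolding Orb_def by (rule range_eqI[of _ _ 0]) simp
  have turn_Orb: "turn g \<in> Orb" if g: "g \<in> Orb" for g
  proof -
    obtain i where "g = (turn ^^ i) f" using g Orb_def by blast
    then have "turn g = (turn ^^ Suc i) f" by simp
    then show ?thesis unfolding Orb_def by blast
  qed
  have per: "(turn ^^ (i + L)) f = (turn ^^ i) f" for i
    using L by (simp add: funpow_add)
  \<comment> \<open>Periodicity makes \<open>turn\<close> surjective on the orbit; an odd
    \<open>L\<close> is positive, so there is a preceding step.\<close>
  have turn_back: "\<exists>h\<in>Orb. g = turn h" if g: "g \<in> Orb" for g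
  proof -
    obtain i where "g = (turn ^^ i) f" using g Orb_def by blast
    then have "g = (turn ^^ Suc (i + L - 1)) f"
      using per[of i] odd by (cases L) auto
    then have "g = turn ((turn ^^ (i + L - 1)) f)" by simp
    then show ?thesis unfolding Orb_def by blast
  qed
  have noflip: "(turn ^^ i) f \<noteq> flip ((turn ^^ j) f)" for i j
    by (rule involutions_no_odd_period[where F = flags and c = cross, OF _ _ _ _ _ _ f L odd])
      (simp_all add: cross_flags flip_flags turn_def)
  have inj: "inj_on ridge Orb"
  proof (rule inj_onI)
    fix g h assume gh: "g \<in> Orb" "h \<in> Orb" "ridge g = ridge h"
    then obtain i j where "g = (turn ^^ i) f" "h = (turn ^^ j) f"
      unfolding Orb_def by blast
    then have "g \<noteq> flip h" using noflip by simp
    then show "g = h" using ridge_eq_cases[of g h] gh Orb by blast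
  qed
  let ?D = "{\<eta> \<in> simplices (int n - 2) T. proj T \<Phi> ` \<eta> = proj T \<Phi> ` ridge f}"
  have simp_ridge: "ridge g \<in> simplices (int n - 2) T" if "g \<in> flags" for g
  proof -
    obtain \<sigma> a b where g: "g = (\<sigma>, a, b)" by (cases g) auto
    then have "\<sigma> \<in> T" using that by (simp add: flags_def)
    then show ?thesis
      using ridge_face(1,2)[OF that[unfolded g]] unfolding simplices_def g by blast
  qed
  have "ridge ` Orb \<subseteq> ?D"
  proof -
    have "proj T \<Phi> ` ridge ((turn ^^ i) f) = proj T \<Phi> ` ridge f" for i
      using f by (induction i) (simp_all add: proj_ridge_turn turn_flags)
    then have "proj T \<Phi> ` ridge g = proj T \<Phi> ` ridge f" if "g \<in> Orb" for g
      using that unfolding Orb_def by blast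
    then show ?thesis using simp_ridge Orb by blast
  qed
  \<comment> \<open>A relative interior point \<open>x\<close> of \<open>ridge f\<close> is followed
    to an equivalent point \<open>y\<close> of \<eta>. Every pairing applicable on the way carries
    the whole current ridge along, to a ridge of the orbit.\<close>
  moreover have "?D \<subseteq> ridge ` Orb"
  proof
    fix \<eta> assume "\<eta> \<in> ?D"
    then obtain \<sigma>' where \<eta>: "\<sigma>' \<in> T" "\<eta> face_of \<sigma>'" "aff_dim \<eta> = int n - 2"
        and pr: "proj T \<Phi> ` \<eta> = proj T \<Phi> ` ridge f"
      by (auto simp: simplices_def)
    have cvx: "convex (ridge g)" for g
      by (cases g) (simp add: ridge_def)
    obtain \<sigma> a b where fe: "f = (\<sigma>, a, b)" by (cases f) auto
    have "ridge f \<noteq> {}" using ridge_face(3) f fe by blast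
    then obtain x where x: "x \<in> rel_interior (ridge f)"
      using rel_interior_eq_empty[OF cvx] by blast
    then have xr: "x \<in> ridge f" using rel_interior_subset by blast
    have "\<sigma> \<in> T" using f fe by (simp add: flags_def)
    then have xT: "x \<in> \<Union>T"
      using xr ridge_face(1) f fe face_of_imp_subset by blast
    have "proj T \<Phi> x \<in> proj T \<Phi> ` \<eta>"
      using xr pr by blast
    then obtain y where y: "y \<in> \<eta>" "proj T \<Phi> x = proj T \<Phi> y" by blast
    then have yT: "y \<in> \<sigma>'" using \<eta> face_of_imp_subset by blast
    have "(x, y) \<in> face_equiv T \<Phi>"
      using proj_eq_iff[OF xT, of y] y yT \<eta>(1) by blast
    then have "\<exists>g\<in>Orb. y \<in> rel_interior (ridge g)"
    proof (rule face_equiv_induct)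
      show "\<exists>g\<in>Orb. x \<in> rel_interior (ridge g)" using x f_Orb by blast
    next
      fix \<tau> z assume t: "\<tau> \<in> facets T" "z \<in> \<tau>" and "\<exists>g\<in>Orb. z \<in> rel_interior (ridge g)"
      then obtain g where g: "g \<in> Orb" "z \<in> rel_interior (ridge g)" by blast
      obtain \<sigma>1 a1 b1 where ge: "g = (\<sigma>1, a1, b1)" by (cases g) auto
      have gf: "(\<sigma>1, a1, b1) \<in> flags" using Orb[OF g(1)] ge by simp
      then have g1: "\<sigma>1 \<in> T" "a1 \<in> verts \<sigma>1" "b1 \<in> verts \<sigma>1" by (auto simp: flags_def)
      obtain \<sigma>2 c where c: "\<sigma>2 \<in> T" "c \<in> verts \<sigma>2" "\<tau> = opp_facet \<sigma>2 c"
        using facet_cases[OF t(1)] by metis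
      have "z \<in> \<sigma>1"
        using g(2) ge ridge_face(1)[OF gf] face_of_imp_subset rel_interior_subset by blast
      moreover have "z \<in> \<sigma>2"
        using t(2) c opp_facet_subset by blast
      ultimately have s: "\<sigma>2 = \<sigma>1"
        using simplex_unique g1 c by blast
      have "\<tau> face_of \<sigma>1"
        using opp_facet(2)[OF c(1,2)] c s facet_of_imp_face_of by blast
      \<comment> \<open>A face that meets the relative interior of a subset of the simplex contains
        that subset.\<close>
      then have sub: "ridge g \<subseteq> \<tau>"
        using subset_of_face_of[of \<tau> \<sigma>1 "ridge g"] ridge_face(1)[OF gf] face_of_imp_subset ge g(2) t(2)
        by blast
      have "verts \<sigma>1 - {a1, b1} \<subseteq> ridge g"
        unfolding ge ridge_def by (simp add: hull_subset)
      then have "c \<notin> verts \<sigma>1 - {a1, b1}"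
        using sub c s vertex_mem_opp_facet[of \<sigma>1 c c] by blast
      then have c_cases: "c = b1 \<or> c = a1"
        using c s by blast
      have img: "\<Phi> \<tau> z \<in> rel_interior (\<Phi> \<tau> ` ridge g)"
        using affine_map_on_rel_interior[OF pairing_affine[OF t(1)] sub cvx] g(2) by blast
      \<comment> \<open>The facet opposite \<open>b1\<close> is the next to be crossed, the one
        opposite \<open>a1\<close> is the facet of entry. The latter leads back to the predecessor
        in the orbit.\<close>
      from c_cases show "\<exists>g\<in>Orb. \<Phi> \<tau> z \<in> rel_interior (ridge g)"
      proof
        assume "c = b1"
        then have "\<Phi> \<tau> ` ridge g = ridge (turn g)"
          using ridge_cross[OF gf] flip_flags(4) c s by (simp add: turn_def ge)
        then show ?thesis using img turn_Orb[OF g(1)] by metis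
      next
        assume ca: "c = a1"
        obtain h where h: "h \<in> Orb" "g = turn h" using turn_back[OF g(1)] by blast
        have "cross (flip g) = h"
          using h Orb cross_flags flip_flags by (simp add: turn_def)
        moreover have "flip g \<in> flags" "flip g = (\<sigma>1, b1, a1)"
          using gf flip_flags(1) ge by (auto simp: flip_def)
        ultimately have "ridge h = \<Phi> \<tau> ` ridge (flip g)"
          using ridge_cross[of \<sigma>1 b1 a1] c s ca by simp
        then have "\<Phi> \<tau> ` ridge g = ridge h"
          using flip_flags(4) by simp
        then show ?thesis using img h by metis
      qed
    qed
    then obtain g where g: "g \<in> Orb" "y \<in> rel_interior (ridge g)" by blast
    obtain \<sigma>1 a1 b1 where ge: "g = (\<sigma>1, a1, b1)" by (cases g) auto
    have gf: "(\<sigma>1, a1, b1) \<in> flags" using Orb[OF g(1)] ge by simp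
    have "y \<in> \<sigma>1"
      using g(2) ge ridge_face(1)[OF gf] face_of_imp_subset rel_interior_subset by blast
    then have s: "\<sigma>1 = \<sigma>'"
      using simplex_unique yT \<eta>(1) gf by (auto simp: flags_def)
    have gsub: "ridge g \<subseteq> \<eta>"
      using subset_of_face_of[OF \<eta>(2), of "ridge g"] ridge_face(1)[OF gf] face_of_imp_subset ge g(2) y(1) s
      by blast
    \<comment> \<open>A proper face has smaller dimension, so equal dimensions force
      equality.\<close>
    have "ridge g face_of \<eta>"
      using face_of_subset[OF _ gsub face_of_imp_subset[OF \<eta>(2)]] ridge_face(1)[OF gf] ge s by blast
    then have "ridge g = \<eta>"
      using face_of_aff_dim_lt[of \<eta> "ridge g"] face_of_imp_convex[OF \<eta>(2)] \<eta>(3) ridge_face(2)[OF gf] ge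
      by force
    then show "\<eta> \<in> ridge ` Orb" using g by blast
  qed
  ultimately have "?D = ridge ` Orb" by blast
  then have "card ?D = card Orb"
    using inj by (simp add: card_image)
  moreover have "odd (card Orb)"
    unfolding Orb_def by (rule odd_card_funpow_orbit[OF L odd])
  moreover have "even (card ?D)"
    using bspec[OF ev, of "proj T \<Phi> ` ridge f"] simp_ridge[OF f]
    by (simp add: singlex_degree_def singlices_def)
  ultimately show False by simp
qed

text \<open>The path is forced: just two facets contain the ridge and one of them is barred, so the
  path follows the iterates of \<open>turn\<close>. One step carries \<open>a\<close> to the second
  vertex of the next flag and \<open>b\<close> to the first, whence the dependence on parity. The
  extra facet \<open>t\<close> records how the path would continue.\<close>

lemma turns_about_flag:
  assumes "(\<sigma>, a, b) \<in> flags" "dual_path T \<Phi> \<sigma> \<gamma> \<sigma>'" "t facet_of \<sigma>'"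
    and "turns_about \<Phi> (ridge (\<sigma>, a, b)) (\<gamma> @ [t])" "hd (\<gamma> @ [t]) = opp_facet \<sigma> b"
  shows "\<exists>a' b'. (turn ^^ length \<gamma>) (\<sigma>, a, b) = (\<sigma>', a', b') \<and> t = opp_facet \<sigma>' b' \<and>
     (if even (length \<gamma>) then projectivity T \<Phi> \<gamma> a = a' \<and> projectivity T \<Phi> \<gamma> b = b'
      else projectivity T \<Phi> \<gamma> a = b' \<and> projectivity T \<Phi> \<gamma> b = a') \<and>
     (\<forall>v\<in>verts \<sigma> - {a, b}. projectivity T \<Phi> \<gamma> v = fold \<Phi> \<gamma> v)"
  using assms
proof (induction \<gamma> arbitrary: \<sigma> a b)
  case Nil
  then show ?case by (simp add: projectivity_def)
next
  case (Cons \<tau> \<gamma>)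
  let ?\<tau>' = "hd (\<gamma> @ [t])"
  let ?p = "persp (opp_facet \<sigma> b)"
  define \<sigma>1 where "\<sigma>1 = across \<tau>"
  have f: "\<sigma> \<in> T" "a \<in> verts \<sigma>" "b \<in> verts \<sigma>" "a \<noteq> b"
    using Cons.prems(1) by (auto simp: flags_def)
  have t: "\<tau> = opp_facet \<sigma> b" using Cons.prems(5) by simp
  note p = perspectivity[OF f(1,3) refl]
  have step: "turn (\<sigma>, a, b) = (\<sigma>1, ?p b, ?p a)"
    by (simp add: turn_def cross_def flip_def \<sigma>1_def t)
  then have fl: "(\<sigma>1, ?p b, ?p a) \<in> flags"
    using turn_flags(1)[OF Cons.prems(1)] by simp
  then have f1: "\<sigma>1 \<in> T" "?p b \<in> verts \<sigma>1" "?p a \<in> verts \<sigma>1" by (auto simp: flags_def)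
  have rd: "ridge (\<sigma>1, ?p b, ?p a) = \<Phi> \<tau> ` ridge (\<sigma>, a, b)"
    using ridge_cross[OF Cons.prems(1)] flip_flags(4) step t unfolding turn_def by metis
  obtain l where l: "\<gamma> @ [t] = ?\<tau>' # l"
    by (cases "\<gamma> @ [t]") auto
  have ta: "turns_about \<Phi> (\<Phi> \<tau> ` ridge (\<sigma>, a, b)) (\<gamma> @ [t])" "?\<tau>' \<noteq> \<Phi> \<tau> ` \<tau>"
    using Cons.prems(4) l by (metis append_Cons turns_about.simps(3))+
  have sub: "\<Phi> \<tau> ` ridge (\<sigma>, a, b) \<subseteq> ?\<tau>'"
    using ta(1) l by (metis turns_about.simps(2,3) neq_Nil_conv)
  have path: "dual_path T \<Phi> \<sigma>1 \<gamma> \<sigma>'"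
    using Cons.prems(2) by (simp add: \<sigma>1_def)
  have "?\<tau>' facet_of \<sigma>1"
    using path Cons.prems(3) by (cases \<gamma>) auto
  then obtain c where c: "c \<in> verts \<sigma>1" "?\<tau>' = opp_facet \<sigma>1 c"
    using facet_iff f1(1) by blast
  have "verts \<sigma>1 - {?p b, ?p a} \<subseteq> ?\<tau>'"
    using sub rd hull_subset[of "verts \<sigma>1 - {?p b, ?p a}" convex] by (simp add: ridge_def)
  then have "c = ?p b \<or> c = ?p a"
    using c vertex_mem_opp_facet[OF f1(1) c(1), of c] by auto
  \<comment> \<open>This is the facet of entry, which \<open>turns_about\<close> excludes as the
    next facet.\<close>
  moreover have "\<Phi> \<tau> ` \<tau> = opp_facet \<sigma>1 (?p b)"
    using p(3) t \<sigma>1_def by metis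
  ultimately have "?\<tau>' = opp_facet \<sigma>1 (?p a)"
    using ta(2) c by metis
  then obtain a' b' where IH: "(turn ^^ length \<gamma>) (\<sigma>1, ?p b, ?p a) = (\<sigma>', a', b')" "t = opp_facet \<sigma>' b'"
     "if even (length \<gamma>) then projectivity T \<Phi> \<gamma> (?p b) = a' \<and> projectivity T \<Phi> \<gamma> (?p a) = b'
      else projectivity T \<Phi> \<gamma> (?p b) = b' \<and> projectivity T \<Phi> \<gamma> (?p a) = a'"
     "\<forall>v\<in>verts \<sigma>1 - {?p b, ?p a}. projectivity T \<Phi> \<gamma> v = fold \<Phi> \<gamma> v"
    using Cons.IH[OF fl path Cons.prems(3)] ta(1) rd by metis
  have pc: "projectivity T \<Phi> (\<tau> # \<gamma>) v = projectivity T \<Phi> \<gamma> (?p v)" for v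
    by (simp add: projectivity_def t)
  have "projectivity T \<Phi> (\<tau> # \<gamma>) v = fold \<Phi> (\<tau> # \<gamma>) v" if "v \<in> verts \<sigma> - {a, b}" for v
  proof -
    have "?p v \<in> verts \<sigma>1 - {?p b, ?p a}"
      using that f p(4) \<sigma>1_def t by (auto simp: bij_betw_def inj_on_def)
    then have "projectivity T \<Phi> (\<tau> # \<gamma>) v = fold \<Phi> \<gamma> (?p v)"
      using IH(4) pc by simp
    also have "?p v = \<Phi> \<tau> v"
      using p(5)[of v] that t by simp
    finally show ?thesis by simp
  qed
  moreover have "(turn ^^ length (\<tau> # \<gamma>)) (\<sigma>, a, b) = (\<sigma>', a', b')"
    using IH(1) step by (simp add: funpow_swap1)
  ultimately show ?case
    using IH(2,3) pc by auto
qed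

text \<open>The vertices of the ridge are fixed because the composed pairings are the identity
  there. Closing up with \<open>hd r\<close> forces the last flag to equal the first, so the length
  is even, and an even number of exchanges fixes the other two vertices.\<close>

lemma dual_cell_boundary_projectivity:
  assumes ev: "\<forall>s\<in>singlices (int n - 2) T \<Phi>. even (singlex_degree (int n - 2) T \<Phi> s)"
    and r: "r \<in> dual_cell_boundaries n T \<Phi> \<sigma>" and v: "v \<in> verts \<sigma>"
  shows "projectivity T \<Phi> r v = v"
proof -
  obtain \<eta> where \<eta>: "\<eta> face_of \<sigma>" "aff_dim \<eta> = int n - 2"
      "turns_about \<Phi> \<eta> (r @ [hd r])" "\<forall>x\<in>\<eta>. fold \<Phi> r x = x"
    and p: "dual_path T \<Phi> \<sigma> r \<sigma>" "r \<noteq> []"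
    using r by (auto simp: dual_cell_boundaries_def dual_loops_def)
  have s: "\<sigma> \<in> T" using dual_path_start[OF p(1)] .
  obtain \<tau> l where l: "r = \<tau> # l" using p(2) by (cases r) auto
  have hf: "hd r facet_of \<sigma>" and sub: "\<eta> \<subseteq> hd r"
    using p(1) \<eta>(3) l by (auto, metis append_Cons list.exhaust subsetD turns_about.simps(3) append_is_Nil_conv list.distinct(1))
  obtain a b where f: "(\<sigma>, a, b) \<in> flags" "\<eta> = ridge (\<sigma>, a, b)" "hd r = opp_facet \<sigma> b"
  proof -
    obtain a b where ab: "(\<sigma>, a, b) \<in> flags" "\<eta> = ridge (\<sigma>, a, b)"
      using codim2_face_is_ridge[OF s \<eta>(1,2)] by blast
    obtain c where c: "c \<in> verts \<sigma>" "hd r = opp_facet \<sigma> c"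
      using hf facet_iff s by blast
    have "verts \<sigma> - {a, b} \<subseteq> hd r"
      using sub ab(2) hull_subset[of "verts \<sigma> - {a, b}" convex] by (simp add: ridge_def)
    then have "c = a \<or> c = b"
      using c vertex_mem_opp_facet[OF s c(1), of c] by auto
    moreover have "(\<sigma>, b, a) \<in> flags" "\<eta> = ridge (\<sigma>, b, a)"
      using ab flip_flags[of "(\<sigma>, a, b)"] by (auto simp: flip_def)
    ultimately show ?thesis using that ab c by blast
  qed
  have ab: "a \<in> verts \<sigma>" "b \<in> verts \<sigma>" "a \<noteq> b" using f(1) by (auto simp: flags_def)
  have "hd (r @ [hd r]) = opp_facet \<sigma> b" using f(3) p(2) by simp
  then obtain a' b' where t: "(turn ^^ length r) (\<sigma>, a, b) = (\<sigma>, a', b')" "hd r = opp_facet \<sigma> b'"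
     "if even (length r) then projectivity T \<Phi> r a = a' \<and> projectivity T \<Phi> r b = b'
      else projectivity T \<Phi> r a = b' \<and> projectivity T \<Phi> r b = a'"
     "\<forall>v\<in>verts \<sigma> - {a, b}. projectivity T \<Phi> r v = fold \<Phi> r v"
    using turns_about_flag[OF f(1) p(1) hf] \<eta>(3) f(2) by metis
  have "verts \<sigma> - {a, b} \<subseteq> \<eta>"
    using f(2) hull_subset[of "verts \<sigma> - {a, b}" convex] by (simp add: ridge_def)
  then have fixed: "projectivity T \<Phi> r v = v" if "v \<in> verts \<sigma> - {a, b}" for v
    using that t(4) \<eta>(4) by auto
  have "(\<sigma>, a', b') \<in> flags"
    using turn_flags(2)[OF f(1), of "length r"] t(1) by simp
  then have ab': "a' \<in> verts \<sigma>" "b' \<in> verts \<sigma>" "a' \<noteq> b'" by (auto simp: flags_def)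
  have bb: "b' = b"
    using t(2) f(3) vertex_mem_opp_facet[OF s ab(2)] vertex_mem_opp_facet[OF s ab'(2)] by metis
  have inj: "inj_on (projectivity T \<Phi> r) (verts \<sigma>)"
    using projectivity_bij[OF p(1)] bij_betw_imp_inj_on by blast
  \<comment> \<open>All other vertices are fixed, so by injectivity neither \<open>a\<close> nor
    \<open>b\<close> can be sent to one of them.\<close>
  have "a' \<in> {a, b}"
  proof (rule ccontr)
    assume "a' \<notin> {a, b}"
    then have "projectivity T \<Phi> r a' = a'" using fixed ab' by blast
    moreover have "projectivity T \<Phi> r a = a' \<or> projectivity T \<Phi> r b = a'"
      using t(3) by (auto split: if_splits)
    ultimately show False
      using inj_onD[OF inj] ab ab' \<open>a' \<notin> {a, b}\<close> by (metis insertCI)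
  qed
  then have aa: "a' = a" using bb ab' by blast
  have "even (length r)"
    using even_turn_period[OF ev f(1)] t(1) aa bb by simp
  then show ?thesis
    using fixed v t(3) aa bb by (cases "v \<in> {a, b}") auto
qed

lemma backtracking_projectivity:
  assumes "r \<in> backtrackings T \<Phi> \<sigma>" "\<sigma> \<in> T" "v \<in> verts \<sigma>"
  shows "projectivity T \<Phi> r v = v" "dual_path T \<Phi> \<sigma> r \<sigma>"
proof -
  obtain \<tau> where \<tau>: "r = [\<tau>, \<Phi> \<tau> ` \<tau>]" "\<tau> facet_of \<sigma>"
    using assms(1) by (auto simp: backtrackings_def)
  obtain b where b: "b \<in> verts \<sigma>" "\<tau> = opp_facet \<sigma> b"
    using \<tau>(2) facet_iff[OF assms(2)] by blast
  note p = perspectivity[OF assms(2) b] and q = perspectivity_back[OF assms(2) b]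
  show "projectivity T \<Phi> r v = v"
    using q(2)[OF assms(3)] \<tau>(1) by (simp add: projectivity_def)
  have "\<Phi> \<tau> ` \<tau> facet_of across \<tau>"
    using facet_iff[OF p(1)] p(2,3) by blast
  then show "dual_path T \<Phi> \<sigma> r \<sigma>"
    using \<tau> p(1) q(1) assms(2) by simp
qed

end

section \<open>Homotopy invariance of projectivities\<close>

locale even_face_paired_simplices = face_paired_simplices +
  assumes even_degrees: "\<forall>s\<in>singlices (int n - 2) T \<Phi>. even (singlex_degree (int n - 2) T \<Phi> s)"
begin

text \<open>The deleted piece \<open>r\<close> acts as the identity on the vertices of the simplex
  where it is inserted. Restriction to \<open>verts \<sigma>\<^sub>0\<close> discards values off the
  base simplex, which may depend on the loop.\<close>

lemma dual_homotopy_projectivity: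
  assumes "(\<gamma>, \<delta>) \<in> dual_homotopy n T \<Phi> \<sigma>\<^sub>0"
  shows "restrict (projectivity T \<Phi> \<gamma>) (verts \<sigma>\<^sub>0) = restrict (projectivity T \<Phi> \<delta>) (verts \<sigma>\<^sub>0)"
  using assms unfolding dual_homotopy_def
proof (rule generated_equiv_invariant[where f = "\<lambda>\<gamma>. restrict (projectivity T \<Phi> \<gamma>) (verts \<sigma>\<^sub>0)"])
  fix u v
  assume "(u, v) \<in> {(\<gamma> @ r @ \<delta>, \<gamma> @ \<delta>) | \<gamma> r \<delta>.
          \<exists>\<sigma>. dual_path T \<Phi> \<sigma>\<^sub>0 \<gamma> \<sigma> \<and> r \<in> backtrackings T \<Phi> \<sigma> \<union> dual_cell_boundaries n T \<Phi> \<sigma>}"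
  then obtain \<gamma> r \<delta> \<sigma> where uv: "u = \<gamma> @ r @ \<delta>" "v = \<gamma> @ \<delta>" "dual_path T \<Phi> \<sigma>\<^sub>0 \<gamma> \<sigma>"
    "r \<in> backtrackings T \<Phi> \<sigma> \<union> dual_cell_boundaries n T \<Phi> \<sigma>" by blast
  have "projectivity T \<Phi> r w = w" if "w \<in> verts \<sigma>" for w
    using uv(4) that backtracking_projectivity(1) dual_cell_boundary_projectivity[OF even_degrees]
      dual_path_end[OF uv(3)] by blast
  then show "restrict (projectivity T \<Phi> u) (verts \<sigma>\<^sub>0) = restrict (projectivity T \<Phi> v) (verts \<sigma>\<^sub>0)"
    using bij_betw_apply[OF projectivity_bij[OF uv(3)]]
    by (auto simp: uv(1,2) projectivity_append restrict_def)
qed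

text \<open>All loops of a class have the same restricted projectivity, so \<open>the_elem\<close>
  is applied to a singleton.\<close>

lemma symmetric_rep_class:
  assumes "\<gamma> \<in> dual_loops T \<Phi> \<sigma>\<^sub>0"
  shows "symmetric_rep T \<Phi> \<sigma>\<^sub>0 (dual_homotopy n T \<Phi> \<sigma>\<^sub>0 `` {\<gamma>})
    = restrict (projectivity T \<Phi> \<gamma>) (verts \<sigma>\<^sub>0)"
proof -
  let ?c = "dual_homotopy n T \<Phi> \<sigma>\<^sub>0 `` {\<gamma>}"
  have "equiv (dual_loops T \<Phi> \<sigma>\<^sub>0) (dual_homotopy n T \<Phi> \<sigma>\<^sub>0)"
    unfolding dual_homotopy_def by (rule equiv_generated_equiv)
  then have "\<gamma> \<in> ?c"
    using equiv_class_self assms by metis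
  have "(\<lambda>\<delta>. restrict (projectivity T \<Phi> \<delta>) (verts \<sigma>\<^sub>0)) ` ?c
     = (\<lambda>_. restrict (projectivity T \<Phi> \<gamma>) (verts \<sigma>\<^sub>0)) ` ?c"
    by (intro image_cong refl dual_homotopy_projectivity[symmetric]) auto
  also have "\<dots> = {restrict (projectivity T \<Phi> \<gamma>) (verts \<sigma>\<^sub>0)}"
    using \<open>\<gamma> \<in> ?c\<close> by blast
  finally show ?thesis
    by (simp add: symmetric_rep_def)
qed

end

section \<open>Bipartitions\<close>

abbreviation act :: "('b \<Rightarrow> 'c) \<Rightarrow> 'b set set \<Rightarrow> 'c set set" where
  "act f \<nu> \<equiv> (`) f ` \<nu>"

lemma act_act: "act g (act f \<nu>) = act (\<lambda>x. g (f x)) \<nu>"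
  by (simp add: image_image)

lemma act_cong: "(\<And>x. x \<in> \<Union>\<nu> \<Longrightarrow> f x = g x) \<Longrightarrow> act f \<nu> = act g \<nu>"
  by (intro image_cong) auto

lemma act_ident: "(\<And>x. x \<in> \<Union>\<nu> \<Longrightarrow> f x = x) \<Longrightarrow> act f \<nu> = \<nu>"
  using act_cong[of \<nu> f "\<lambda>x. x"] by simp

lemma Union_bipartition: "\<nu> \<in> bipartitions V k \<Longrightarrow> \<Union>\<nu> = V"
  by (auto simp: bipartitions_def)

lemma finite_bipartitions: "finite V \<Longrightarrow> finite (bipartitions V k)"
  by (rule finite_subset[of _ "Pow (Pow V)"]) (auto simp: bipartitions_def)

lemma act_bipartition:
  assumes "bij_betw f V W" "\<nu> \<in> bipartitions V k"
  shows "act f \<nu> \<in> bipartitions W k"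
proof -
  obtain A B where AB: "\<nu> = {A, B}" "A \<union> B = V" "A \<inter> B = {}" "card A = k" "card B = card V - k"
    using assms(2) by (auto simp: bipartitions_def)
  have inj: "inj_on f V" and W: "f ` V = W"
    using assms(1) by (auto simp: bij_betw_def)
  have "f ` A \<union> f ` B = W" using AB(2) W by blast
  moreover have "f ` A \<inter> f ` B = {}"
    using inj_on_image_Int[OF inj, of A B] AB by auto
  moreover have "card (f ` A) = k"
    using AB inj by (metis card_image inj_on_subset Un_upper1)
  moreover have "card (f ` B) = card W - k"
    using AB inj W by (metis card_image inj_on_subset Un_upper2)
  ultimately show ?thesis
    unfolding bipartitions_def mem_Collect_eq AB(1)
    by (intro exI[of _ "f ` A"] exI[of _ "f ` B"]) simp
qed

lemma bij_betw_act:
  assumes "bij_betw f V W"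
  shows "bij_betw (act f) (bipartitions V k) (bipartitions W k)"
proof (rule bij_betw_byWitness[where f' = "act (inv_into V f)"])
  have g: "bij_betw (inv_into V f) W V"
    using assms by (rule bij_betw_inv_into)
  show "\<forall>\<nu>\<in>bipartitions V k. act (inv_into V f) (act f \<nu>) = \<nu>"
    unfolding act_act by (intro ballI act_ident) (metis Union_bipartition assms bij_betw_inv_into_left)
  show "\<forall>\<nu>\<in>bipartitions W k. act f (act (inv_into V f) \<nu>) = \<nu>"
    unfolding act_act by (intro ballI act_ident) (metis Union_bipartition assms bij_betw_inv_into_right)
  show "act f ` bipartitions V k \<subseteq> bipartitions W k"
    using act_bipartition[OF assms] by blast
  show "act (inv_into V f) ` bipartitions W k \<subseteq> bipartitions V k"
    using act_bipartition[OF g] by blast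
qed

section \<open>Components of the hypersurface\<close>

locale normal_hypersurface = even_face_paired_simplices +
  fixes k :: nat
  assumes k_gt: "1 < k" and k_le: "2 * k \<le> n + 1"
    and connected: "connected_space (pseudo_manifold T \<Phi>)"
begin

text \<open>The first block has \<open>k > 1\<close> vertices, and \<open>2 * k \<le> n + 1\<close>
  makes the second at least as large.\<close>

lemma disc_type_cases:
  assumes "\<sigma> \<in> T" "\<nu> \<in> disc_types k \<sigma>"
  obtains A B where "\<nu> = {A, B}" "A \<union> B = verts \<sigma>" "A \<inter> B = {}" "2 \<le> card A" "2 \<le> card B"
    "finite A" "finite B"
proof -
  obtain A B where AB: "\<nu> = {A, B}" "A \<union> B = verts \<sigma>" "A \<inter> B = {}" "card A = k"
      "card B = card (verts \<sigma>) - k"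
    using assms(2) by (auto simp: disc_types_def bipartitions_def)
  moreover have "finite A" "finite B"
    using AB(2) simplex_verts(4)[OF assms(1)] by (metis finite_Un)+
  ultimately show ?thesis
    using that[of A B] k_gt k_le simplex_verts(2)[OF assms(1)] by auto
qed

text \<open>The union of the blocks is the vertex set, and its hull recovers the simplex.\<close>

lemma disc_type_simplex_unique:
  assumes "\<sigma> \<in> T" "\<sigma>' \<in> T" "\<nu> \<in> disc_types k \<sigma>" "\<nu> \<in> disc_types k \<sigma>'"
  shows "\<sigma> = \<sigma>'"
  using assms simplex_verts(3) unfolding disc_types_def by (metis Union_bipartition)

lemma
  assumes "\<sigma> \<in> T" "\<nu> \<in> disc_types k \<sigma>"
  shows disc_subset: "disc \<nu> \<subseteq> \<sigma>" and compact_disc: "compact (disc \<nu>)"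
    and polytope_disc: "polytope (disc \<nu>)"
    and disc_facet_nonempty: "v \<in> verts \<sigma> \<Longrightarrow> disc \<nu> \<inter> opp_facet \<sigma> v \<noteq> {}"
    and aff_dim_disc: "aff_dim (disc \<nu>) = int n - 1"
    and rel_frontier_disc: "disc \<nu> \<inter> rel_frontier \<sigma> = rel_frontier (disc \<nu>)"
proof -
  obtain A B where AB: "\<nu> = {A, B}" "A \<union> B = verts \<sigma>" "A \<inter> B = {}" "2 \<le> card A" "2 \<le> card B"
    "finite A" "finite B"
    using disc_type_cases[OF assms] by metis
  have ne: "A \<noteq> {}" "B \<noteq> {}" using AB by auto
  note d = disc_eq[OF AB(3) ne(1)]
  have fin: "finite {midpoint a b |a b. a \<in> A \<and> b \<in> B}"
    using finite_midpoints AB by blast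
  show "polytope (disc \<nu>)"
    unfolding AB(1) d polytope_def using fin by blast
  then show "compact (disc \<nu>)"
    by (rule polytope_imp_compact)
  have mid: "midpoint a b \<in> convex hull C" if "a \<in> C" "b \<in> C" for a b and C :: "'a set"
    using that midpoint_in_closed_segment convex_contains_segment convex_convex_hull hull_inc
    by (metis subsetD)
  have "disc \<nu> \<subseteq> convex hull (verts \<sigma>)"
    unfolding AB(1) d using AB(2) by (intro hull_minimal convex_convex_hull) (auto intro!: mid)
  then show "disc \<nu> \<subseteq> \<sigma>"
    using simplex_verts(3)[OF assms(1)] by simp
  show "disc \<nu> \<inter> opp_facet \<sigma> v \<noteq> {}" if "v \<in> verts \<sigma>"
  proof -
    \<comment> \<open>Neither block reduces to \<open>v\<close>, so some edge between the blocks
      avoids \<open>v\<close>; its midpoint is the required point.\<close>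
    have "card A \<noteq> 1" "card B \<noteq> 1" using AB by auto
    then have "A \<noteq> {v}" "B \<noteq> {v}" by auto
    with ne obtain a b where ab: "a \<in> A" "a \<noteq> v" "b \<in> B" "b \<noteq> v" by blast
    then have "midpoint a b \<in> opp_facet \<sigma> v"
      unfolding opp_facet_def using AB(2) by (intro mid) auto
    moreover have "midpoint a b \<in> disc \<nu>"
      unfolding AB(1) d using ab by (intro hull_inc) blast
    ultimately show ?thesis by blast
  qed
  have indep: "\<not> affine_dependent (A \<union> B)" and hull: "convex hull (A \<union> B) = \<sigma>"
    using AB(2) simplex_verts[OF assms(1)] by simp_all
  show "aff_dim (disc \<nu>) = int n - 1"
    using disc_rel_frontier_aff_dim(2)[OF indep AB(3) ne] aff_dim_simplex[OF simplex_T[OF assms(1)]]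
    by (simp add: hull AB(1))
  show "disc \<nu> \<inter> rel_frontier \<sigma> = rel_frontier (disc \<nu>)"
    using disc_rel_frontier_aff_dim(1)[OF indep AB(3) ne] by (simp add: hull AB(1))
qed

lemma convex_disc: "convex (disc \<nu>)"
  by (simp add: disc_def)

text \<open>The part of the disc in the facet is spanned by the midpoints lying there, and their
  edges lie there too. The affine pairing sends them to midpoints belonging to the transported
  type.\<close>

lemma pairing_disc:
  assumes "\<sigma> \<in> T" "\<nu> \<in> disc_types k \<sigma>" "v \<in> verts \<sigma>" "\<tau> = opp_facet \<sigma> v" "x \<in> disc \<nu>" "x \<in> \<tau>"
  shows "\<Phi> \<tau> x \<in> disc (act (persp \<tau>) \<nu>)"
proof -
  obtain A B where AB: "\<nu> = {A, B}" "A \<union> B = verts \<sigma>" "A \<inter> B = {}" "2 \<le> card A" "2 \<le> card B"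
    "finite A" "finite B"
    using disc_type_cases[OF assms(1,2)] by metis
  have ne: "A \<noteq> {}" using AB by auto
  let ?M = "{midpoint a b |a b. a \<in> A \<and> b \<in> B}"
  have f: "\<tau> \<in> facets T" "\<tau> face_of \<sigma>"
    using opp_facet(1,2)[OF assms(1,3)] assms(4) facet_of_imp_face_of by auto
  have "convex \<sigma>"
    using convex_simplex[OF simplex_T[OF assms(1)]] .
  moreover have "?M \<subseteq> \<sigma>"
    using disc_subset[OF assms(1,2)] hull_subset[of ?M convex] disc_eq[OF AB(3) ne] AB(1) by simp
  ultimately have "x \<in> convex hull (?M \<inter> \<tau>)"
    using convex_hull_Int_face[of ?M \<sigma> \<tau>] finite_midpoints[OF AB(6,7)] f(2) assms(5,6)
      disc_eq[OF AB(3) ne] AB(1) by auto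
  then have "\<Phi> \<tau> x \<in> \<Phi> \<tau> ` (convex hull (?M \<inter> \<tau>))" by blast
  also have "\<dots> = convex hull (\<Phi> \<tau> ` (?M \<inter> \<tau>))"
    using affine_map_on_convex_hull[OF pairing_affine[OF f(1)]] face_of_imp_convex[OF f(2)] by blast
  also have "\<dots> \<subseteq> disc (act (persp \<tau>) \<nu>)"
    unfolding disc_def
  proof (rule hull_mono, rule subsetI)
    fix y assume "y \<in> \<Phi> \<tau> ` (?M \<inter> \<tau>)"
    then obtain a b where ab: "a \<in> A" "b \<in> B" "midpoint a b \<in> \<tau>" "y = \<Phi> \<tau> (midpoint a b)" by blast
    have v: "a \<in> verts \<sigma>" "b \<in> verts \<sigma>" using ab AB(2) by auto
    then have t: "a \<in> \<tau>" "b \<in> \<tau>"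
      using midpoint_mem_face[OF f(2) _ _ ab(3)] vertex_in_simplex by blast+
    then have "y = midpoint (persp \<tau> a) (persp \<tau> b)"
      using affine_map_on_midpoint[OF pairing_affine[OF f(1)] t ab(3)] ab(4)
      by (simp add: perspectivity_def)
    moreover have "persp \<tau> ` A \<noteq> persp \<tau> ` B"
      using perspectivity(4)[OF assms(1,3,4)] AB(2,3) ne
      by (metis bij_betw_def inj_on_image_eq_iff Un_upper1 Un_upper2 inf.idem)
    ultimately show "y \<in> {midpoint a b |a b A B. A \<in> act (persp \<tau>) \<nu> \<and> B \<in> act (persp \<tau>) \<nu> \<and>
        A \<noteq> B \<and> a \<in> A \<and> b \<in> B}"
      using ab AB(1) by blast
  qed
  finally show ?thesis .
qed

section \<open>Adjacency of disc types and dual paths\<close>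

definition type_adj :: "('a set set \<times> 'a set set) set" where
  "type_adj = {(\<nu>, act (persp \<tau>) \<nu>) |\<nu> \<tau>. \<tau> \<in> facets T \<and> \<nu> \<in> disc_types k (simplex_of T \<tau>)}"

lemma type_adjE:
  assumes "(\<nu>, \<mu>) \<in> type_adj"
  obtains \<sigma> v where "\<sigma> \<in> T" "v \<in> verts \<sigma>" "\<nu> \<in> disc_types k \<sigma>"
    "\<mu> = act (persp (opp_facet \<sigma> v)) \<nu>" "\<mu> \<in> disc_types k (across (opp_facet \<sigma> v))"
    "across (opp_facet \<sigma> v) \<in> T"
proof -
  obtain \<tau> where t: "\<tau> \<in> facets T" "\<nu> \<in> disc_types k (simplex_of T \<tau>)" "\<mu> = act (persp \<tau>) \<nu>"
    using assms by (auto simp: type_adj_def)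
  obtain \<sigma> v where s: "\<sigma> \<in> T" "v \<in> verts \<sigma>" "\<tau> = opp_facet \<sigma> v" "simplex_of T \<tau> = \<sigma>"
    using facet_cases[OF t(1)] by metis
  have "\<mu> \<in> disc_types k (across \<tau>)"
    using act_bipartition[OF perspectivity(4)[OF s(1-3)]] t(2,3) s(4) by (simp add: disc_types_def)
  then show ?thesis
    using that[of \<sigma> v] s t perspectivity(1)[OF s(1-3)] by simp
qed

lemma type_adjI:
  assumes "\<sigma> \<in> T" "v \<in> verts \<sigma>" "\<nu> \<in> disc_types k \<sigma>"
  shows "(\<nu>, act (persp (opp_facet \<sigma> v)) \<nu>) \<in> type_adj"
  unfolding type_adj_def mem_Collect_eq using opp_facet[OF assms(1,2)] assms(3)
  by (intro exI[of _ \<nu>] exI[of _ "opp_facet \<sigma> v"]) simp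

lemma sym_type_adj: "sym type_adj"
proof (rule symI)
  fix \<nu> \<mu> assume "(\<nu>, \<mu>) \<in> type_adj"
  then obtain \<sigma> v where s: "\<sigma> \<in> T" "v \<in> verts \<sigma>" "\<nu> \<in> disc_types k \<sigma>"
    "\<mu> = act (persp (opp_facet \<sigma> v)) \<nu>" "\<mu> \<in> disc_types k (across (opp_facet \<sigma> v))"
    "across (opp_facet \<sigma> v) \<in> T" by (rule type_adjE)
  let ?\<tau> = "opp_facet \<sigma> v"
  note p = perspectivity[OF s(1,2) refl] and q = perspectivity_back[OF s(1,2) refl]
  have "act (persp (\<Phi> ?\<tau> ` ?\<tau>)) \<mu> = \<nu>"
    unfolding s(4) act_act
    by (intro act_ident q(2)) (metis Union_bipartition s(3) disc_types_def)
  then show "(\<mu>, \<nu>) \<in> type_adj"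
    using type_adjI[OF s(6) p(2) s(5)] p(3) by simp
qed

text \<open>The closure is reflexive on arbitrary sets of sets, so later statements restrict to
  \<open>all_disc_types\<close>, which \<open>type_rel_closed\<close> shows to be stable.\<close>

definition type_rel :: "('a set set \<times> 'a set set) set" where
  "type_rel = type_adj\<^sup>*"

lemma type_rel_refl: "(\<nu>, \<nu>) \<in> type_rel"
  by (simp add: type_rel_def)

lemma type_rel_sym: "(\<nu>, \<mu>) \<in> type_rel \<Longrightarrow> (\<mu>, \<nu>) \<in> type_rel"
  unfolding type_rel_def using sym_rtrancl[OF sym_type_adj] by (rule symD)

lemma type_rel_trans: "(\<nu>, \<mu>) \<in> type_rel \<Longrightarrow> (\<mu>, \<kappa>) \<in> type_rel \<Longrightarrow> (\<nu>, \<kappa>) \<in> type_rel"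
  unfolding type_rel_def by (rule rtrancl_trans)

lemma type_rel_image_eq: "(\<nu>, \<mu>) \<in> type_rel \<Longrightarrow> type_rel `` {\<nu>} = type_rel `` {\<mu>}"
  using type_rel_sym type_rel_trans by blast

lemma all_disc_types_iff: "\<nu> \<in> all_disc_types k T \<longleftrightarrow> (\<exists>\<sigma>\<in>T. \<nu> \<in> disc_types k \<sigma>)"
  by (auto simp: all_disc_types_def)

lemma type_rel_closed: "(\<nu>, \<mu>) \<in> type_rel \<Longrightarrow> \<nu> \<in> all_disc_types k T \<Longrightarrow> \<mu> \<in> all_disc_types k T"
  unfolding type_rel_def
  by (induction rule: rtrancl_induct) (auto simp: all_disc_types_iff elim: type_adjE)

lemma path_type_rel:
  "dual_path T \<Phi> \<sigma> \<gamma> \<sigma>' \<Longrightarrow> \<nu> \<in> disc_types k \<sigma> \<Longrightarrow> (\<nu>, act (projectivity T \<Phi> \<gamma>) \<nu>) \<in> type_rel"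
proof (induction \<gamma> arbitrary: \<sigma> \<nu>)
  case Nil
  then show ?case by (simp add: projectivity_def type_rel_refl)
next
  case (Cons \<tau> \<gamma>)
  then obtain v where v: "\<sigma> \<in> T" "v \<in> verts \<sigma>" "\<tau> = opp_facet \<sigma> v"
    using facet_iff by auto
  have adj: "(\<nu>, act (persp \<tau>) \<nu>) \<in> type_adj"
    using type_adjI[OF v(1,2) Cons.prems(2)] v(3) by simp
  have "act (persp \<tau>) \<nu> \<in> disc_types k (across \<tau>)"
    using act_bipartition[OF perspectivity(4)[OF v]] Cons.prems(2) by (simp add: disc_types_def)
  then have "(act (persp \<tau>) \<nu>, act (projectivity T \<Phi> \<gamma>) (act (persp \<tau>) \<nu>)) \<in> type_rel"
    using Cons.IH[of "across \<tau>"] Cons.prems(1) by auto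
  moreover have "act (projectivity T \<Phi> \<gamma>) (act (persp \<tau>) \<nu>) = act (projectivity T \<Phi> (\<tau> # \<gamma>)) \<nu>"
    unfolding act_act by (simp add: projectivity_def)
  ultimately show ?case
    using adj unfolding type_rel_def by (metis converse_rtrancl_into_rtrancl)
qed

lemma path_disc_types:
  "dual_path T \<Phi> \<sigma> \<gamma> \<sigma>' \<Longrightarrow>
    bij_betw (act (projectivity T \<Phi> \<gamma>)) (disc_types k \<sigma>) (disc_types k \<sigma>')"
  unfolding disc_types_def by (intro bij_betw_act projectivity_bij)

text \<open>A type determines its simplex, so successive adjacencies fit end to end into one dual
  path.\<close>

lemma type_rel_path:
  assumes "(\<nu>, \<mu>) \<in> type_rel" "\<sigma> \<in> T" "\<nu> \<in> disc_types k \<sigma>"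
  shows "\<exists>\<gamma> \<sigma>'. dual_path T \<Phi> \<sigma> \<gamma> \<sigma>' \<and> \<mu> = act (projectivity T \<Phi> \<gamma>) \<nu>"
  using assms(1) unfolding type_rel_def
proof (induction rule: rtrancl_induct)
  case base
  have "dual_path T \<Phi> \<sigma> [] \<sigma> \<and> \<nu> = act (projectivity T \<Phi> []) \<nu>"
    using assms by (simp add: projectivity_def)
  then show ?case by blast
next
  case (step \<kappa> \<mu>)
  then obtain \<gamma> \<sigma>' where g: "dual_path T \<Phi> \<sigma> \<gamma> \<sigma>'" "\<kappa> = act (projectivity T \<Phi> \<gamma>) \<nu>" by blast
  obtain \<sigma>1 v where s: "\<sigma>1 \<in> T" "v \<in> verts \<sigma>1" "\<kappa> \<in> disc_types k \<sigma>1"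
    "\<mu> = act (persp (opp_facet \<sigma>1 v)) \<kappa>" "across (opp_facet \<sigma>1 v) \<in> T"
    using type_adjE[OF step.hyps(2)] by metis
  have "\<kappa> \<in> disc_types k \<sigma>'"
    using bij_betw_apply[OF path_disc_types[OF g(1)] assms(3)] g(2) by simp
  then have "\<sigma>1 = \<sigma>'"
    using disc_type_simplex_unique s(1,3) dual_path_end[OF g(1)] by blast
  then have "dual_path T \<Phi> \<sigma> (\<gamma> @ [opp_facet \<sigma>1 v]) (across (opp_facet \<sigma>1 v))"
    using g(1) s opp_facet(2)[OF s(1,2)] by (auto simp: dual_path_append)
  moreover have "\<mu> = act (projectivity T \<Phi> (\<gamma> @ [opp_facet \<sigma>1 v])) \<nu>"
    unfolding s(4) g(2) act_act projectivity_append by (simp add: projectivity_def)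
  ultimately show ?case by blast
qed

section \<open>Connectedness of the dual graph\<close>

lemma quotient_map_proj: "quotient_map (top_of_set (\<Union>T)) (pseudo_manifold T \<Phi>) (proj T \<Phi>)"
proof -
  have "quotient_map (top_of_set (\<Union>T)) (pseudo_manifold T \<Phi>) (\<lambda>x. face_equiv T \<Phi> `` {x})"
    unfolding pseudo_manifold_def using equiv_face_equiv
    by (intro quotient_map_quotient_topology) simp
  moreover have "proj T \<Phi> = (\<lambda>x. face_equiv T \<Phi> `` {x})"
    by (auto simp: proj_def)
  ultimately show ?thesis by simp
qed

lemma closed_Union_simplices: "S \<subseteq> T \<Longrightarrow> closed (\<Union>S)"
  using finite_T simplex_T by (intro closed_Union) (auto intro: finite_subset closed_simplex)

text \<open>The union of the simplices reachable from \<sigma> is saturated under the face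
  equivalence, and it is clopen because the simplices are finitely many disjoint closed sets.
  Connectedness of the quotient then makes every simplex reachable.\<close>

lemma dual_path_exists:
  assumes "\<sigma> \<in> T" "\<sigma>' \<in> T"
  obtains \<gamma> where "dual_path T \<Phi> \<sigma> \<gamma> \<sigma>'"
proof -
  define S where "S = {\<sigma>'. \<exists>\<gamma>. dual_path T \<Phi> \<sigma> \<gamma> \<sigma>'}"
  have ST: "S \<subseteq> T" using dual_path_end by (auto simp: S_def)
  have "dual_path T \<Phi> \<sigma> [] \<sigma>" using assms by simp
  then have sS: "\<sigma> \<in> S" unfolding S_def by blast
  have S_closed: "y \<in> \<Union>S" if "(x, y) \<in> face_equiv T \<Phi>" "x \<in> \<Union>S" for x y
    using that
  proof (rule face_equiv_induct)
    fix \<tau> z assume t: "\<tau> \<in> facets T" "z \<in> \<tau>" "z \<in> \<Union>S"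
    obtain \<sigma>1 v where s: "\<sigma>1 \<in> T" "v \<in> verts \<sigma>1" "\<tau> = opp_facet \<sigma>1 v"
      using facet_cases[OF t(1)] by metis
    have "z \<in> \<sigma>1" using t s opp_facet_subset by blast
    then have "\<sigma>1 \<in> S" using t(3) ST simplex_unique s(1) by blast
    then obtain \<gamma> where "dual_path T \<Phi> \<sigma> \<gamma> \<sigma>1" by (auto simp: S_def)
    then have "dual_path T \<Phi> \<sigma> (\<gamma> @ [\<tau>]) (across \<tau>)"
      using s perspectivity(1)[OF s] opp_facet(2)[OF s(1,2)] by (auto simp: dual_path_append)
    then have "across \<tau> \<in> S" unfolding S_def by blast
    moreover have "\<Phi> \<tau> z \<in> across \<tau>"
      using t(2) perspectivity(3)[OF s] opp_facet_subset[OF perspectivity(1)[OF s]] by blast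
    ultimately show "\<Phi> \<tau> z \<in> \<Union>S" by blast
  qed
  let ?U = "proj T \<Phi> ` \<Union>S"
  have pre: "{x \<in> \<Union>T. proj T \<Phi> x \<in> ?U} = \<Union>S"
  proof (intro equalityI subsetI)
    fix y assume "y \<in> {x \<in> \<Union>T. proj T \<Phi> x \<in> ?U}"
    then obtain x where x: "y \<in> \<Union>T" "x \<in> \<Union>S" "proj T \<Phi> x = proj T \<Phi> y" by auto
    then have "(x, y) \<in> face_equiv T \<Phi>"
      using proj_eq_iff[of x y] ST by blast
    then show "y \<in> \<Union>S" using S_closed x by blast
  qed (use ST in auto)
  have U: "?U \<subseteq> topspace (pseudo_manifold T \<Phi>)"
    using quotient_imp_surjective_map[OF quotient_map_proj] ST by force
  have "closedin (top_of_set (\<Union>T)) (\<Union>S)"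
    using closed_Union_simplices[OF ST] ST by (intro closed_subset) auto
  then have "closedin (pseudo_manifold T \<Phi>) ?U"
    using quotient_map_closedin_iff[OF quotient_map_proj U] pre by simp
  moreover have "openin (top_of_set (\<Union>T)) (\<Union>S)"
  proof -
    have "\<Union>T - \<Union>S = \<Union>(T - S)"
      using simplex_unique ST by blast
    moreover have "closedin (top_of_set (\<Union>T)) (\<Union>(T - S))"
      using closed_Union_simplices[of "T - S"] by (intro closed_subset) auto
    ultimately show ?thesis
      using ST by (simp add: openin_closedin_eq Union_mono)
  qed
  then have "openin (pseudo_manifold T \<Phi>) ?U"
    using quotient_map_openin_iff[OF quotient_map_proj U] pre by simp
  ultimately have "?U = {} \<or> ?U = topspace (pseudo_manifold T \<Phi>)"
    using connected unfolding connected_space_clopen_in by blast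
  moreover have ne: "\<sigma> \<noteq> {}" if "\<sigma> \<in> T" for \<sigma>
    using simplex_verts(2,3)[OF that] by auto
  ultimately have "?U = topspace (pseudo_manifold T \<Phi>)"
    using sS assms(1) by blast
  obtain x where x: "x \<in> \<sigma>'" using ne assms(2) by blast
  then have "proj T \<Phi> x \<in> ?U"
    using \<open>?U = topspace (pseudo_manifold T \<Phi>)\<close> quotient_imp_surjective_map[OF quotient_map_proj] assms(2)
    by (metis UnionI imageI topspace_euclidean_subtopology)
  then have "x \<in> \<Union>S" using pre x assms(2) by blast
  then have "\<sigma>' \<in> S" using ST simplex_unique x assms(2) by blast
  then show ?thesis using that by (auto simp: S_def)
qed

section \<open>Gluing of discs and connected components\<close>

abbreviation gluing :: "(('a set set \<times> 'a) \<times> ('a set set \<times> 'a)) set" where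
  "gluing \<equiv> disc_gluing k T \<Phi>"

abbreviation Q :: "('a set set \<times> 'a) set topology" where
  "Q \<equiv> hypersurface k T \<Phi>"

abbreviation disc_in :: "'a set set \<Rightarrow> ('a set set \<times> 'a) set set" where
  "disc_in \<equiv> disc_in_hypersurface k T \<Phi>"

lemma topspace_disjoint_discs: "topspace (disjoint_discs k T) = Sigma (all_disc_types k T) disc"
  by (simp add: disjoint_discs_def comp_def)

lemma proj_in_topspace: "x \<in> \<Union>T \<Longrightarrow> proj T \<Phi> x \<in> topspace (pseudo_manifold T \<Phi>)"
  using quotient_imp_surjective_map[OF quotient_map_proj] imageI[of x "\<Union>T" "proj T \<Phi>"] by simp

lemma equiv_gluing: "equiv (topspace (disjoint_discs k T)) gluing"
  unfolding disc_gluing_def by (rule equiv_generated_equiv)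

lemma quotient_map_gluing: "quotient_map (disjoint_discs k T) Q (\<lambda>p. gluing `` {p})"
  unfolding hypersurface_def by (rule quotient_map_quotient_topology[OF equiv_gluing])

lemma gluing_class_eq_iff:
  "p \<in> topspace (disjoint_discs k T) \<Longrightarrow> q \<in> topspace (disjoint_discs k T) \<Longrightarrow>
    gluing `` {p} = gluing `` {q} \<longleftrightarrow> (p, q) \<in> gluing"
  using eq_equiv_class_iff[OF equiv_gluing] by blast

lemma gluing_step:
  assumes "\<sigma> \<in> T" "v \<in> verts \<sigma>" "\<tau> = opp_facet \<sigma> v" "\<nu> \<in> disc_types k \<sigma>" "x \<in> disc \<nu>" "x \<in> \<tau>"
  shows "((\<nu>, x), (act (persp \<tau>) \<nu>, \<Phi> \<tau> x)) \<in> gluing"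
    "\<Phi> \<tau> x \<in> disc (act (persp \<tau>) \<nu>)"
proof -
  show d: "\<Phi> \<tau> x \<in> disc (act (persp \<tau>) \<nu>)"
    using pairing_disc assms by blast
  have "act (persp \<tau>) \<nu> \<in> disc_types k (across \<tau>)"
    using act_bipartition[OF perspectivity(4)[OF assms(1-3)]] assms(4) by (simp add: disc_types_def)
  then have "act (persp \<tau>) \<nu> \<in> all_disc_types k T" "\<nu> \<in> all_disc_types k T"
    using perspectivity(1)[OF assms(1-3)] assms(1,4) all_disc_types_iff by blast+
  then have "(\<nu>, x) \<in> topspace (disjoint_discs k T)"
    "(act (persp \<tau>) \<nu>, \<Phi> \<tau> x) \<in> topspace (disjoint_discs k T)"
    using d assms(5) by (auto simp: topspace_disjoint_discs)
  moreover have "\<tau> \<in> facets T" "simplex_of T \<tau> = \<sigma>"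
    using opp_facet[OF assms(1,2)] assms(3) by auto
  ultimately show "((\<nu>, x), (act (persp \<tau>) \<nu>, \<Phi> \<tau> x)) \<in> gluing"
    unfolding disc_gluing_def using assms(4-6) by (intro generated_equivI) auto
qed

lemma gluing_invariant:
  assumes "(p, q) \<in> gluing"
    and "\<And>\<nu> x \<tau>. \<tau> \<in> facets T \<Longrightarrow> \<nu> \<in> disc_types k (simplex_of T \<tau>) \<Longrightarrow> x \<in> \<tau> \<Longrightarrow>
      f (\<nu>, x) = f (act (persp \<tau>) \<nu>, \<Phi> \<tau> x)"
  shows "f p = f q"
  using assms(1) unfolding disc_gluing_def
  by (rule generated_equiv_invariant) (use assms(2) in blast)

lemma gluing_type_rel: "((\<nu>, x), (\<mu>, y)) \<in> gluing \<Longrightarrow> (\<nu>, \<mu>) \<in> type_rel"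
proof -
  assume "((\<nu>, x), (\<mu>, y)) \<in> gluing"
  then have "type_rel `` {fst (\<nu>, x)} = type_rel `` {fst (\<mu>, y)}"
  proof (rule gluing_invariant[where f = "\<lambda>p. type_rel `` {fst p}"])
    fix \<nu> x \<tau> assume "\<tau> \<in> facets T" "\<nu> \<in> disc_types k (simplex_of T \<tau>)"
    then have "(\<nu>, act (persp \<tau>) \<nu>) \<in> type_adj" by (auto simp: type_adj_def)
    then have "(\<nu>, act (persp \<tau>) \<nu>) \<in> type_rel" by (simp add: type_rel_def)
    then show "type_rel `` {fst (\<nu>, x)} = type_rel `` {fst (act (persp \<tau>) \<nu>, \<Phi> \<tau> x)}"
      using type_rel_image_eq by simp
  qed
  then show "(\<nu>, \<mu>) \<in> type_rel"
    using type_rel_refl[of \<mu>] by auto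
qed

text \<open>Makes the natural map from the hypersurface to the pseudo-manifold well defined.\<close>

lemma gluing_proj: "((\<nu>, x), (\<mu>, y)) \<in> gluing \<Longrightarrow> proj T \<Phi> x = proj T \<Phi> y"
  using gluing_invariant[of "(\<nu>, x)" "(\<mu>, y)" "\<lambda>p. proj T \<Phi> (snd p)"] proj_pairing by simp

lemma disc_nonempty: "\<nu> \<in> all_disc_types k T \<Longrightarrow> disc \<nu> \<noteq> {}"
proof -
  assume "\<nu> \<in> all_disc_types k T"
  then obtain \<sigma> where s: "\<sigma> \<in> T" "\<nu> \<in> disc_types k \<sigma>" by (auto simp: all_disc_types_iff)
  obtain v where "v \<in> verts \<sigma>" using simplex_verts(2,4)[OF s(1)] by fastforce
  then show ?thesis using disc_facet_nonempty[OF s] by blast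
qed

lemma continuous_map_class:
  assumes "\<nu> \<in> all_disc_types k T"
  shows "continuous_map (top_of_set (disc \<nu>)) Q (\<lambda>x. gluing `` {(\<nu>, x)})"
proof -
  have "continuous_map (top_of_set (disc \<nu>)) (disjoint_discs k T) (\<lambda>x. (\<nu>, x))"
    unfolding disjoint_discs_def
    using continuous_map_component_injection[OF assms, of "\<lambda>\<nu>. top_of_set (disc \<nu>)"] .
  then show ?thesis
    using continuous_map_compose[OF _ quotient_imp_continuous_map[OF quotient_map_gluing]]
    by (fastforce simp: comp_def)
qed

lemma connectedin_disc_in: "\<nu> \<in> all_disc_types k T \<Longrightarrow> connectedin Q (disc_in \<nu>)"
  unfolding disc_in_hypersurface_def
  by (rule connectedin_continuous_map_image[OF continuous_map_class])
    (auto simp: connectedin_subtopology convex_connected convex_disc)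

text \<open>A candidate for a connected component, assembled from whole discs so that openness and
  closedness can be tested disc by disc.\<close>

definition type_component :: "'a set set \<Rightarrow> ('a set set \<times> 'a) set set" where
  "type_component \<nu> = (\<Union>\<mu>\<in>type_rel `` {\<nu>}. disc_in \<mu>)"

lemma type_component_eq: "(\<nu>, \<mu>) \<in> type_rel \<Longrightarrow> type_component \<nu> = type_component \<mu>"
  unfolding type_component_def using type_rel_image_eq by metis

lemma class_in_type_component_iff:
  assumes "\<nu> \<in> all_disc_types k T" "\<mu> \<in> all_disc_types k T" "y \<in> disc \<mu>"
  shows "gluing `` {(\<mu>, y)} \<in> type_component \<nu> \<longleftrightarrow> (\<nu>, \<mu>) \<in> type_rel"
proof
  assume "gluing `` {(\<mu>, y)} \<in> type_component \<nu>"
  then obtain \<kappa> x where x: "(\<nu>, \<kappa>) \<in> type_rel" "x \<in> disc \<kappa>" "gluing `` {(\<kappa>, x)} = gluing `` {(\<mu>, y)}"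
    unfolding type_component_def disc_in_hypersurface_def by force
  have "((\<kappa>, x), (\<mu>, y)) \<in> gluing"
    using x gluing_class_eq_iff[of "(\<kappa>, x)" "(\<mu>, y)"] type_rel_closed assms
    by (auto simp: topspace_disjoint_discs)
  then show "(\<nu>, \<mu>) \<in> type_rel"
    using gluing_type_rel x(1) type_rel_trans by blast
qed (use assms(3) in \<open>auto simp: type_component_def disc_in_hypersurface_def\<close>)

lemma disc_in_subset_type_component_iff:
  assumes "\<nu> \<in> all_disc_types k T" "\<mu> \<in> all_disc_types k T"
  shows "disc_in \<mu> \<subseteq> type_component \<nu> \<longleftrightarrow> (\<nu>, \<mu>) \<in> type_rel"
proof
  obtain y where y: "y \<in> disc \<mu>" using disc_nonempty[OF assms(2)] by blast
  assume "disc_in \<mu> \<subseteq> type_component \<nu>"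
  then have "gluing `` {(\<mu>, y)} \<in> type_component \<nu>"
    using y unfolding disc_in_hypersurface_def by blast
  then show "(\<nu>, \<mu>) \<in> type_rel"
    using class_in_type_component_iff[OF assms y] by simp
qed (auto simp: type_component_def)

lemma type_component_subset_topspace: "\<nu> \<in> all_disc_types k T \<Longrightarrow> type_component \<nu> \<subseteq> topspace Q"
  unfolding type_component_def
  using type_rel_closed connectedin_subset_topspace[OF connectedin_disc_in] by (intro UN_least) blast

lemma type_component_preimage:
  assumes "\<nu> \<in> all_disc_types k T"
  shows "{p \<in> topspace (disjoint_discs k T). gluing `` {p} \<in> type_component \<nu>}
     = Sigma (all_disc_types k T) (\<lambda>\<mu>. if (\<nu>, \<mu>) \<in> type_rel then disc \<mu> else {})"
  using class_in_type_component_iff[OF assms] by (auto simp: topspace_disjoint_discs split: if_splits)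

text \<open>In each summand of the disjoint union the preimage is either the whole disc or
  empty.\<close>

lemma clopen_type_component:
  assumes "\<nu> \<in> all_disc_types k T"
  shows "openin Q (type_component \<nu>)" "closedin Q (type_component \<nu>)"
proof -
  let ?S = "Sigma (all_disc_types k T) (\<lambda>\<mu>. if (\<nu>, \<mu>) \<in> type_rel then disc \<mu> else {})"
  have "openin (disjoint_discs k T) ?S"
    unfolding disjoint_discs_def openin_disjoint_union by auto
  then show "openin Q (type_component \<nu>)"
    using quotient_map_openin_iff[OF quotient_map_gluing type_component_subset_topspace[OF assms] type_component_preimage[OF assms]]
    by simp
  have "closedin (disjoint_discs k T) ?S"
    unfolding disjoint_discs_def closedin_disjoint_union by auto
  then show "closedin Q (type_component \<nu>)"
    using quotient_map_closedin_iff[OF quotient_map_gluing type_component_subset_topspace[OF assms] type_component_preimage[OF assms]]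
    by simp
qed

text \<open>Here the block sizes matter: a disc cutting off a single vertex would miss the opposite
  facet. A point of the disc in the facet is glued to its image under the pairing.\<close>

lemma disc_in_adj_meet:
  assumes "(\<nu>, \<mu>) \<in> type_adj"
  shows "disc_in \<nu> \<inter> disc_in \<mu> \<noteq> {}"
proof -
  obtain \<sigma> v where s: "\<sigma> \<in> T" "v \<in> verts \<sigma>" "\<nu> \<in> disc_types k \<sigma>"
    "\<mu> = act (persp (opp_facet \<sigma> v)) \<nu>" using type_adjE[OF assms] by metis
  obtain x where x: "x \<in> disc \<nu>" "x \<in> opp_facet \<sigma> v"
    using disc_facet_nonempty[OF s(1,3,2)] by blast
  note g = gluing_step[OF s(1,2) refl s(3) x]
  have "gluing `` {(\<nu>, x)} = gluing `` {(\<mu>, \<Phi> (opp_facet \<sigma> v) x)}"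
    using equiv_class_eq[OF equiv_gluing g(1)] s(4) by simp
  then show ?thesis
    using x(1) g(2) s(4) by (auto simp: disc_in_hypersurface_def)
qed

text \<open>A connected set meeting a clopen set stays inside it. Conversely, discs are connected
  and adjacent ones overlap, so the component spreads along \<open>type_rel\<close>.\<close>

lemma connected_component_eq_type_component:
  assumes "\<nu> \<in> all_disc_types k T" "q \<in> type_component \<nu>"
  shows "connected_component_of_set Q q = type_component \<nu>"
proof
  have q: "q \<in> topspace Q"
    using assms type_component_subset_topspace by blast
  then have "q \<in> connected_component_of_set Q q"
    by (simp add: connected_component_of_refl)
  then have "\<not> disjnt (connected_component_of_set Q q) (type_component \<nu>)"
    using assms(2) by (auto simp: disjnt_def)
  then show "connected_component_of_set Q q \<subseteq> type_component \<nu>"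
    using connectedin_clopen_cases[OF connectedin_connected_component_of[of Q q]
        clopen_type_component(2)[OF assms(1)] clopen_type_component(1)[OF assms(1)]] by blast
  obtain \<mu> where m: "(\<nu>, \<mu>) \<in> type_rel" "q \<in> disc_in \<mu>"
    using assms(2) by (auto simp: type_component_def)
  have mu: "\<mu> \<in> all_disc_types k T" using type_rel_closed m assms by blast
  have "disc_in \<kappa> \<subseteq> connected_component_of_set Q q" if "(\<mu>, \<kappa>) \<in> type_rel" for \<kappa>
    using that unfolding type_rel_def
  proof (induction rule: rtrancl_induct)
    case base
    then show ?case
      using connected_component_of_maximal[OF connectedin_disc_in[OF mu] m(2)] .
  next
    case (step \<kappa> \<kappa>')
    then have k: "\<kappa> \<in> all_disc_types k T" "\<kappa>' \<in> all_disc_types k T"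
      using type_rel_closed mu unfolding type_rel_def by (meson rtrancl.rtrancl_into_rtrancl)+
    obtain r where r: "r \<in> disc_in \<kappa>" "r \<in> disc_in \<kappa>'"
      using disc_in_adj_meet[OF step.hyps(2)] by blast
    then have "connected_component_of_set Q r = connected_component_of_set Q q"
      using step.IH by (auto simp: connected_component_of_equiv)
    then show ?case
      using connected_component_of_maximal[OF connectedin_disc_in[OF k(2)] r(2)] by simp
  qed
  then show "type_component \<nu> \<subseteq> connected_component_of_set Q q"
    using type_component_eq[OF m(1)] unfolding type_component_def by auto
qed

lemma type_component_nonempty: "\<nu> \<in> all_disc_types k T \<Longrightarrow> type_component \<nu> \<noteq> {}"
  using disc_nonempty type_rel_refl by (fastforce simp: type_component_def disc_in_hypersurface_def)

lemma connected_components: "connected_components_of Q = type_component ` all_disc_types k T"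
proof (intro equalityI subsetI)
  fix C assume "C \<in> connected_components_of Q"
  then obtain q where q: "q \<in> topspace Q" "C = connected_component_of_set Q q"
    by (auto simp: connected_components_of_def)
  then have "q \<in> (\<lambda>p. gluing `` {p}) ` Sigma (all_disc_types k T) disc"
    using quotient_imp_surjective_map[OF quotient_map_gluing] by (simp add: topspace_disjoint_discs)
  then obtain \<nu> x where x: "\<nu> \<in> all_disc_types k T" "x \<in> disc \<nu>" "q = gluing `` {(\<nu>, x)}"
    by auto
  then have "q \<in> type_component \<nu>"
    using class_in_type_component_iff type_rel_refl by blast
  then show "C \<in> type_component ` all_disc_types k T"
    using connected_component_eq_type_component q(2) x(1) by blast
next
  fix C assume "C \<in> type_component ` all_disc_types k T"
  then obtain \<nu> where n: "\<nu> \<in> all_disc_types k T" "C = type_component \<nu>" by blast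
  obtain q where q: "q \<in> type_component \<nu>" using type_component_nonempty[OF n(1)] by blast
  then have "q \<in> topspace Q" using type_component_subset_topspace[OF n(1)] by blast
  then show "C \<in> connected_components_of Q"
    using connected_component_eq_type_component[OF n(1) q] n(2) by (auto simp: connected_components_of_def)
qed

lemma component_types_type_component:
  assumes "\<sigma> \<in> T" "\<nu> \<in> all_disc_types k T"
  shows "component_types k T \<Phi> \<sigma> (type_component \<nu>) = {\<mu> \<in> disc_types k \<sigma>. (\<nu>, \<mu>) \<in> type_rel}"
  unfolding component_types_def using disc_in_subset_type_component_iff[OF assms(2)] assms(1) all_disc_types_iff by blast

lemma type_component_eq_iff:
  assumes "\<nu> \<in> all_disc_types k T" "\<mu> \<in> all_disc_types k T"
  shows "type_component \<nu> = type_component \<mu> \<longleftrightarrow> (\<nu>, \<mu>) \<in> type_rel"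
  using disc_in_subset_type_component_iff[OF assms] disc_in_subset_type_component_iff[OF assms(2,2)] type_rel_refl type_component_eq
  by blast

text \<open>Transport along a dual path to \<sigma> stays within a component. Counting components
  thus becomes counting classes of types of one simplex.\<close>

lemma components_meet_base:
  assumes "\<sigma> \<in> T"
  shows "connected_components_of Q = type_component ` disc_types k \<sigma>"
proof -
  have "type_component \<nu> \<in> type_component ` disc_types k \<sigma>" if \<nu>: "\<nu> \<in> all_disc_types k T" for \<nu>
  proof -
    obtain \<sigma>' where s: "\<sigma>' \<in> T" "\<nu> \<in> disc_types k \<sigma>'"
      using \<nu> all_disc_types_iff by blast
    obtain \<gamma> where g: "dual_path T \<Phi> \<sigma>' \<gamma> \<sigma>" using dual_path_exists[OF s(1) assms] .
    have "act (projectivity T \<Phi> \<gamma>) \<nu> \<in> disc_types k \<sigma>"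
      using bij_betw_apply[OF path_disc_types[OF g] s(2)] .
    then show ?thesis using type_component_eq[OF path_type_rel[OF g s(2)]] by blast
  qed
  then show ?thesis
    unfolding connected_components using assms all_disc_types_iff by blast
qed

lemma type_rel_loop:
  assumes "\<sigma> \<in> T" "\<nu> \<in> disc_types k \<sigma>" "\<mu> \<in> disc_types k \<sigma>" "(\<nu>, \<mu>) \<in> type_rel"
  obtains \<gamma> where "\<gamma> \<in> dual_loops T \<Phi> \<sigma>" "\<mu> = act (projectivity T \<Phi> \<gamma>) \<nu>"
proof -
  obtain \<gamma> \<sigma>' where g: "dual_path T \<Phi> \<sigma> \<gamma> \<sigma>'" "\<mu> = act (projectivity T \<Phi> \<gamma>) \<nu>"
    using type_rel_path assms by blast
  then have "\<mu> \<in> disc_types k \<sigma>'"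
    using bij_betw_apply[OF path_disc_types[OF g(1)] assms(2)] by simp
  then have "\<sigma>' = \<sigma>"
    using disc_type_simplex_unique assms dual_path_end[OF g(1)] by blast
  then show ?thesis using that[of \<gamma>] g by (simp add: dual_loops_def)
qed

text \<open>Transport to the base simplex is a bijection of types that preserves components, so
  injectivity there spreads to every simplex.\<close>

lemma type_rel_trivial_transport:
  assumes "inj_on type_component (disc_types k \<sigma>\<^sub>0)" "\<sigma>\<^sub>0 \<in> T"
    and "\<sigma> \<in> T" "\<nu> \<in> disc_types k \<sigma>" "\<mu> \<in> disc_types k \<sigma>" "(\<nu>, \<mu>) \<in> type_rel"
  shows "\<nu> = \<mu>"
proof -
  obtain \<gamma> where g: "dual_path T \<Phi> \<sigma> \<gamma> \<sigma>\<^sub>0" using dual_path_exists[OF assms(3,2)] .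
  note b = path_disc_types[OF g]
  have "type_component (act (projectivity T \<Phi> \<gamma>) \<nu>) = type_component (act (projectivity T \<Phi> \<gamma>) \<mu>)"
    using type_component_eq[OF path_type_rel[OF g assms(4)]] type_component_eq[OF path_type_rel[OF g assms(5)]]
      type_component_eq[OF assms(6)] by simp
  then have "act (projectivity T \<Phi> \<gamma>) \<nu> = act (projectivity T \<Phi> \<gamma>) \<mu>"
    using inj_onD[OF assms(1)] bij_betw_apply[OF b] assms(4,5) by blast
  then show ?thesis
    using bij_betw_imp_inj_on[OF b] assms(4,5) by (meson inj_onD)
qed

section \<open>Embedding the components\<close>

text \<open>The identity serves as PL parametrisation and the constant family as isotopy. The
  substance lies in the dimension of the disc and in its meeting the boundary of the simplex exactly
  in its own.\<close>

lemma normal_disc_disc: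
  assumes "\<sigma> \<in> T" "\<nu> \<in> disc_types k \<sigma>"
  shows "normal_disc n \<sigma> \<nu> (disc \<nu>)"
  unfolding normal_disc_def
proof
  have "affine_map_on (disc \<nu>) (\<lambda>x. x)"
    unfolding affine_map_on_def by (rule exI[of _ "\<lambda>x. x"], rule exI[of _ 0]) (simp add: linear_id[unfolded id_def])
  then have "pl_homeomorphism (disc \<nu>) (disc \<nu>) (\<lambda>x. x)"
    unfolding pl_homeomorphism_def using polytope_disc[OF assms]
    by (intro conjI exI[of _ "{disc \<nu>}"]) (auto simp: bij_betw_def)
  then show "proper_pl_cell (int n - 1) \<sigma> (disc \<nu>)"
    unfolding proper_pl_cell_def
    using disc_subset[OF assms] polytope_disc[OF assms] aff_dim_disc[OF assms] rel_frontier_disc[OF assms]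
    by (intro conjI exI[of _ "disc \<nu>"] exI[of _ "\<lambda>x. x"]) auto
  have "continuous_on ({0..1::real} \<times> \<sigma>) (\<lambda>(t, x). x)"
    unfolding case_prod_beta by (intro continuous_intros)
  then show "normal_isotopic \<sigma> (disc \<nu>) (disc \<nu>)"
    unfolding normal_isotopic_def by (intro exI[of _ "\<lambda>t x. x"]) auto
qed

lemma embedded_component:
  assumes uniq: "\<And>\<sigma> \<nu> \<mu>. \<sigma> \<in> T \<Longrightarrow> \<nu> \<in> disc_types k \<sigma> \<Longrightarrow> \<mu> \<in> disc_types k \<sigma> \<Longrightarrow>
      (\<nu>, \<mu>) \<in> type_rel \<Longrightarrow> \<nu> = \<mu>"
    and \<kappa>: "\<kappa> \<in> all_disc_types k T"
  shows "embedded_normal_hypersurface n k T \<Phi> (type_component \<kappa>)"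
proof -
  \<comment> \<open>The value is read off an arbitrary representative; \<open>gluing_proj\<close>
    removes the dependence on the choice.\<close>
  define f where "f q = proj T \<Phi> (snd (SOME z. z \<in> q))" for q :: "('a set set \<times> 'a) set"
  have f_class: "f (gluing `` {(\<nu>, x)}) = proj T \<Phi> x" if "\<nu> \<in> all_disc_types k T" "x \<in> disc \<nu>" for \<nu> x
  proof -
    have "(\<nu>, x) \<in> gluing `` {(\<nu>, x)}"
      using equiv_class_self[OF equiv_gluing] that topspace_disjoint_discs by auto
    then have "(SOME z. z \<in> gluing `` {(\<nu>, x)}) \<in> gluing `` {(\<nu>, x)}"
      by (rule someI)
    then show ?thesis
      unfolding f_def using gluing_proj[of \<nu> x] by (metis Image_singleton_iff prod.collapse)
  qed
  text \<open>A face pairing carries a point of the component to a point of the component, along the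
    unique disc of the component in the neighbouring simplex.\<close>
  have chain: "\<exists>\<mu>. (\<kappa>, \<mu>) \<in> type_rel \<and> y \<in> disc \<mu> \<and> ((\<nu>, x), (\<mu>, y)) \<in> gluing"
    if xy: "(x, y) \<in> face_equiv T \<Phi>" and x: "(\<kappa>, \<nu>) \<in> type_rel" "x \<in> disc \<nu>" for x y \<nu>
    using xy
  proof (rule face_equiv_induct)
    have "(\<nu>, x) \<in> topspace (disjoint_discs k T)"
      using x type_rel_closed \<kappa> by (auto simp: topspace_disjoint_discs)
    then show "\<exists>\<mu>. (\<kappa>, \<mu>) \<in> type_rel \<and> x \<in> disc \<mu> \<and> ((\<nu>, x), (\<mu>, x)) \<in> gluing"
      using x equiv_class_self[OF equiv_gluing] by blast
  next
    fix \<tau> z assume t: "\<tau> \<in> facets T" "z \<in> \<tau>"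
      and "\<exists>\<mu>. (\<kappa>, \<mu>) \<in> type_rel \<and> z \<in> disc \<mu> \<and> ((\<nu>, x), (\<mu>, z)) \<in> gluing"
    then obtain \<mu> where m: "(\<kappa>, \<mu>) \<in> type_rel" "z \<in> disc \<mu>" "((\<nu>, x), (\<mu>, z)) \<in> gluing" by blast
    obtain \<sigma> v where s: "\<sigma> \<in> T" "v \<in> verts \<sigma>" "\<tau> = opp_facet \<sigma> v"
      using facet_cases[OF t(1)] by metis
    obtain \<sigma>' where s': "\<sigma>' \<in> T" "\<mu> \<in> disc_types k \<sigma>'"
      using type_rel_closed[OF m(1) \<kappa>] all_disc_types_iff by blast
    have "z \<in> \<sigma>" "z \<in> \<sigma>'"
      using t(2) s opp_facet_subset disc_subset[OF s'] m(2) by blast+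
    then have "\<mu> \<in> disc_types k \<sigma>" using simplex_unique s s' by blast
    note g = gluing_step[OF s this m(2) t(2)]
    have "((\<nu>, x), (act (persp \<tau>) \<mu>, \<Phi> \<tau> z)) \<in> gluing"
      using g(1) m(3) equivE[OF equiv_gluing] by (metis transD)
    moreover have "(\<kappa>, act (persp \<tau>) \<mu>) \<in> type_rel"
      using gluing_type_rel[OF g(1)] m(1) type_rel_trans by blast
    ultimately show "\<exists>\<mu>. (\<kappa>, \<mu>) \<in> type_rel \<and> \<Phi> \<tau> z \<in> disc \<mu> \<and> ((\<nu>, x), (\<mu>, \<Phi> \<tau> z)) \<in> gluing"
      using g(2) by blast
  qed
  have disc_T: "\<nu> \<in> all_disc_types k T \<Longrightarrow> disc \<nu> \<subseteq> \<Union>T" for \<nu>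
    using disc_subset all_disc_types_iff by blast
  \<comment> \<open>The chain starting at \<open>x\<close> ends at \<open>y\<close> in a disc of the
    same component and in the simplex of \<open>\<mu>\<close>; uniqueness identifies that disc with
    the one of type \<open>\<mu>\<close>.\<close>
  have glue: "((\<nu>, x), (\<mu>, y)) \<in> gluing"
    if g: "(\<kappa>, \<nu>) \<in> type_rel" "x \<in> disc \<nu>" "(\<kappa>, \<mu>) \<in> type_rel" "y \<in> disc \<mu>" "proj T \<Phi> x = proj T \<Phi> y"
    for x y \<nu> \<mu>
  proof -
    have all: "\<nu> \<in> all_disc_types k T" "\<mu> \<in> all_disc_types k T"
      using g type_rel_closed \<kappa> by blast+
    then have "(x, y) \<in> face_equiv T \<Phi>"
      using proj_eq_iff[of x y] g disc_T by blast
    then obtain \<mu>' where m: "(\<kappa>, \<mu>') \<in> type_rel" "y \<in> disc \<mu>'" "((\<nu>, x), (\<mu>', y)) \<in> gluing"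
      using chain[of x y \<nu>] g by blast
    have "\<mu>' \<in> all_disc_types k T" using m type_rel_closed \<kappa> by blast
    then obtain \<sigma> \<sigma>' where s: "\<sigma> \<in> T" "\<mu> \<in> disc_types k \<sigma>" "\<sigma>' \<in> T" "\<mu>' \<in> disc_types k \<sigma>'"
      using all all_disc_types_iff by blast
    have "y \<in> \<sigma>" "y \<in> \<sigma>'"
      using disc_subset[OF s(1,2)] disc_subset[OF s(3,4)] g(4) m(2) by blast+
    then have "\<sigma> = \<sigma>'"
      using simplex_unique s by blast
    moreover have "(\<mu>, \<mu>') \<in> type_rel"
      using g(3) m(1) type_rel_sym type_rel_trans by blast
    ultimately have "\<mu> = \<mu>'" using uniq s by blast
    then show ?thesis using m by simp
  qed
  have comp_cases: "\<exists>\<nu> x. (\<kappa>, \<nu>) \<in> type_rel \<and> \<nu> \<in> all_disc_types k T \<and> x \<in> disc \<nu> \<and> q = gluing `` {(\<nu>, x)}"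
    if "q \<in> type_component \<kappa>" for q
    using that type_rel_closed \<kappa> by (auto simp: type_component_def disc_in_hypersurface_def)
  \<comment> \<open>Continuity is tested on the disjoint discs, where \<open>f\<close> becomes the
    projection of the underlying point.\<close>
  have cont: "continuous_map Q (pseudo_manifold T \<Phi>) f"
  proof -
    have "continuous_map (disjoint_discs k T) (pseudo_manifold T \<Phi>) (\<lambda>p. proj T \<Phi> (snd p))"
    proof -
      have "openin (top_of_set (disc \<nu>)) {x \<in> disc \<nu>. proj T \<Phi> x \<in> U}"
        if "openin (pseudo_manifold T \<Phi>) U" "\<nu> \<in> all_disc_types k T" for \<nu> U
      proof -
        have "continuous_map (top_of_set (disc \<nu>)) (pseudo_manifold T \<Phi>) (proj T \<Phi>)"
          using continuous_map_from_subtopology_mono[OF quotient_imp_continuous_map[OF quotient_map_proj]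
              disc_T[OF that(2)]] .
        then show ?thesis
          using that(1) by (auto simp: continuous_map_def)
      qed
      moreover have "proj T \<Phi> x \<in> topspace (pseudo_manifold T \<Phi>)"
        if "\<nu> \<in> all_disc_types k T" "x \<in> disc \<nu>" for \<nu> x
        using proj_in_topspace disc_T that by blast
      ultimately show ?thesis
        unfolding continuous_map_def topspace_disjoint_discs
        by (auto simp: disjoint_discs_def openin_sum_topology)
    qed
    then have "continuous_map (disjoint_discs k T) (pseudo_manifold T \<Phi>) (f \<circ> (\<lambda>p. gluing `` {p}))"
      by (rule continuous_map_eq) (auto simp: topspace_disjoint_discs f_class)
    then show ?thesis
      using continuous_compose_quotient_map_eq[OF quotient_map_gluing] by blast
  qed
  have inj: "inj_on f (type_component \<kappa>)"
  proof (rule inj_onI)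
    fix p q assume "p \<in> type_component \<kappa>" "q \<in> type_component \<kappa>" and eq: "f p = f q"
    then obtain \<nu> x \<mu> y where p: "(\<kappa>, \<nu>) \<in> type_rel" "\<nu> \<in> all_disc_types k T" "x \<in> disc \<nu>" "p = gluing `` {(\<nu>, x)}"
      and q: "(\<kappa>, \<mu>) \<in> type_rel" "\<mu> \<in> all_disc_types k T" "y \<in> disc \<mu>" "q = gluing `` {(\<mu>, y)}"
      using comp_cases by metis
    have "((\<nu>, x), (\<mu>, y)) \<in> gluing"
      using glue p q eq f_class by metis
    then show "p = q"
      using equiv_class_eq[OF equiv_gluing] p q by blast
  qed
  have top: "topspace (subtopology Q (type_component \<kappa>)) = type_component \<kappa>"
    using type_component_subset_topspace[OF \<kappa>] by auto
  have closed: "closed_map (subtopology Q (type_component \<kappa>)) (pseudo_manifold T \<Phi>) f"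
    unfolding closed_map_def
  proof (intro allI impI)
    fix C assume "closedin (subtopology Q (type_component \<kappa>)) C"
    then have C: "closedin Q C" "C \<subseteq> type_component \<kappa>"
      using clopen_type_component(2)[OF \<kappa>] by (auto simp: closedin_closed_subtopology)
    define K where "K \<nu> = {x \<in> disc \<nu>. gluing `` {(\<nu>, x)} \<in> C}" for \<nu>
    have K_closed: "closed (K \<nu>)" if "\<nu> \<in> all_disc_types k T" for \<nu>
    proof -
      have "closedin (top_of_set (disc \<nu>)) (K \<nu>)"
        using closedin_continuous_map_preimage[OF continuous_map_class[OF that] C(1)]
        by (simp add: K_def)
      moreover have "closed (disc \<nu>)"
        using that compact_disc all_disc_types_iff compact_imp_closed by blast
      ultimately show ?thesis
        using closedin_closed_trans by blast
    qed
    \<comment> \<open>By \<open>chain\<close>, a point identified with one of the image lies in a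
      disc of the component and represents the same point of \<open>C\<close>. The preimage in the
      simplices is therefore a finite union of closed pieces of discs.\<close>
    have pre: "{y \<in> \<Union>T. proj T \<Phi> y \<in> f ` C} = (\<Union>\<nu>\<in>type_rel `` {\<kappa>}. K \<nu>)"
    proof (intro equalityI subsetI)
      fix y assume "y \<in> {y \<in> \<Union>T. proj T \<Phi> y \<in> f ` C}"
      then obtain q where y: "y \<in> \<Union>T" "q \<in> C" "proj T \<Phi> y = f q" by auto
      then obtain \<nu> x where x: "(\<kappa>, \<nu>) \<in> type_rel" "\<nu> \<in> all_disc_types k T" "x \<in> disc \<nu>" "q = gluing `` {(\<nu>, x)}"
        using comp_cases C(2) by blast
      then have "proj T \<Phi> x = proj T \<Phi> y" using f_class y(3) by simp
      then have "(x, y) \<in> face_equiv T \<Phi>"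
        using proj_eq_iff[of x y] x(3) disc_T[OF x(2)] y(1) by blast
      then obtain \<mu> where m: "(\<kappa>, \<mu>) \<in> type_rel" "y \<in> disc \<mu>" "((\<nu>, x), (\<mu>, y)) \<in> gluing"
        using chain x by blast
      then have "gluing `` {(\<mu>, y)} = q"
        using equiv_class_eq[OF equiv_gluing m(3)] x(4) by simp
      then show "y \<in> (\<Union>\<nu>\<in>type_rel `` {\<kappa>}. K \<nu>)"
        using m y(2) by (auto simp: K_def)
    next
      fix y assume "y \<in> (\<Union>\<nu>\<in>type_rel `` {\<kappa>}. K \<nu>)"
      then obtain \<nu> where n: "(\<kappa>, \<nu>) \<in> type_rel" "y \<in> disc \<nu>" "gluing `` {(\<nu>, y)} \<in> C"
        by (auto simp: K_def)
      have all: "\<nu> \<in> all_disc_types k T" using n type_rel_closed \<kappa> by blast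
      have "proj T \<Phi> y \<in> f ` C"
        using f_class[OF all n(2)] n(3) by (metis image_eqI)
      then show "y \<in> {y \<in> \<Union>T. proj T \<Phi> y \<in> f ` C}"
        using disc_T[OF all] n(2) by blast
    qed
    have sub: "type_rel `` {\<kappa>} \<subseteq> all_disc_types k T"
      using type_rel_closed \<kappa> by blast
    moreover have "finite (all_disc_types k T)"
      unfolding all_disc_types_def disc_types_def
      using finite_T simplex_verts(4) finite_bipartitions by blast
    ultimately have "closed (\<Union>\<nu>\<in>type_rel `` {\<kappa>}. K \<nu>)"
      using K_closed by (intro closed_UN) (auto intro: finite_subset)
    moreover have "(\<Union>\<nu>\<in>type_rel `` {\<kappa>}. K \<nu>) \<subseteq> \<Union>T"
      using pre by blast
    ultimately have "closedin (top_of_set (\<Union>T)) {y \<in> topspace (top_of_set (\<Union>T)). proj T \<Phi> y \<in> f ` C}"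
      using pre by (simp add: closed_subset)
    moreover have "f ` C \<subseteq> topspace (pseudo_manifold T \<Phi>)"
      using continuous_map_image_subset_topspace[OF cont] C type_component_subset_topspace[OF \<kappa>] by blast
    ultimately show "closedin (pseudo_manifold T \<Phi>) (f ` C)"
      using quotient_map_closedin_iff[OF quotient_map_proj, of "f ` C"] by blast
  qed
  have "embedding_map (subtopology Q (type_component \<kappa>)) (pseudo_manifold T \<Phi>) f"
    using injective_closed_imp_embedding_map[OF continuous_map_from_subtopology[OF cont] closed] inj top
    by simp
  then show ?thesis
    unfolding embedded_normal_hypersurface_def
    using f_class normal_disc_disc all_disc_types_iff
    by (intro exI[of _ f] exI[of _ "\<lambda>\<nu> x. x"]) (auto simp: component_types_def)
qed

section \<open>The induced representation and the number of components\<close>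

lemma induced_rep_class:
  assumes "\<gamma> \<in> dual_loops T \<Phi> \<sigma>\<^sub>0" "\<nu> \<in> disc_types k \<sigma>\<^sub>0"
  shows "induced_rep k T \<Phi> \<sigma>\<^sub>0 (dual_homotopy n T \<Phi> \<sigma>\<^sub>0 `` {\<gamma>}) \<nu> = act (projectivity T \<Phi> \<gamma>) \<nu>"
proof -
  have "\<Union>\<nu> = verts \<sigma>\<^sub>0"
    using Union_bipartition assms(2) unfolding disc_types_def .
  then have "act (restrict (projectivity T \<Phi> \<gamma>) (verts \<sigma>\<^sub>0)) \<nu> = act (projectivity T \<Phi> \<gamma>) \<nu>"
    by (intro act_cong) auto
  then show ?thesis
    using assms(2) by (simp add: induced_rep_def symmetric_rep_class[OF assms(1)])
qed

text \<open>A loop moves types only within their class; injectivity on a finite set turns the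
  inclusion into equality.\<close>

lemma induced_rep_component_types:
  assumes "\<sigma>\<^sub>0 \<in> T" "\<nu> \<in> all_disc_types k T" "\<gamma> \<in> dual_loops T \<Phi> \<sigma>\<^sub>0"
  shows "induced_rep k T \<Phi> \<sigma>\<^sub>0 (dual_homotopy n T \<Phi> \<sigma>\<^sub>0 `` {\<gamma>}) ` component_types k T \<Phi> \<sigma>\<^sub>0 (type_component \<nu>)
     = component_types k T \<Phi> \<sigma>\<^sub>0 (type_component \<nu>)" (is "_ ` ?C = _")
proof -
  have C: "?C = {\<mu> \<in> disc_types k \<sigma>\<^sub>0. (\<nu>, \<mu>) \<in> type_rel}"
    using component_types_type_component[OF assms(1,2)] .
  have g: "dual_path T \<Phi> \<sigma>\<^sub>0 \<gamma> \<sigma>\<^sub>0" using assms(3) by (simp add: dual_loops_def)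
  note b = path_disc_types[OF g]
  have "finite (disc_types k \<sigma>\<^sub>0)"
    using simplex_verts(4)[OF assms(1)] finite_bipartitions by (simp add: disc_types_def)
  then have "finite ?C" using C by simp
  moreover have "act (projectivity T \<Phi> \<gamma>) ` ?C \<subseteq> ?C"
    unfolding C using bij_betw_apply[OF b] path_type_rel[OF g] type_rel_trans by blast
  moreover have "inj_on (act (projectivity T \<Phi> \<gamma>)) ?C"
    using bij_betw_imp_inj_on[OF b] C by (auto intro: inj_on_subset)
  ultimately have "act (projectivity T \<Phi> \<gamma>) ` ?C = ?C"
    by (rule endo_inj_surj)
  moreover have "induced_rep k T \<Phi> \<sigma>\<^sub>0 (dual_homotopy n T \<Phi> \<sigma>\<^sub>0 `` {\<gamma>}) ` ?C
     = act (projectivity T \<Phi> \<gamma>) ` ?C"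
    using induced_rep_class[OF assms(3)] C by (intro image_cong) auto
  ultimately show ?thesis by simp
qed

text \<open>Two types of the base simplex lie in the same component exactly when some loop carries
  one to the other.\<close>

lemma induced_rep_trivial_iff:
  assumes "\<sigma>\<^sub>0 \<in> T"
  shows "induced_rep k T \<Phi> \<sigma>\<^sub>0 ` carrier (dual_pi1 n T \<Phi> \<sigma>\<^sub>0) = {\<one>\<^bsub>BijGroup (disc_types k \<sigma>\<^sub>0)\<^esub>}
    \<longleftrightarrow> inj_on type_component (disc_types k \<sigma>\<^sub>0)"
proof -
  let ?cl = "\<lambda>\<gamma>. dual_homotopy n T \<Phi> \<sigma>\<^sub>0 `` {\<gamma>}"
  have car: "carrier (dual_pi1 n T \<Phi> \<sigma>\<^sub>0) = ?cl ` dual_loops T \<Phi> \<sigma>\<^sub>0"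
    by (auto simp: dual_pi1_def quotient_def)
  have one: "\<one>\<^bsub>BijGroup (disc_types k \<sigma>\<^sub>0)\<^esub> = (\<lambda>\<nu>\<in>disc_types k \<sigma>\<^sub>0. \<nu>)"
    by (simp add: BijGroup_def)
  have all: "\<nu> \<in> disc_types k \<sigma>\<^sub>0 \<Longrightarrow> \<nu> \<in> all_disc_types k T" for \<nu>
    using assms all_disc_types_iff by blast
  \<comment> \<open>The constant loop keeps the image from being empty, so it is a singleton as soon
    as the values agree.\<close>
  have loop: "[] \<in> dual_loops T \<Phi> \<sigma>\<^sub>0" using assms by (simp add: dual_loops_def)
  have image_singleton: "f ` dual_loops T \<Phi> \<sigma>\<^sub>0 = {c} \<longleftrightarrow> (\<forall>\<gamma>\<in>dual_loops T \<Phi> \<sigma>\<^sub>0. f \<gamma> = c)"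
    for f :: "'a set list \<Rightarrow> 'a set set \<Rightarrow> 'a set set" and c
  proof
    assume "\<forall>\<gamma>\<in>dual_loops T \<Phi> \<sigma>\<^sub>0. f \<gamma> = c"
    then have "f ` dual_loops T \<Phi> \<sigma>\<^sub>0 = (\<lambda>_. c) ` dual_loops T \<Phi> \<sigma>\<^sub>0"
      by (intro image_cong) auto
    with loop show "f ` dual_loops T \<Phi> \<sigma>\<^sub>0 = {c}" by blast
  qed blast
  have "induced_rep k T \<Phi> \<sigma>\<^sub>0 ` carrier (dual_pi1 n T \<Phi> \<sigma>\<^sub>0) = {\<one>\<^bsub>BijGroup (disc_types k \<sigma>\<^sub>0)\<^esub>}
    \<longleftrightarrow> (\<forall>\<gamma>\<in>dual_loops T \<Phi> \<sigma>\<^sub>0. induced_rep k T \<Phi> \<sigma>\<^sub>0 (?cl \<gamma>) = (\<lambda>\<nu>\<in>disc_types k \<sigma>\<^sub>0. \<nu>))"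
    unfolding car one image_image by (rule image_singleton)
  also have "\<dots> \<longleftrightarrow> (\<forall>\<gamma>\<in>dual_loops T \<Phi> \<sigma>\<^sub>0. \<forall>\<nu>\<in>disc_types k \<sigma>\<^sub>0. act (projectivity T \<Phi> \<gamma>) \<nu> = \<nu>)"
  proof (intro ball_cong refl)
    fix \<gamma> assume g: "\<gamma> \<in> dual_loops T \<Phi> \<sigma>\<^sub>0"
    \<comment> \<open>Both functions are extensional, so they are compared on disc types
      only.\<close>
    have "induced_rep k T \<Phi> \<sigma>\<^sub>0 (?cl \<gamma>) = restrict (induced_rep k T \<Phi> \<sigma>\<^sub>0 (?cl \<gamma>)) (disc_types k \<sigma>\<^sub>0)"
      by (simp add: induced_rep_def)
    then show "induced_rep k T \<Phi> \<sigma>\<^sub>0 (?cl \<gamma>) = (\<lambda>\<nu>\<in>disc_types k \<sigma>\<^sub>0. \<nu>)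
      \<longleftrightarrow> (\<forall>\<nu>\<in>disc_types k \<sigma>\<^sub>0. act (projectivity T \<Phi> \<gamma>) \<nu> = \<nu>)"
      using induced_rep_class[OF g] by (metis (no_types, lifting) restrict_apply' restrict_ext)
  qed
  also have "\<dots> \<longleftrightarrow> inj_on type_component (disc_types k \<sigma>\<^sub>0)"
  proof
    assume triv: "\<forall>\<gamma>\<in>dual_loops T \<Phi> \<sigma>\<^sub>0. \<forall>\<nu>\<in>disc_types k \<sigma>\<^sub>0. act (projectivity T \<Phi> \<gamma>) \<nu> = \<nu>"
    show "inj_on type_component (disc_types k \<sigma>\<^sub>0)"
    proof (rule inj_onI)
      fix \<nu> \<mu> assume n: "\<nu> \<in> disc_types k \<sigma>\<^sub>0" "\<mu> \<in> disc_types k \<sigma>\<^sub>0" "type_component \<nu> = type_component \<mu>"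
      then have "(\<nu>, \<mu>) \<in> type_rel" using type_component_eq_iff all by blast
      then obtain \<gamma> where "\<gamma> \<in> dual_loops T \<Phi> \<sigma>\<^sub>0" "\<mu> = act (projectivity T \<Phi> \<gamma>) \<nu>"
        using type_rel_loop assms n by metis
      then show "\<nu> = \<mu>" using triv n(1) by simp
    qed
  next
    assume inj: "inj_on type_component (disc_types k \<sigma>\<^sub>0)"
    show "\<forall>\<gamma>\<in>dual_loops T \<Phi> \<sigma>\<^sub>0. \<forall>\<nu>\<in>disc_types k \<sigma>\<^sub>0. act (projectivity T \<Phi> \<gamma>) \<nu> = \<nu>"
    proof (intro ballI)
      fix \<gamma> \<nu> assume "\<gamma> \<in> dual_loops T \<Phi> \<sigma>\<^sub>0" and n: "\<nu> \<in> disc_types k \<sigma>\<^sub>0"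
      then have g: "dual_path T \<Phi> \<sigma>\<^sub>0 \<gamma> \<sigma>\<^sub>0" by (simp add: dual_loops_def)
      show "act (projectivity T \<Phi> \<gamma>) \<nu> = \<nu>"
        using inj_onD[OF inj type_component_eq[OF path_type_rel[OF g n], symmetric]]
          bij_betw_apply[OF path_disc_types[OF g] n] n by blast
    qed
  qed
  finally show ?thesis .
qed

end

theorem proposition20:
  fixes n k :: nat
    and T :: "'a::euclidean_space set set"
    and \<omega> :: "'a set \<Rightarrow> 'a list set"
    and \<Phi> :: "'a set \<Rightarrow> 'a \<Rightarrow> 'a"
    and \<sigma>\<^sub>0 :: "'a set"
  assumes "n \<ge> 3"
    and "even_triangulation n T \<omega> \<Phi>"
    and "\<sigma>\<^sub>0 \<in> T"
    and "1 < k" and "2 * k \<le> n + 1"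
  shows "(\<forall>Q\<^sub>0\<in>connected_components_of (hypersurface k T \<Phi>).
            \<forall>g\<in>carrier (dual_pi1 n T \<Phi> \<sigma>\<^sub>0).
              induced_rep k T \<Phi> \<sigma>\<^sub>0 g ` component_types k T \<Phi> \<sigma>\<^sub>0 Q\<^sub>0
                = component_types k T \<Phi> \<sigma>\<^sub>0 Q\<^sub>0) \<and>
         (induced_rep k T \<Phi> \<sigma>\<^sub>0 ` carrier (dual_pi1 n T \<Phi> \<sigma>\<^sub>0)
              = {\<one>\<^bsub>BijGroup (disc_types k \<sigma>\<^sub>0)\<^esub>}
            \<longleftrightarrow> card (connected_components_of (hypersurface k T \<Phi>)) = card (bipartitions {..n} k)) \<and>
         (induced_rep k T \<Phi> \<sigma>\<^sub>0 ` carrier (dual_pi1 n T \<Phi> \<sigma>\<^sub>0)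
              = {\<one>\<^bsub>BijGroup (disc_types k \<sigma>\<^sub>0)\<^esub>}
            \<longrightarrow> (\<forall>Q\<^sub>0\<in>connected_components_of (hypersurface k T \<Phi>).
                   embedded_normal_hypersurface n k T \<Phi> Q\<^sub>0))"
proof -
  interpret normal_hypersurface n T \<Phi> k
    using assms by unfold_locales (auto simp: even_triangulation_def triangulation_def)
  have fin: "finite (disc_types k \<sigma>\<^sub>0)"
    using simplex_verts(4)[OF assms(3)] finite_bipartitions by (simp add: disc_types_def)
  \<comment> \<open>Enumerating the \<open>n + 1\<close> vertices by \<open>{..n}\<close> transports
    bipartitions and yields the number \<open>N\<close>.\<close>
  have N: "card (disc_types k \<sigma>\<^sub>0) = card (bipartitions {..n} k)"
  proof -
    obtain f where "bij_betw f (verts \<sigma>\<^sub>0) {..n}"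
      using simplex_verts(2,4)[OF assms(3)] finite_same_card_bij[of "verts \<sigma>\<^sub>0" "{..n}"] by auto
    then show ?thesis
      unfolding disc_types_def by (rule bij_betw_same_card[OF bij_betw_act])
  qed
  have triv: "induced_rep k T \<Phi> \<sigma>\<^sub>0 ` carrier (dual_pi1 n T \<Phi> \<sigma>\<^sub>0)
              = {\<one>\<^bsub>BijGroup (disc_types k \<sigma>\<^sub>0)\<^esub>} \<longleftrightarrow> inj_on type_component (disc_types k \<sigma>\<^sub>0)"
    by (rule induced_rep_trivial_iff[OF assms(3)])
  have "induced_rep k T \<Phi> \<sigma>\<^sub>0 g ` component_types k T \<Phi> \<sigma>\<^sub>0 Q\<^sub>0 = component_types k T \<Phi> \<sigma>\<^sub>0 Q\<^sub>0"
    if Q\<^sub>0: "Q\<^sub>0 \<in> connected_components_of Q" and g: "g \<in> carrier (dual_pi1 n T \<Phi> \<sigma>\<^sub>0)" for Q\<^sub>0 g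
  proof -
    obtain \<gamma> where "\<gamma> \<in> dual_loops T \<Phi> \<sigma>\<^sub>0" "g = dual_homotopy n T \<Phi> \<sigma>\<^sub>0 `` {\<gamma>}"
      using g by (auto simp: dual_pi1_def quotient_def)
    moreover obtain \<nu> where "\<nu> \<in> all_disc_types k T" "Q\<^sub>0 = type_component \<nu>"
      using Q\<^sub>0 connected_components by blast
    ultimately show ?thesis
      using induced_rep_component_types[OF assms(3)] by simp
  qed
  \<comment> \<open>The components are the image of the finite set of types of the base simplex, and
    a map on a finite set preserves cardinality exactly when it is injective.\<close>
  moreover have "inj_on type_component (disc_types k \<sigma>\<^sub>0) \<longleftrightarrow>
      card (connected_components_of Q) = card (bipartitions {..n} k)"
    unfolding components_meet_base[OF assms(3)] N[symmetric] using fin by (rule inj_on_iff_eq_card)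
  moreover have "embedded_normal_hypersurface n k T \<Phi> Q\<^sub>0"
    if inj: "inj_on type_component (disc_types k \<sigma>\<^sub>0)" and Q\<^sub>0: "Q\<^sub>0 \<in> connected_components_of Q" for Q\<^sub>0
  proof -
    obtain \<nu> where \<nu>: "\<nu> \<in> all_disc_types k T" "Q\<^sub>0 = type_component \<nu>"
      using Q\<^sub>0 connected_components by blast
    have "embedded_normal_hypersurface n k T \<Phi> (type_component \<nu>)"
      using type_rel_trivial_transport[OF inj assms(3)] \<nu>(1) by (rule embedded_component)
    then show ?thesis using \<nu>(2) by simp
  qed
  ultimately show ?thesis
    unfolding triv by blast
qed

end
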